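(* Let $N$ be large. There are irreducible polynomials $Q_1,Q_2\in\mathbb{A}$ of degree $N$ such that $$L(1, \chi_{Q_1})\geq e^{\gamma} (\log_2|Q_1|+ \log_3 |Q_1|)+ O(1),$$ and $$L(1, \chi_{Q_2})\leq \zeta_{\mathbb{A}}(2) e^{-\gamma} (\log_2 |Q_1|+ \log_3 |Q_1|+ O(1))^{-1}.$$
   Context: $q$ is a fixed prime power with $q\equiv 1 \pmod 4$, $\mathbb{A}=\mathbb{F}_q[T]$; implied constants depend at most on $q$. For $f\in\mathbb{A}\setminus\{0\}$, $|f|=q^{\deg f}$ (so $|Q_1|=|Q_2|=q^N$). $\log$ is the logarithm in base $q$ and $\log_j$ its $j$-fold iterate; $\gamma$ is Euler's constant. $\zeta_{\mathbb{A}}(s)=\sum_{f\text{ monic}}|f|^{-s}=(1-q^{1-s})^{-1}$. For $D\in\mathbb{A}$ and monic $f$, $\chi_D(f)=\left(\frac{D}{f}\right)$ is the Kronecker symbol: for $P$ monic irreducible, $\left(\frac{D}{P}\right)$ is $0$ if $P\mid D$, $1$ if $D$ is a nonzero square mod $P$, $-1$ otherwise, extended multiplicatively in $f$. $L(s,\chi_D)=\sum_{f\text{ monic}}\chi_D(f)|f|^{-s}$ (summed by increasing degree). *)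

theory Defs
  imports
    "HOL-Analysis.Analysis"
    "HOL-Computational_Algebra.Polynomial"
    "HOL-Number_Theory.Cong"
begin

text \<open>
  The ring \<open>\<bbbA> = F\<^sub>q[T]\<close> is \<^typ>\<open>'a poly\<close> for a type \<open>'a :: {field, finite}\<close>, so that
  \<open>q = CARD('a)\<close>, which is then automatically a prime power.
\<close>

abbreviation monic :: "'a::field poly \<Rightarrow> bool" where
  "monic f \<equiv> lead_coeff f = 1"

text \<open>The absolute value is meant for nonzero polynomials only; note that \<open>poly_abs 0 = 1\<close> here.\<close>

definition poly_abs :: "'a::{field,finite} poly \<Rightarrow> real" where
  "poly_abs f = real CARD('a) ^ degree f"

definition residue_symbol :: "'a::{field,finite} poly \<Rightarrow> 'a poly \<Rightarrow> int" where
  "residue_symbol D P =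
     (if P dvd D then 0 else if \<exists>X. [X ^ 2 = D] (mod P) then 1 else - 1)"

text \<open>
  The completely multiplicative extension to \<open>f \<noteq> 0\<close>. The exponent is the multiplicity of \<open>P\<close> in
  \<open>f\<close>; the library constant of that name requires \<open>'a\<close> to be of a factorial ring class,
  which would needlessly constrain the coefficient field.
\<close>

definition kronecker_symbol :: "'a::{field,finite} poly \<Rightarrow> 'a poly \<Rightarrow> int" where
  "kronecker_symbol D f =
     (\<Prod>P | monic P \<and> irreducible P \<and> P dvd f. residue_symbol D P ^ Max {k. P ^ k dvd f})"

text \<open>
  Only real arguments are needed. The series is summed by increasing degree; at \<open>s = 1\<close> it is
  not absolutely convergent in general, but for an irreducible \<open>D\<close> of positive degree (and odd
  \<open>q\<close>) the coefficients of degree at least \<^term>\<open>degree D\<close> vanish.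
\<close>

definition L_chi :: "real \<Rightarrow> 'a::{field,finite} poly \<Rightarrow> real" where
  "L_chi s D =
     (\<Sum>n. \<Sum>f | monic f \<and> degree f = n. real_of_int (kronecker_symbol D f) * poly_abs f powr (- s))"

definition zeta_poly :: "'a::{field,finite} itself \<Rightarrow> real \<Rightarrow> real" where
  "zeta_poly _ s = (\<Sum>\<^sub>\<infinity>f\<in>{f :: 'a poly. monic f}. poly_abs f powr (- s))"

definition iter_log :: "real \<Rightarrow> nat \<Rightarrow> real \<Rightarrow> real" where
  "iter_log b j = log b ^^ j"

end

theory Submission
  imports
    "HOL-Algebra.Algebraic_Closure_Type"
    "HOL-Real_Asymp.Real_Asymp"
    Defs
begin

text \<open>
  Choose \<open>n = log\<^sub>2 \<bar>Q\<bar> + log\<^sub>3 \<bar>Q\<bar> + O(1)\<close>, about the largest degree for which at most \<open>N / 2\<close>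
  irreducible \<open>P\<close> have degree \<open>\<le> n\<close>. If \<open>\<chi>\<^sub>Q(P) = 1\<close> for all of them, the part of
  \<open>log L(1, \<chi>\<^sub>Q) = \<Sum>\<^sub>m (\<Sum>\<^sub>f \<Lambda>(f) \<chi>\<^sub>Q(f)) / (m q\<^sup>m)\<close> with \<open>m \<le> n\<close> is the harmonic number \<open>H\<^sub>n\<close>, because
  \<open>\<Lambda>\<close> sums to \<open>q\<^sup>m\<close> in degree \<open>m\<close>. If all these symbols are \<open>-1\<close>, it is \<open>-H\<^sub>n\<close> plus at most
  \<open>-log (1 - 1/q) = log \<zeta>(2)\<close>. That such a \<open>Q\<close> exists, with a harmless remaining part, follows by
  averaging over all irreducible \<open>Q\<close> of degree \<open>N\<close> with the weight \<open>\<Prod>\<^sub>P (1 \<plusminus> \<chi>\<^sub>Q(P))\<close>: after reciprocity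
  one needs \<open>\<Sum>\<^sub>Q (f/Q) \<lless> q\<^bsup>N/2\<^esup> deg f / N\<close> for squarefree \<open>f\<close> of degree larger than \<open>N\<close>, which is
  the Riemann hypothesis for hyperelliptic curves. It is obtained by Stepanov's method in the form
  of Bombieri: the auxiliary polynomial is built so that a power of it with exponent \<open>q\<^sup>s\<close> vanishes
  modulo \<open>Q\<close>, and the linear system for its coefficients is solved by the pigeonhole principle.
\<close>

section \<open>Arithmetic of polynomials over a finite field\<close>

text \<open>Since log |Q| = N, the quantity log_2 |Q| + log_3 |Q| is log N + log log N, which solves
  q^n = N n up to O(1). The equation arises because about q^n / n primes have degree at most n:
  opening the product over K primes produces 2^K terms, each of size q^(N/2) up to a polynomial
  factor, so K may grow like a multiple of N. The obstacle is the range of degrees between n and N.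
  For a single Q the Riemann hypothesis bounds the contribution of degree m by about N q^(-m/2) / m,
  which becomes small only near m = 2 log N, well beyond the cutoff n. These degrees are therefore
  controlled on average only, and what is extracted for one Q is a one-sided bound, in the direction
  that the theorem asks for. Degrees above N are negligible for every Q. An error O(1/n) in log L(1)
  is harmless because n exp(O(1/n)) = n + O(1). The congruence q = 1 mod 4 removes the sign from the
  reciprocity law.\<close>

lemma finite_field_power_card_minus_1:
  fixes c :: "'a::{field,finite}"
  assumes "c \<noteq> 0"
  shows "c ^ (CARD('a) - 1) = 1"
proof -
  have "(\<Prod>x\<in>-{0}. c * x) = (\<Prod>x\<in>-{0::'a}. x)"
    by (rule prod.reindex_bij_witness[of _ "\<lambda>x. x / c" "\<lambda>x. c * x"]) (use assms in auto)
  hence "c ^ card (-{0::'a}) * (\<Prod>x\<in>-{0::'a}. x) = (\<Prod>x\<in>-{0::'a}. x)"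
    by (simp add: prod.distrib)
  moreover have "(\<Prod>x\<in>-{0::'a}. x) \<noteq> 0"
    by (simp add: prod_zero_iff)
  ultimately have "c ^ card (-{0::'a}) = 1"
    by simp
  thus ?thesis
    by (simp add: Compl_eq_Diff_UNIV card_Diff_singleton)
qed

lemma finite_field_power_card [simp]:
  fixes c :: "'a::{field,finite}"
  shows "c ^ CARD('a) = c"
proof (cases "c = 0")
  case False
  have "c ^ CARD('a) = c * c ^ (CARD('a) - 1)"
    by (metis Suc_pred' finite_UNIV_card_ge_0 finite_class.finite_UNIV power_Suc)
  thus ?thesis
    using finite_field_power_card_minus_1[OF False] by simp
qed auto

lemma finite_field_power_card_power [simp]:
  fixes c :: "'a::{field,finite}"
  shows "c ^ (CARD('a) ^ t) = c"
  by (induction t) (simp_all add: power_mult)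

text \<open>In the field both x and x + 1 are fixed by the q-th power, so the middle terms of the
  expansion of (x + 1)^q form a polynomial of degree below q with q roots. Additivity of the q-th
  power follows without mention of the characteristic.\<close>

lemma of_nat_card_choose_eq_0:
  assumes "0 < k" "k < CARD('a::{field,finite})"
  shows "(of_nat (CARD('a) choose k) :: 'a) = 0"
proof -
  define p :: "'a poly" where "p = (\<Sum>k\<in>{0<..<CARD('a)}. monom (of_nat (CARD('a) choose k)) k)"
  have binom: "(x + 1) ^ CARD('a) = x ^ CARD('a) + 1 + poly p x" for x :: 'a
  proof -
    have "(x + 1) ^ CARD('a) = (\<Sum>k\<le>CARD('a). of_nat (CARD('a) choose k) * x ^ k)"
      using binomial_ring[of x 1 "CARD('a)"] by simp
    also have "{..CARD('a)} = insert 0 (insert (CARD('a)) {0<..<CARD('a)})"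
      by auto
    also have "(\<Sum>k\<in>\<dots>. of_nat (CARD('a) choose k) * x ^ k) = x ^ CARD('a) + 1 + poly p x"
      unfolding p_def by (subst sum.insert; simp add: poly_sum poly_monom)+
    finally show ?thesis .
  qed
  have "poly p x = 0" for x
    using binom[of x] by simp
  hence "{x. poly p x = 0} = UNIV"
    by auto
  moreover have "degree p < CARD('a)"
    unfolding p_def by (intro degree_sum_less) (auto intro: le_less_trans[OF degree_monom_le])
  ultimately have "p = 0"
    using card_poly_roots_bound[of p] by force
  hence "coeff p k = 0"
    by simp
  thus ?thesis
    unfolding p_def using assms by (simp add: coeff_sum if_distrib cong: if_cong)
qed

text \<open>The map \<open>\<iota>\<close> only serves to transport the vanishing of the binomial coefficients to \<open>'b\<close>.\<close>

lemma add_power_card: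
  fixes x y :: "'b::comm_ring_1" and \<iota> :: "'a::{field,finite} \<Rightarrow> 'b"
  assumes "\<iota> 0 = 0" "\<And>n. \<iota> (of_nat n) = of_nat n"
  shows "(x + y) ^ CARD('a) = x ^ CARD('a) + y ^ CARD('a)"
proof -
  have "(of_nat (CARD('a) choose k) :: 'b) = 0" if "0 < k" "k < CARD('a)" for k
    using of_nat_card_choose_eq_0[where 'a='a, OF that] assms by metis
  hence *: "(\<Sum>k\<in>{0<..<CARD('a)}. of_nat (CARD('a) choose k) * x ^ k * y ^ (CARD('a) - k)) = 0"
    by (intro sum.neutral) auto
  have "(x + y) ^ CARD('a) = (\<Sum>k\<le>CARD('a). of_nat (CARD('a) choose k) * x ^ k * y ^ (CARD('a) - k))"
    by (rule binomial_ring)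
  also have "{..CARD('a)} = insert 0 (insert (CARD('a)) {0<..<CARD('a)})"
    by auto
  also have "(\<Sum>k\<in>\<dots>. of_nat (CARD('a) choose k) * x ^ k * y ^ (CARD('a) - k)) = x ^ CARD('a) + y ^ CARD('a)"
    by (subst sum.insert; simp add: *)+
  finally show ?thesis .
qed

lemma add_power_card_power_poly:
  fixes x y :: "'a::{field,finite} poly"
  shows "(x + y) ^ (CARD('a) ^ t) = x ^ (CARD('a) ^ t) + y ^ (CARD('a) ^ t)"
proof (induction t)
  case (Suc t)
  thus ?case
    by (simp add: power_mult power_mult[of _ "CARD('a) ^ t" "CARD('a)"] mult.commute[of "CARD('a)"]
        add_power_card[of "\<lambda>x::'a. [:x:]"] of_nat_poly)
qed simp

lemma add_power_card_power_ac:
  fixes x y :: "'a::{field,finite} alg_closure"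
  shows "(x + y) ^ (CARD('a) ^ t) = x ^ (CARD('a) ^ t) + y ^ (CARD('a) ^ t)"
proof (induction t)
  case (Suc t)
  thus ?case
    by (simp add: power_mult power_mult[of _ "CARD('a) ^ t" "CARD('a)"] mult.commute[of "CARD('a)"]
        add_power_card[of "to_ac :: 'a \<Rightarrow> _"])
qed simp

lemma sum_power_card_power_poly:
  fixes h :: "'i \<Rightarrow> 'a::{field,finite} poly"
  shows "(\<Sum>i\<in>I. h i) ^ (CARD('a) ^ t) = (\<Sum>i\<in>I. h i ^ (CARD('a) ^ t))"
  by (induction I rule: infinite_finite_induct) (simp_all add: add_power_card_power_poly)

text \<open>The q^t-th power is additive and fixes the coefficients, so it only substitutes for the
  variable. Stepanov's method reads f^k in this way as f(y) with y = T^k.\<close>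

lemma poly_power_card_power:
  fixes f :: "'a::{field,finite} poly"
  shows "f ^ (CARD('a) ^ t) = pcompose f (monom 1 (CARD('a) ^ t))"
proof (induction f)
  case (pCons a f)
  have "pCons a f ^ (CARD('a) ^ t) = ([:a:] + [:0, 1:] * f) ^ (CARD('a) ^ t)"
    by simp
  also have "\<dots> = [:a:] ^ (CARD('a) ^ t) + [:0, 1:] ^ (CARD('a) ^ t) * f ^ (CARD('a) ^ t)"
    by (simp only: add_power_card_power_poly power_mult_distrib)
  also have "[:a:] ^ (CARD('a) ^ t) = [:a:]"
    by (simp add: poly_const_pow)
  also have "[:0, 1:] ^ (CARD('a) ^ t) = (monom 1 (CARD('a) ^ t) :: 'a poly)"
    by (simp add: monom_altdef)
  finally show ?case
    using pCons by (simp add: pcompose_pCons)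
qed simp

text \<open>Stated through coefficients so that the zero polynomial belongs to it even for n = 0;
  this makes it a vector space of dimension n in every case.\<close>

definition polys_below :: "nat \<Rightarrow> 'a::zero poly set" where
  "polys_below n = {f. \<forall>i\<ge>n. coeff f i = 0}"

lemma polys_below_0 [simp]: "polys_below 0 = {0}"
  by (auto simp: polys_below_def poly_eq_iff)

lemma polys_below_Suc: "polys_below (Suc n) = (\<lambda>(a, f). pCons a f) ` (UNIV \<times> polys_below n)"
proof (intro equalityI subsetI)
  fix f :: "'a poly" assume f: "f \<in> polys_below (Suc n)"
  obtain a g where "f = pCons a g" by (cases f)
  with f show "f \<in> (\<lambda>(a, f). pCons a f) ` (UNIV \<times> polys_below n)"
    by (force simp: polys_below_def coeff_pCons split: nat.splits)
qed (auto simp: polys_below_def coeff_pCons split: nat.splits)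

lemma card_polys_below: "card (polys_below n :: 'a::{field,finite} poly set) = CARD('a) ^ n"
  and finite_polys_below [simp]: "finite (polys_below n :: 'a::{field,finite} poly set)"
proof (induction n)
  case (Suc n)
  {
    case 1
    show ?case
      unfolding polys_below_Suc
      by (subst card_image) (use Suc in \<open>auto simp: inj_on_def card_cartesian_product\<close>)
  next
    case 2
    show ?case
      unfolding polys_below_Suc using Suc by auto
  }
qed auto

lemma polys_below_iff: "f \<in> polys_below n \<longleftrightarrow> f = 0 \<or> degree f < n"
  by (auto simp: polys_below_def coeff_eq_0) (metis leading_coeff_0_iff not_le)

lemma monic_of_degree_eq: "{f :: 'a::field poly. monic f \<and> degree f = n} = (\<lambda>g. monom 1 n + g) ` polys_below n"
proof (intro equalityI subsetI)
  fix f :: "'a poly" assume "f \<in> {f. monic f \<and> degree f = n}"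
  hence "f - monom 1 n \<in> polys_below n"
    by (auto simp: polys_below_def coeff_eq_0)
  thus "f \<in> (\<lambda>g. monom 1 n + g) ` polys_below n"
    by (force simp: image_iff)
next
  fix f :: "'a poly" assume "f \<in> (\<lambda>g. monom 1 n + g) ` polys_below n"
  then obtain g where g: "f = monom 1 n + g" "g \<in> polys_below n" by auto
  have "coeff f n = 1" "\<forall>i>n. coeff f i = 0"
    using g by (auto simp: polys_below_def)
  hence "degree f = n"
    by (intro antisym degree_le le_degree) auto
  thus "f \<in> {f. monic f \<and> degree f = n}"
    using \<open>coeff f n = 1\<close> by auto
qed

lemma finite_monic_of_degree [simp]: "finite {f :: 'a::{field,finite} poly. monic f \<and> degree f = n}"
  by (simp add: monic_of_degree_eq)

lemma card_monic_of_degree: "card {f :: 'a::{field,finite} poly. monic f \<and> degree f = n} = CARD('a) ^ n"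
  by (simp add: monic_of_degree_eq card_image card_polys_below)

section \<open>Evaluation at points of the algebraic closure\<close>

definition ac_eval :: "'a::field poly \<Rightarrow> 'a alg_closure \<Rightarrow> 'a alg_closure" where
  "ac_eval f x = poly (map_poly to_ac f) x"

lemma ac_eval_0 [simp]: "ac_eval 0 x = 0"
  and ac_eval_1 [simp]: "ac_eval 1 x = 1"
  by (simp_all add: ac_eval_def map_poly_1')

lemma ac_eval_pCons [simp]: "ac_eval (pCons a f) x = to_ac a + x * ac_eval f x"
  by (simp add: ac_eval_def map_poly_pCons)

lemma ac_eval_add [simp]: "ac_eval (f + g) x = ac_eval f x + ac_eval g x"
proof -
  have "map_poly to_ac (f + g) = map_poly to_ac f + map_poly to_ac g"
    by (simp add: poly_eq_iff coeff_map_poly)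
  thus ?thesis by (simp add: ac_eval_def)
qed

lemma ac_eval_uminus [simp]: "ac_eval (-f) x = -ac_eval f x"
  using ac_eval_add[of f "-f" x] by (simp add: eq_neg_iff_add_eq_0 add.commute del: ac_eval_add)

lemma ac_eval_diff [simp]: "ac_eval (f - g) x = ac_eval f x - ac_eval g x"
  using ac_eval_add[of f "-g" x] by simp

lemma ac_eval_smult [simp]: "ac_eval (smult a f) x = to_ac a * ac_eval f x"
  by (induction f) (auto simp: algebra_simps)

lemma ac_eval_mult [simp]: "ac_eval (f * g) x = ac_eval f x * ac_eval g x"
  by (induction f) (auto simp: algebra_simps)

lemma ac_eval_power [simp]: "ac_eval (f ^ n) x = ac_eval f x ^ n"
  by (induction n) auto

lemma ac_eval_frobenius:
  fixes f :: "'a::{field,finite} poly"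
  shows "ac_eval f x ^ (CARD('a) ^ t) = ac_eval f (x ^ (CARD('a) ^ t))"
proof (induction f)
  case (pCons a f)
  thus ?case
    by (simp add: add_power_card_power_ac power_mult_distrib flip: to_ac_power)
qed auto

section \<open>Residue fields inside the algebraic closure\<close>

lemma one_less_card_field: "1 < CARD('a::{field,finite})"
proof -
  have "card {0, 1 :: 'a} \<le> CARD('a)"
    by (rule card_mono) auto
  thus ?thesis by simp
qed

lemma irreducible_imp_degree_pos:
  assumes "irreducible (Q :: 'a::field poly)"
  shows "degree Q > 0"
  using assms by (metis gr0I irreducible_def is_unit_iff_degree)

lemma irreducible_has_root:
  assumes "irreducible (Q :: 'a::field poly)"
  shows "\<exists>\<alpha>. ac_eval Q \<alpha> = 0"
proof -
  have "degree (map_poly to_ac Q) > 0"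
    using irreducible_imp_degree_pos[OF assms] by (simp add: degree_map_poly)
  thus ?thesis
    unfolding ac_eval_def by (rule alg_closed_imp_poly_has_root)
qed

text \<open>So the residue field of \<open>Q\<close> is identified with a subfield of the algebraic closure.\<close>

lemma ac_eval_eq_0_iff_dvd:
  assumes Q: "irreducible (Q :: 'a::field poly)" "ac_eval Q \<alpha> = 0"
  shows "ac_eval f \<alpha> = 0 \<longleftrightarrow> Q dvd f"
proof
  assume f: "ac_eval f \<alpha> = 0"
  \<comment> \<open>\<open>p\<close> generates the ideal of polynomials vanishing at \<alpha>. It
    divides the irreducible Q and is not a unit, so Q divides it in turn.\<close>
  define p where "p = (ARG_MIN degree p. p \<noteq> 0 \<and> ac_eval p \<alpha> = 0)"
  have "Q \<noteq> 0 \<and> ac_eval Q \<alpha> = 0"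
    using Q by auto
  hence p: "p \<noteq> 0" "ac_eval p \<alpha> = 0"
    and min: "\<And>r. r \<noteq> 0 \<Longrightarrow> ac_eval r \<alpha> = 0 \<Longrightarrow> degree p \<le> degree r"
    using arg_min_nat_lemma[of "\<lambda>p. p \<noteq> 0 \<and> ac_eval p \<alpha> = 0" Q degree]
    unfolding p_def by auto
  have dvd: "p dvd g" if "ac_eval g \<alpha> = 0" for g
  proof -
    have "ac_eval (g mod p) \<alpha> = 0"
      using that p by (simp flip: minus_div_mult_eq_mod)
    hence "g mod p = 0"
      using min[of "g mod p"] degree_mod_less[OF p(1), of g] by (metis leD)
    thus ?thesis
      by (rule mod_0_imp_dvd)
  qed
  have "\<not>is_unit p"
  proof
    assume "is_unit p"
    hence "degree p = 0"
      using p(1) by (simp add: is_unit_iff_degree)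
    then obtain c where c: "p = [:c:]"
      by (rule degree_eq_zeroE)
    show False
      using p unfolding c by simp
  qed
  hence "Q dvd p"
    using irreducibleD'[OF Q(1) dvd[OF Q(2)]] by blast
  thus "Q dvd f"
    using dvd[OF f] by (rule dvd_trans)
next
  assume "Q dvd f"
  then obtain g where "f = Q * g" ..
  thus "ac_eval f \<alpha> = 0"
    using Q by simp
qed

text \<open>Euclid's lemma, read off from the values at a root of Q: they lie in a field.\<close>

lemma irreducible_dvd_mult_iff:
  assumes "irreducible (Q :: 'a::field poly)"
  shows "Q dvd f * g \<longleftrightarrow> Q dvd f \<or> Q dvd g"
proof -
  obtain \<alpha> where "ac_eval Q \<alpha> = 0"
    using irreducible_has_root[OF assms] by blast
  thus ?thesis
    by (simp flip: ac_eval_eq_0_iff_dvd[OF assms])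
qed

lemma irreducible_dvd_power:
  assumes "irreducible (Q :: 'a::field poly)" "Q dvd f ^ n"
  shows "Q dvd f"
  using assms(2)
proof (induction n)
  case 0
  thus ?case using assms(1) by (simp add: irreducible_def)
qed (auto simp: irreducible_dvd_mult_iff[OF assms(1)])

lemma irreducible_dvd_prod:
  assumes "irreducible (Q :: 'a::field poly)" "Q dvd prod h A"
  shows "\<exists>x\<in>A. Q dvd h x"
  using assms(2)
proof (induction A rule: infinite_finite_induct)
  case empty
  thus ?case using assms(1) by (simp add: irreducible_def)
next
  case infinite
  thus ?case using assms(1) by (simp add: irreducible_def)
qed (auto simp: irreducible_dvd_mult_iff[OF assms(1)])

lemma cong_iff_ac_eval_eq:
  assumes "irreducible (Q :: 'a::field poly)" "ac_eval Q \<alpha> = 0"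
  shows "[f = g] (mod Q) \<longleftrightarrow> ac_eval f \<alpha> = ac_eval g \<alpha>"
  by (simp add: cong_iff_dvd_diff flip: ac_eval_eq_0_iff_dvd[OF assms])

lemma card_power_eq_self:
  assumes "k > 0"
  shows "finite {x :: 'a::{field,finite} alg_closure. x ^ (CARD('a) ^ k) = x}"
    and "card {x :: 'a::{field,finite} alg_closure. x ^ (CARD('a) ^ k) = x} \<le> CARD('a) ^ k"
proof -
  define p :: "'a alg_closure poly" where "p = monom 1 (CARD('a) ^ k) - [:0, 1:]"
  have "1 < CARD('a) ^ k"
    using assms one_less_card_field by (rule one_less_power[rotated])
  hence "coeff p (CARD('a) ^ k) = 1" and deg: "degree p \<le> CARD('a) ^ k"
    unfolding p_def using assms by (auto simp: coeff_pCons split: nat.splits intro!: degree_diff_le degree_monom_le)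
  hence "p \<noteq> 0"
    by auto
  have eq: "{x :: 'a alg_closure. x ^ (CARD('a) ^ k) = x} = {x. poly p x = 0}"
    by (simp add: p_def poly_monom)
  show "finite {x :: 'a alg_closure. x ^ (CARD('a) ^ k) = x}"
    unfolding eq using \<open>p \<noteq> 0\<close> by (rule poly_roots_finite)
  show "card {x :: 'a alg_closure. x ^ (CARD('a) ^ k) = x} \<le> CARD('a) ^ k"
    unfolding eq using card_poly_roots_bound[OF \<open>p \<noteq> 0\<close>] deg by (rule order.trans)
qed

context
  fixes Q :: "'a::{field,finite} poly" and \<alpha> :: "'a alg_closure"
  assumes Q: "irreducible Q" "ac_eval Q \<alpha> = 0"
begin

lemma range_ac_eval_eq: "range (\<lambda>f. ac_eval f \<alpha>) = (\<lambda>f. ac_eval f \<alpha>) ` polys_below (degree Q)"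
proof (intro equalityI subsetI)
  fix x assume "x \<in> range (\<lambda>f. ac_eval f \<alpha>)"
  then obtain f where f: "x = ac_eval f \<alpha>" by auto
  have "x = ac_eval (f mod Q) \<alpha>"
    unfolding f using Q by (simp flip: minus_div_mult_eq_mod)
  moreover have "f mod Q \<in> polys_below (degree Q)"
    using degree_mod_less[of Q f] Q by (cases "Q = 0") (auto simp: polys_below_iff)
  ultimately show "x \<in> (\<lambda>f. ac_eval f \<alpha>) ` polys_below (degree Q)"
    by blast
qed auto

lemma card_range_ac_eval: "card (range (\<lambda>f. ac_eval f \<alpha>)) = CARD('a) ^ degree Q"
proof -
  have "inj_on (\<lambda>f. ac_eval f \<alpha>) (polys_below (degree Q))"
  proof (rule inj_onI)
    fix f g assume fg: "f \<in> polys_below (degree Q)" "g \<in> polys_below (degree Q)" "ac_eval f \<alpha> = ac_eval g \<alpha>"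
    hence "Q dvd f - g"
      using ac_eval_eq_0_iff_dvd[OF Q, of "f - g"] by simp
    moreover have "f - g \<in> polys_below (degree Q)"
      using fg by (auto simp: polys_below_def)
    ultimately show "f = g"
      using dvd_imp_degree_le[of Q "f - g"] by (cases "f = g") (auto simp: polys_below_iff)
  qed
  thus ?thesis
    unfolding range_ac_eval_eq by (simp add: card_image card_polys_below)
qed

lemma finite_range_ac_eval: "finite (range (\<lambda>f. ac_eval f \<alpha>))"
  unfolding range_ac_eval_eq by simp

text \<open>Multiplication by a nonzero value permutes the nonzero values; comparing the products
  over all of them gives the claim.\<close>

lemma ac_eval_power_minus_1:
  assumes "ac_eval f \<alpha> \<noteq> 0"
  shows "ac_eval f \<alpha> ^ (CARD('a) ^ degree Q - 1) = 1"
proof -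
  define S where "S = range (\<lambda>f. ac_eval f \<alpha>)"
  define s where "s = ac_eval f \<alpha>"
  have [simp]: "finite S"
    unfolding S_def by (rule finite_range_ac_eval)
  have 0: "0 \<in> S"
    unfolding S_def by (rule range_eqI[of _ _ 0]) auto
  have bij: "bij_betw ((*) s) (S - {0}) (S - {0})"
  proof -
    have "inj_on ((*) s) (S - {0})"
      using assms by (auto simp: inj_on_def s_def)
    moreover have "(*) s ` (S - {0}) \<subseteq> S - {0}"
    proof
      fix y assume "y \<in> (*) s ` (S - {0})"
      then obtain g where g: "ac_eval g \<alpha> \<noteq> 0" "y = s * ac_eval g \<alpha>"
        by (auto simp: S_def)
      hence "y = ac_eval (f * g) \<alpha>"
        by (simp add: s_def)
      hence "y \<in> S"
        unfolding S_def by blast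
      thus "y \<in> S - {0}"
        using g assms by (simp add: s_def)
    qed
    ultimately show ?thesis
      using endo_inj_surj[of "S - {0}" "(*) s"] by (auto simp: bij_betw_def)
  qed
  have "s ^ card (S - {0}) * \<Prod>(S - {0}) = (\<Prod>x\<in>S - {0}. s * x)"
    by (simp add: prod.distrib)
  also have "\<dots> = \<Prod>(S - {0})"
    by (rule prod.reindex_bij_betw[OF bij])
  finally have "s ^ card (S - {0}) = 1"
    using prod_zero_iff[of "S - {0}" "\<lambda>x. x"] by simp
  also have "card (S - {0}) = CARD('a) ^ degree Q - 1"
    using 0 card_range_ac_eval by (simp add: S_def)
  finally show ?thesis
    by (simp add: s_def)
qed

lemma ac_eval_power_self: "ac_eval f \<alpha> ^ (CARD('a) ^ degree Q) = ac_eval f \<alpha>"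
proof (cases "ac_eval f \<alpha> = 0")
  case False
  have "ac_eval f \<alpha> ^ (CARD('a) ^ degree Q) = ac_eval f \<alpha> * ac_eval f \<alpha> ^ (CARD('a) ^ degree Q - 1)"
    by (rule power_eq_if[THEN trans]) simp
  thus ?thesis
    using ac_eval_power_minus_1[OF False] by simp
next
  case True
  show ?thesis
    unfolding True by (rule zero_power) simp
qed

text \<open>The values satisfy the equation, and it has no more roots than there are values.
  Membership in the residue field thus becomes an equation, as Euler's criterion requires.\<close>

lemma range_ac_eval: "range (\<lambda>f. ac_eval f \<alpha>) = {x. x ^ (CARD('a) ^ degree Q) = x}"
proof (rule card_seteq)
  have *: "degree Q > 0"
    using Q irreducible_imp_degree_pos by blast
  show "finite {x :: 'a alg_closure. x ^ (CARD('a) ^ degree Q) = x}"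
    by (rule card_power_eq_self[OF *])
  show "card {x :: 'a alg_closure. x ^ (CARD('a) ^ degree Q) = x} \<le> card (range (\<lambda>f. ac_eval f \<alpha>))"
    unfolding card_range_ac_eval by (rule card_power_eq_self[OF *])
  show "range (\<lambda>f. ac_eval f \<alpha>) \<subseteq> {x. x ^ (CARD('a) ^ degree Q) = x}"
    using ac_eval_power_self by blast
qed

text \<open>If two conjugates agreed, a power q^k with k < deg Q would fix \<alpha> and hence the
  whole residue field, which has more elements than that equation has roots.\<close>

lemma inj_on_frobenius_orbit: "inj_on (\<lambda>i. \<alpha> ^ (CARD('a) ^ i)) {..<degree Q}"
proof -
  have ne: "\<alpha> ^ (CARD('a) ^ i) \<noteq> \<alpha> ^ (CARD('a) ^ j)" if ij: "i < j" "j < degree Q" for i j :: nat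
  proof
    assume eq: "\<alpha> ^ (CARD('a) ^ i) = \<alpha> ^ (CARD('a) ^ j)"
    obtain k where k: "j = k + i" "0 < k"
      using less_imp_add_positive[OF ij(1)] by (auto simp: add.commute)
    \<comment> \<open>Additivity in this form shows that the q^i-th power of the first difference is
      0, so Frobenius can be cancelled from the coincidence of conjugates.\<close>
    have "(\<alpha> ^ (CARD('a) ^ k) - \<alpha> + \<alpha>) ^ (CARD('a) ^ i) =
          (\<alpha> ^ (CARD('a) ^ k) - \<alpha>) ^ (CARD('a) ^ i) + \<alpha> ^ (CARD('a) ^ i)"
      by (rule add_power_card_power_ac)
    moreover have "(\<alpha> ^ (CARD('a) ^ k)) ^ (CARD('a) ^ i) = \<alpha> ^ (CARD('a) ^ j)"
      unfolding k(1) power_add power_mult ..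
    ultimately have "\<alpha> ^ (CARD('a) ^ k) = \<alpha>"
      using eq by simp
    hence "range (\<lambda>f. ac_eval f \<alpha>) \<subseteq> {x. x ^ (CARD('a) ^ k) = x}"
      by (auto simp: ac_eval_frobenius)
    hence "card (range (\<lambda>f. ac_eval f \<alpha>)) \<le> card {x :: 'a alg_closure. x ^ (CARD('a) ^ k) = x}"
      by (intro card_mono card_power_eq_self(1)[OF k(2)])
    hence "CARD('a) ^ degree Q \<le> CARD('a) ^ k"
      unfolding card_range_ac_eval using card_power_eq_self(2)[OF k(2), where ?'a='a] by (rule order.trans)
    hence "degree Q \<le> k"
      by (rule power_le_imp_le_exp[OF one_less_card_field])
    thus False
      using ij k by linarith
  qed
  show ?thesis
    unfolding inj_on_def using ne by (metis lessThan_iff linorder_neqE_nat)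
qed

text \<open>The conjugates of \<alpha> are distinct roots of Q. The difference of the two monic
  polynomials has degree below d but d roots.\<close>

lemma ac_eval_monic_irreducible:
  assumes "monic Q"
  shows "ac_eval Q x = (\<Prod>i<degree Q. x - \<alpha> ^ (CARD('a) ^ i))"
proof -
  define d where "d = degree Q"
  define p where "p = map_poly to_ac Q"
  define r where "r = (\<Prod>i<d. [:- (\<alpha> ^ (CARD('a) ^ i)), 1:])"
  have p: "degree p = d" "lead_coeff p = 1"
    using assms by (simp_all add: p_def d_def degree_map_poly coeff_map_poly)
  have r: "degree r = d" "lead_coeff r = 1"
    unfolding r_def by (subst degree_prod_sum_eq; simp) (simp add: lead_coeff_prod)
  have "p - r = 0"
  proof (rule ccontr)
    assume nz: "p - r \<noteq> 0"
    have "d > 0"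
      unfolding d_def using Q irreducible_imp_degree_pos by blast
    have "p - r \<in> polys_below d"
      using p r by (auto simp: polys_below_def coeff_eq_0 le_less)
    hence "degree (p - r) < d"
      using nz \<open>d > 0\<close> by (auto simp: polys_below_iff)
    moreover have "(\<lambda>i. \<alpha> ^ (CARD('a) ^ i)) ` {..<d} \<subseteq> {x. poly (p - r) x = 0}"
    proof safe
      fix i assume "i < d"
      hence "poly r (\<alpha> ^ (CARD('a) ^ i)) = 0"
        unfolding r_def by (auto simp: poly_prod)
      moreover have "poly p (\<alpha> ^ (CARD('a) ^ i)) = ac_eval Q \<alpha> ^ (CARD('a) ^ i)"
        unfolding ac_eval_frobenius by (simp add: p_def ac_eval_def)
      ultimately show "poly (p - r) (\<alpha> ^ (CARD('a) ^ i)) = 0"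
        using Q by simp
    qed
    hence "card ((\<lambda>i. \<alpha> ^ (CARD('a) ^ i)) ` {..<d}) \<le> card {x. poly (p - r) x = 0}"
      using nz by (intro card_mono poly_roots_finite)
    hence "d \<le> card {x. poly (p - r) x = 0}"
      using inj_on_frobenius_orbit by (simp add: card_image d_def)
    ultimately show False
      using card_poly_roots_bound[OF nz] by linarith
  qed
  hence "poly p x = poly r x"
    by simp
  thus ?thesis
    by (simp add: p_def ac_eval_def r_def poly_prod d_def)
qed

end

section \<open>Quadratic residue symbols\<close>

text \<open>The binomial coefficient q choose 1 shows q = 0 in the field; as q = 2 k + 1, the
  equation 2 = 0 would give 1 = 0.\<close>

lemma odd_card_imp_two_neq_0:
  assumes "odd CARD('a::{field,finite})"
  shows "(2 :: 'a) \<noteq> 0"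
proof
  assume 2: "(2 :: 'a) = 0"
  obtain k where k: "CARD('a) = 2 * k + 1"
    using assms by (rule oddE)
  have "(of_nat (CARD('a) choose 1) :: 'a) = 0"
    by (rule of_nat_card_choose_eq_0) (use one_less_card_field in auto)
  thus False
    using 2 unfolding k by simp
qed

lemma residue_symbol_cases: "residue_symbol f Q \<in> {-1, 0, 1}"
  by (simp add: residue_symbol_def)

lemma residue_symbol_eq_0_iff: "residue_symbol f Q = 0 \<longleftrightarrow> Q dvd f"
  by (simp add: residue_symbol_def)

text \<open>Symbols are computed in the algebraic closure. Odd q keeps -1, 0 and 1 apart there, so
  identities between integers can be recovered.\<close>

lemma of_int_sign_inj:
  assumes "odd CARD('a::{field,finite})" "i \<in> {-1, 0, 1}" "j \<in> {-1, 0, 1}"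
    "(of_int i :: 'a alg_closure) = of_int j"
  shows "i = j"
proof -
  have 2: "(2 :: 'a alg_closure) \<noteq> 0"
    using odd_card_imp_two_neq_0[OF assms(1)] by (metis to_ac_eq_0_iff to_ac_numeral)
  hence "(-1 :: 'a alg_closure) \<noteq> 1" 
    by (metis add.right_inverse one_add_one)
  thus ?thesis
    using assms(2-4) by auto
qed

text \<open>Euler's criterion. A nonzero value s has (s^h)^2 = 1, so s^h is a sign; the real content
  is that the sign 1 forces a square root inside the residue field.\<close>

lemma ac_eval_power_half:
  fixes Q :: "'a::{field,finite} poly"
  assumes odd: "odd CARD('a)" and Q: "irreducible Q" "ac_eval Q \<alpha> = 0"
  shows "ac_eval f \<alpha> ^ ((CARD('a) ^ degree Q - 1) div 2) = of_int (residue_symbol f Q)"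
proof -
  define h where "h = (CARD('a) ^ degree Q - 1) div 2"
  define s where "s = ac_eval f \<alpha>"
  have "odd (CARD('a) ^ degree Q)"
    using odd by simp
  hence h: "CARD('a) ^ degree Q = 2 * h + 1"
    unfolding h_def by presburger
  have "1 < CARD('a) ^ degree Q"
    using irreducible_imp_degree_pos[OF Q(1)] one_less_card_field by (rule one_less_power[rotated])
  hence "h > 0"
    using h by linarith
  consider "Q dvd f" | "\<not> Q dvd f" "\<exists>Y. [Y ^ 2 = f] (mod Q)"
    | "\<not> Q dvd f" "\<not> (\<exists>Y. [Y ^ 2 = f] (mod Q))"
    by blast
  hence "s ^ h = of_int (residue_symbol f Q)"
  proof cases
    case 1
    thus ?thesis
      using \<open>h > 0\<close> ac_eval_eq_0_iff_dvd[OF Q, of f] by (simp add: residue_symbol_def s_def)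
  next
    case 2
    then obtain Y where "[Y ^ 2 = f] (mod Q)"
      by blast
    hence Y: "s = ac_eval Y \<alpha> ^ 2"
      by (simp add: cong_iff_ac_eval_eq[OF Q] s_def)
    have "s \<noteq> 0"
      using 2 ac_eval_eq_0_iff_dvd[OF Q, of f] by (simp add: s_def)
    hence "ac_eval Y \<alpha> \<noteq> 0"
      using Y by auto
    hence "ac_eval Y \<alpha> ^ (2 * h) = 1"
      using ac_eval_power_minus_1[OF Q, of Y] by (simp add: h)
    thus ?thesis
      using 2 unfolding Y by (simp add: residue_symbol_def power_mult)
  next
    case 3
    have "s \<noteq> 0"
      using 3 ac_eval_eq_0_iff_dvd[OF Q, of f] by (simp add: s_def)
    hence "(s ^ h) ^ 2 = 1"
      using ac_eval_power_minus_1[OF Q, of f] by (simp add: h s_def mult.commute flip: power_mult)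
    hence "s ^ h = 1 \<or> s ^ h = -1"
      by (rule power2_eq_1_iff[THEN iffD1])
    moreover have "s ^ h \<noteq> 1"
    proof
      assume sh: "s ^ h = 1"
      \<comment> \<open>A square root t exists in the closure, and s^h = 1 says that t^(2h+1) = t,
        which is the equation of the residue field.\<close>
      have "\<exists>t. poly [:- s, 0, 1:] t = 0"
        by (rule alg_closed_imp_poly_has_root) simp
      then obtain t where t: "t ^ 2 = s"
        by (auto simp: power2_eq_square)
      have "t ^ (2 * h + 1) = t"
        using sh t by (simp add: power_mult)
      hence "t \<in> range (\<lambda>f. ac_eval f \<alpha>)"
        unfolding range_ac_eval[OF Q] h by simp
      then obtain g where "t = ac_eval g \<alpha>"
        by blast
      hence "[g ^ 2 = f] (mod Q)"
        using t by (simp add: cong_iff_ac_eval_eq[OF Q] s_def)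
      thus False
        using 3 by blast
    qed
    ultimately show ?thesis
      using 3 by (simp add: residue_symbol_def)
  qed
  thus ?thesis
    by (simp add: s_def h_def)
qed

lemma cong_power_half:
  fixes Q :: "'a::{field,finite} poly"
  assumes "odd CARD('a)" "irreducible Q"
  shows "[f ^ ((CARD('a) ^ degree Q - 1) div 2) = of_int (residue_symbol f Q)] (mod Q)"
proof -
  obtain \<alpha> where \<alpha>: "ac_eval Q \<alpha> = 0"
    using irreducible_has_root[OF assms(2)] by blast
  have "ac_eval (of_int i) \<alpha> = of_int i" for i
    by (cases i rule: int_cases2) (simp_all add: of_nat_poly)
  thus ?thesis
    using ac_eval_power_half[OF assms \<alpha>, of f] by (simp add: cong_iff_ac_eval_eq[OF assms(2) \<alpha>])
qed

lemma cong_power_card_power: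
  fixes Q :: "'a::{field,finite} poly"
  assumes "irreducible Q"
  shows "[f ^ (CARD('a) ^ degree Q) = f] (mod Q)"
proof -
  obtain \<alpha> where \<alpha>: "ac_eval Q \<alpha> = 0"
    using irreducible_has_root[OF assms] by blast
  show ?thesis
    using ac_eval_power_self[OF assms \<alpha>, of f] by (simp add: cong_iff_ac_eval_eq[OF assms \<alpha>])
qed

lemma residue_symbol_mult:
  fixes Q :: "'a::{field,finite} poly"
  assumes "odd CARD('a)" "irreducible Q"
  shows "residue_symbol (f * g) Q = residue_symbol f Q * residue_symbol g Q"
proof -
  obtain \<alpha> where \<alpha>: "ac_eval Q \<alpha> = 0"
    using irreducible_has_root[OF assms(2)] by blast
  note * = ac_eval_power_half[OF assms \<alpha>, symmetric]
  show ?thesis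
  proof (rule of_int_sign_inj[OF assms(1)])
    show "(of_int (residue_symbol (f * g) Q) :: 'a alg_closure) = of_int (residue_symbol f Q * residue_symbol g Q)"
      by (simp only: of_int_mult * ac_eval_mult power_mult_distrib)
    show "residue_symbol f Q * residue_symbol g Q \<in> {-1, 0, 1}"
      using residue_symbol_cases[of f Q] residue_symbol_cases[of g Q] by auto
  qed (rule residue_symbol_cases)
qed

lemma residue_symbol_1:
  assumes "irreducible Q"
  shows "residue_symbol 1 Q = 1"
proof -
  have "\<not>Q dvd 1"
    using assms by (simp add: irreducible_def)
  moreover have "[1 ^ 2 = 1] (mod Q)"
    by simp
  ultimately show ?thesis
    unfolding residue_symbol_def by meson
qed

lemma residue_symbol_prod:
  fixes Q :: "'a::{field,finite} poly"
  assumes "odd CARD('a)" "irreducible Q"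
  shows "residue_symbol (\<Prod>x\<in>A. h x) Q = (\<Prod>x\<in>A. residue_symbol (h x) Q)"
  by (induction A rule: infinite_finite_induct)
    (simp_all add: residue_symbol_1[OF assms(2)] residue_symbol_mult[OF assms])

text \<open>Both symbols are powers of the resultant of \<open>P\<close> and \<open>Q\<close>, which is symmetric up to sign.\<close>

theorem residue_symbol_reciprocity:
  fixes P Q :: "'a::{field,finite} poly"
  assumes q: "CARD('a) mod 4 = 1"
    and P: "monic P" "irreducible P" and Q: "monic Q" "irreducible Q"
  shows "residue_symbol P Q = residue_symbol Q P"
proof -
  have odd: "odd CARD('a)" and even: "even ((CARD('a) - 1) div 2)"
    using q by presburger+
  \<comment> \<open>The geometric sum in the exponent turns Euler's power into a product over the
    Frobenius conjugates.\<close>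
  have geo: "(CARD('a) ^ d - 1) div 2 = (CARD('a) - 1) div 2 * (\<Sum>i<d. CARD('a) ^ i)" for d
  proof -
    have "int (CARD('a) ^ d - 1) = int ((CARD('a) - 1) * (\<Sum>i<d. CARD('a) ^ i))"
      using one_less_card_field[where 'a='a] power_diff_1_eq[of "int CARD('a)" d]
      by (simp add: of_nat_diff)
    hence "CARD('a) ^ d - 1 = (CARD('a) - 1) * (\<Sum>i<d. CARD('a) ^ i)"
      by (rule of_nat_eq_iff[THEN iffD1])
    moreover have "2 dvd CARD('a) - 1"
      using odd by simp
    ultimately show ?thesis
      by (simp add: div_mult_swap mult.commute)
  qed
  have *: "of_int (residue_symbol B A) = (\<Prod>i<degree A. \<Prod>j<degree B.
      (\<alpha> ^ (CARD('a) ^ i) - \<beta> ^ (CARD('a) ^ j)) ^ ((CARD('a) - 1) div 2))"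
    if "irreducible A" "ac_eval A \<alpha> = 0" "monic B" "irreducible B" "ac_eval B \<beta> = 0"
    for A B :: "'a poly" and \<alpha> \<beta>
  proof -
    have "of_int (residue_symbol B A) = ac_eval B \<alpha> ^ ((CARD('a) ^ degree A - 1) div 2)"
      by (rule ac_eval_power_half[OF odd that(1,2), symmetric])
    also have "\<dots> = (\<Prod>i<degree A. ac_eval B \<alpha> ^ (CARD('a) ^ i)) ^ ((CARD('a) - 1) div 2)"
      unfolding geo mult.commute[of "(CARD('a) - 1) div 2"] power_mult power_sum ..
    also have "\<dots> = (\<Prod>i<degree A. \<Prod>j<degree B. (\<alpha> ^ (CARD('a) ^ i) - \<beta> ^ (CARD('a) ^ j))) ^ ((CARD('a) - 1) div 2)"
      unfolding ac_eval_frobenius by (simp only: ac_eval_monic_irreducible[OF that(4,5,3)])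
    finally show ?thesis
      by (simp add: prod_power_distrib)
  qed
  obtain \<alpha> \<beta> where \<alpha>: "ac_eval P \<alpha> = 0" and \<beta>: "ac_eval Q \<beta> = 0"
    using irreducible_has_root P(2) Q(2) by metis
  have "of_int (residue_symbol P Q) = (\<Prod>i<degree Q. \<Prod>j<degree P.
      (\<beta> ^ (CARD('a) ^ i) - \<alpha> ^ (CARD('a) ^ j)) ^ ((CARD('a) - 1) div 2))"
    by (rule *[OF Q(2) \<beta> P \<alpha>])
  \<comment> \<open>Exchanging the two roots changes the sign of each factor; (q - 1) / 2 is even as
    q = 1 mod 4, so the sign disappears.\<close>
  also have "\<dots> = (\<Prod>i<degree Q. \<Prod>j<degree P.
      (\<alpha> ^ (CARD('a) ^ j) - \<beta> ^ (CARD('a) ^ i)) ^ ((CARD('a) - 1) div 2))"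
    by (intro prod.cong refl) (metis even minus_diff_eq power_minus_even)
  also have "\<dots> = (\<Prod>j<degree P. \<Prod>i<degree Q.
      (\<alpha> ^ (CARD('a) ^ j) - \<beta> ^ (CARD('a) ^ i)) ^ ((CARD('a) - 1) div 2))"
    by (rule prod.swap)
  also have "\<dots> = of_int (residue_symbol Q P)"
    by (rule *[OF P(2) \<alpha> Q \<beta>, symmetric])
  finally show ?thesis
    by (intro of_int_sign_inj[OF odd residue_symbol_cases residue_symbol_cases])
qed

section \<open>Stepanov's method\<close>

lemma monic_dvd_antisym:
  fixes P Q :: "'a::field poly"
  assumes "monic P" "monic Q" "P dvd Q" "Q dvd P"
  shows "P = Q"
proof -
  obtain u where u: "Q = P * u"
    using assms(3) ..
  have nz: "P \<noteq> 0" "Q \<noteq> 0" "u \<noteq> 0"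
    using assms u by auto
  have "degree P = degree Q"
    using dvd_imp_degree_le[OF assms(3) nz(2)] dvd_imp_degree_le[OF assms(4) nz(1)] by simp
  hence "degree u = 0"
    using nz by (simp add: u degree_mult_eq)
  then obtain c where c: "u = [:c:]"
    by (rule degree_eq_zeroE)
  have "lead_coeff Q = lead_coeff P * c"
    unfolding u lead_coeff_mult c by simp
  hence "c = 1"
    unfolding assms by simp
  thus ?thesis
    using u c by simp
qed

lemma prod_irreducible_dvd:
  fixes R :: "'a::field poly"
  assumes "finite A" "\<And>Q. Q \<in> A \<Longrightarrow> monic Q \<and> irreducible Q \<and> Q dvd R"
  shows "\<Prod>A dvd R"
  using assms
proof (induction A)
  case (insert Q A)
  then obtain c where c: "R = \<Prod>A * c"
    by (meson dvdE insertI2)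
  have "\<not> Q dvd \<Prod>A"
  proof
    assume "Q dvd \<Prod>A"
    then obtain P where P: "P \<in> A" "Q dvd P"
      using irreducible_dvd_prod[of Q "\<lambda>x. x" A] insert.prems by auto
    have "irreducible P" "\<not> Q dvd 1"
      using insert.prems P(1) by (auto simp: irreducible_def)
    hence "P dvd Q"
      using irreducibleD'[of P Q] P(2) by blast
    moreover have "monic P" "monic Q"
      using insert.prems P(1) by auto
    ultimately have "P = Q"
      using P(2) by (intro monic_dvd_antisym) simp_all
    thus False
      using insert P by blast
  qed
  moreover have "Q dvd \<Prod>A * c" "irreducible Q"
    using insert.prems c by auto
  ultimately have "Q dvd c"
    using irreducible_dvd_mult_iff by blast
  thus ?case
    using insert c by (simp add: mult.commute mult_dvd_mono)
qed simp

text \<open>P divides f exactly once, so the two sides would have different parity of multiplicity.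
  Carried out as a descent: P divides a, then d, and dividing both by P gives a smaller
  solution.\<close>

lemma square_eq_square_mult_imp_eq_0:
  fixes f :: "'a::field poly"
  assumes P: "irreducible P" "P dvd f" "\<not> P ^ 2 dvd f" and c: "c \<noteq> 0"
  shows "a ^ 2 = d ^ 2 * f * [:c:] \<Longrightarrow> d = 0"
proof (induction "degree d" arbitrary: a d rule: less_induct)
  case less
  show "d = 0"
  proof (rule ccontr)
    assume "d \<noteq> 0"
    have P0: "P \<noteq> 0"
      using P(1) by auto
    obtain f' where f': "f = P * f'"
      using P(2) by blast
    have "\<not> P dvd f'"
      using P(3) f' by (auto simp: power2_eq_square mult_dvd_mono)
    moreover have "\<not> P dvd [:c:]"
      using c irreducible_imp_degree_pos[OF P(1)] dvd_imp_degree_le[of P "[:c:]"] by auto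
    ultimately have nd: "\<not> P dvd f' * [:c:]"
      using irreducible_dvd_mult_iff[OF P(1)] by blast
    have "a ^ 2 = P * (d ^ 2 * f' * [:c:])"
      using less.prems unfolding f' by (simp add: mult_ac)
    hence "P dvd a ^ 2" ..
    hence "P dvd a"
      by (rule irreducible_dvd_power[OF P(1)])
    then obtain a' where a': "a = P * a'" ..
    have "P * (P * a' ^ 2) = P * (d ^ 2 * (f' * [:c:]))"
      using less.prems unfolding a' f' by (simp add: power2_eq_square mult_ac)
    hence 1: "P * a' ^ 2 = d ^ 2 * (f' * [:c:])"
      using P0 by (metis mult_cancel_left)
    hence "P dvd d ^ 2 * (f' * [:c:])"
      by (metis dvd_triv_left)
    hence "P dvd d ^ 2"
      using nd irreducible_dvd_mult_iff[OF P(1)] by blast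
    hence "P dvd d"
      by (rule irreducible_dvd_power[OF P(1)])
    then obtain d' where d': "d = P * d'" ..
    have "P * a' ^ 2 = P * (d' ^ 2 * f * [:c:])"
      using 1 unfolding d' f' by (simp add: power2_eq_square mult_ac)
    hence "a' ^ 2 = d' ^ 2 * f * [:c:]"
      using P0 by (metis mult_cancel_left)
    moreover have "d' \<noteq> 0"
      using d' \<open>d \<noteq> 0\<close> by auto
    moreover have "degree d' < degree d"
      using d' \<open>d' \<noteq> 0\<close> P0 irreducible_imp_degree_pos[OF P(1)] by (simp add: degree_mult_eq)
    ultimately show False
      using less.hyps by blast
  qed
qed

text \<open>After substituting T^k for the outer variable, coefficients of degree below k occupy
  disjoint blocks of exponents, so nothing can cancel.\<close>

lemma poly_monom_eq_0_imp_eq_0: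
  fixes G :: "'a::field poly poly"
  assumes "\<And>i. degree (coeff G i) < k" "poly G (monom 1 k) = 0"
  shows "G = 0"
  using assms
proof (induction G)
  case (pCons c G)
  have deg: "degree c < k" "\<And>i. degree (coeff G i) < k"
    using pCons.prems(1)[of 0] pCons.prems(1)[of "Suc i" for i] by auto
  have eq: "c = - (monom 1 k * poly G (monom 1 k))"
    using pCons.prems(2) by (simp add: add_eq_0_iff2 mult.commute)
  have "poly G (monom 1 k) = 0"
  proof (rule ccontr)
    assume "poly G (monom 1 k) \<noteq> 0"
    hence "degree c = k + degree (poly G (monom 1 k))"
      unfolding eq by (simp add: degree_mult_eq degree_monom_eq)
    thus False
      using deg(1) by simp
  qed
  moreover from this have "c = 0"
    using eq by simp
  ultimately show ?case
    using pCons.IH deg by simp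
qed simp

lemma degree_coeff_mult_le:
  fixes A B :: "'a::comm_semiring_0 poly poly"
  assumes "\<And>i. degree (coeff A i) \<le> a" "\<And>i. degree (coeff B i) \<le> b"
  shows "degree (coeff (A * B) i) \<le> a + b"
  unfolding coeff_mult
  by (intro degree_sum_le) (auto intro: degree_mult_le[THEN order.trans] add_mono assms)

text \<open>In the unknown \<open>y = T ^ k\<close> the assumption reads \<open>A(y)\<^sup>2 = D(y)\<^sup>2 f(T) f(y)\<close>. All
  degrees in \<open>T\<close> being small, this holds with an independent variable \<open>y\<close>, and comparison of
  the leading coefficients in \<open>y\<close> makes \<open>f\<close> a square up to a constant.\<close>

lemma stepanov_auxiliary_eq_0:
  fixes f :: "'a::{field,finite} poly" and A D :: "'a poly poly"
  assumes P: "irreducible P" "P dvd f" "\<not> P ^ 2 dvd f"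
    and k: "k = CARD('a) ^ t" "odd k"
    and A: "\<And>i. degree (coeff A i) \<le> S" and D: "\<And>i. degree (coeff D i) \<le> S"
    and S: "2 * S + degree f < k"
    and eq: "poly A (monom 1 k) + poly D (monom 1 k) * f ^ ((k + 1) div 2) = 0"
  shows "A = 0 \<and> D = 0"
proof -
  \<comment> \<open>\<open>F\<close> is f(y), with constant coefficients in T.\<close>
  define F where "F = map_poly (\<lambda>x. [:x:]) f"
  have f0: "f \<noteq> 0"
    using P(3) by auto
  have F: "poly F (monom 1 k) = f ^ k"
    unfolding F_def k by (simp add: poly_power_card_power pcompose_altdef)
  have "poly A (monom 1 k) = - (poly D (monom 1 k) * f ^ ((k + 1) div 2))"
    using eq by (simp add: add_eq_0_iff2)
  hence "poly A (monom 1 k) ^ 2 = poly D (monom 1 k) ^ 2 * f ^ ((k + 1) div 2 * 2)"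
    by (simp add: power_mult_distrib power_mult)
  also have "(k + 1) div 2 * 2 = Suc k"
    using k(2) by (auto elim!: oddE)
  finally have "poly (A ^ 2 - D ^ 2 * ([:f:] * F)) (monom 1 k) = 0"
    by (simp add: F)
  moreover have "degree (coeff (A ^ 2 - D ^ 2 * ([:f:] * F)) i) < k" for i
  proof -
    have "degree (coeff (A ^ 2) i) \<le> S + S" for i
      unfolding power2_eq_square by (intro degree_coeff_mult_le A)
    moreover have "degree (coeff (D ^ 2 * ([:f:] * F)) i) \<le> S + S + (degree f + 0)" for i
      unfolding power2_eq_square
      by (intro degree_coeff_mult_le D)
        (auto simp: coeff_pCons F_def coeff_map_poly split: nat.splits)
    ultimately have "degree (coeff (A ^ 2 - D ^ 2 * ([:f:] * F)) i) \<le> S + S + (degree f + 0)"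
      unfolding coeff_diff by (intro degree_diff_le) (auto intro: order.trans[OF _ le_add1])
    thus ?thesis
      using S by simp
  qed
  ultimately have "A ^ 2 - D ^ 2 * ([:f:] * F) = 0"
    by (rule poly_monom_eq_0_imp_eq_0[rotated])
  hence AD: "A ^ 2 = D ^ 2 * ([:f:] * F)"
    by simp
  have "lead_coeff (A ^ 2) = lead_coeff (D ^ 2 * ([:f:] * F))"
    unfolding AD ..
  moreover have "lead_coeff F = [:lead_coeff f:]"
    using f0 by (simp add: F_def degree_map_poly coeff_map_poly)
  moreover have "lead_coeff [:f:] = f"
    by simp
  ultimately have "lead_coeff A ^ 2 = lead_coeff D ^ 2 * f * [:lead_coeff f:]"
    by (simp only: lead_coeff_power lead_coeff_mult mult.assoc)
  hence "lead_coeff D = 0"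
    by (rule square_eq_square_mult_imp_eq_0[OF P, rotated]) (use f0 in simp)
  hence "D = 0"
    by simp
  with AD show ?thesis
    by simp
qed

section \<open>Counting irreducible polynomials with a prescribed symbol\<close>

definition irreds :: "nat \<Rightarrow> 'a::field poly set" where
  "irreds n = {P. monic P \<and> irreducible P \<and> degree P = n}"

lemma finite_irreds [simp]: "finite (irreds n :: 'a::{field,finite} poly set)"
  unfolding irreds_def by (rule finite_subset[OF _ finite_monic_of_degree[of n]]) auto

lemma irredsD:
  assumes "P \<in> irreds n"
  shows "monic P" "irreducible P" "degree P = n" "n > 0"
  using assms irreducible_imp_degree_pos[of P] by (auto simp: irreds_def)

text \<open>Put M = q^s and k = q^t, so that M k = q^N. Take R as the sum of (\<alpha>_j +
  \<delta>_j f^((k+1)/2)) T^(kj). Modulo Q one has T^(q^N) = T and f^((q^N-1)/2) = \<epsilon>, so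
  R^M becomes the sum of (\<alpha>_j^M + \<epsilon> \<delta>_j^M f^h) T^j. This expression no longer
  depends on Q. If it is the zero polynomial, one and the same R is divisible by all the Q counted,
  and its degree bounds their number.\<close>

lemma stepanov_bound:
  fixes f :: "'a::{field,finite} poly"
  assumes odd: "odd CARD('a)" and P: "irreducible P" "P dvd f" "\<not> P ^ 2 dvd f"
    and \<epsilon>: "\<epsilon> = 1 \<or> \<epsilon> = (-1::int)" and st: "s \<le> t" "N = s + t"
    and small: "8 * degree f < CARD('a) ^ s"
  shows "2 * N * card {Q \<in> irreds N. residue_symbol f Q = \<epsilon>}
    \<le> CARD('a) ^ N + 6 * degree f * CARD('a) ^ t"
proof -
  define m where "m = degree f"
  define M where "M = CARD('a) ^ s"
  define k where "k = CARD('a) ^ t"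
  \<comment> \<open>S is about as large as the nonvanishing of R permits. B is about M / 2, which
    yields the main term q^N; its excess 2 m makes the unknowns outnumber the equations and costs
    only O(m k) in the degree of R.\<close>
  define S where "S = (k - m) div 2"
  define B where "B = (M + 1) div 2 + 2 * m"
  define h where "h = (M + 1) div 2"
  define U where "U = S * M + m * h + B"
  define e where "e = (of_int \<epsilon> :: 'a poly)"
  have f0: "f \<noteq> 0"
    using P(3) by auto
  have m: "m > 0"
    unfolding m_def using irreducible_imp_degree_pos[OF P(1)] dvd_imp_degree_le[OF P(2) f0] by linarith
  have "odd M" "odd k"
    using odd by (simp_all add: M_def k_def)
  hence h2: "2 * h = M + 1" and k2: "2 * ((k + 1) div 2) = k + 1"
    by (auto simp: h_def)
  have "M \<le> k"
    unfolding M_def k_def using st one_less_card_field[where 'a='a] by (simp add: power_increasing)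
  have kM: "CARD('a) ^ N = k * M"
    by (simp add: st k_def M_def power_add)
  have Mm: "8 * m < M"
    using small by (simp add: m_def M_def)
  have S2: "2 * S + m \<le> k" "k \<le> 2 * S + m + 1"
    unfolding S_def using Mm \<open>M \<le> k\<close> by linarith+
  have "S > 0" "B > 0"
    using S2 Mm \<open>M \<le> k\<close> m by (auto simp: B_def)

  \<comment> \<open>2 S B is the number of free coefficients in the \<alpha>_j and \<delta>_j, and U
    is the number of coefficients that have to vanish.\<close>
  have dimension: "U < 2 * (S * B)"
  proof -
    have 1: "3 * m < S"
      using S2 Mm m \<open>M \<le> k\<close> by linarith
    have 2: "3 * M < 8 * S"
      using S2 Mm m \<open>M \<le> k\<close> by linarith
    have "2 * (S * B) = S * (2 * h) + 4 * (S * m)"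
      by (simp add: B_def h_def algebra_simps)
    also have "\<dots> = S * M + S + 4 * (S * m)"
      unfolding h2 by (simp add: algebra_simps)
    finally have *: "2 * (S * B) = S * M + S + 4 * (S * m)" .
    have "2 * (m * h + h) \<le> 4 * (m * h)"
      using m by simp
    hence "m * h + h \<le> m * (2 * h)"
      by simp
    also have "m * (2 * h) = m * M + m"
      unfolding h2 by simp
    finally have "m * h + B \<le> m * M + 3 * m"
      by (simp add: B_def h_def)
    moreover have "m * (3 * M) \<le> m * (8 * S)"
      using 2 by (intro mult_left_mono) auto
    hence "3 * (m * M) \<le> 8 * (S * m)"
      by (simp add: mult_ac)
    ultimately show ?thesis
      unfolding U_def * using 1 by linarith
  qed

  \<comment> \<open>The common residue of R^M. It is additive because M is a power of q, so two
    colliding arguments differ by a nonzero element of the kernel.\<close>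
  define \<Phi> where "\<Phi> = (\<lambda>(a, d). \<Sum>j<B. (a j ^ M + e * d j ^ M * f ^ h) * monom 1 j)"
  define V where "V = (PiE {..<B} (\<lambda>_. polys_below S :: 'a poly set)) \<times> (PiE {..<B} (\<lambda>_. polys_below S :: 'a poly set))"
  have pow_diff: "(x - y) ^ M = x ^ M - y ^ M" for x y :: "'a poly"
    using add_power_card_power_poly[of "x - y" y s] by (simp add: M_def)
  have deg_e: "degree e = 0"
    by (simp add: e_def)
  have "\<Phi> ` V \<subseteq> polys_below U"
  proof safe
    fix a d assume "(a, d) \<in> V"
    hence ad: "a j \<in> polys_below S" "d j \<in> polys_below S" if "j < B" for j
      using that by (auto simp: V_def)
    have lt: "degree x \<le> S - 1" if "x \<in> polys_below S" for x :: "'a poly"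
      using that by (auto simp: polys_below_iff)
    have "degree ((a j ^ M + e * d j ^ M * f ^ h) * monom 1 j) \<le> ((S - 1) * M + m * h) + (B - 1)" if j: "j < B" for j
    proof -
      have "degree (x ^ M) \<le> (S - 1) * M" if "x \<in> polys_below S" for x :: "'a poly"
        using lt[OF that] degree_power_le[of x M] by (meson mult_le_mono1 order.trans)
      note * = this[OF ad(1)[OF j]] this[OF ad(2)[OF j]]
      have "degree (e * d j ^ M * f ^ h) \<le> (0 + (S - 1) * M) + m * h"
        using *(2) deg_e degree_power_le[of f h]
        by (intro degree_mult_le[THEN order.trans] add_mono) (auto simp: m_def)
      hence "degree (a j ^ M + e * d j ^ M * f ^ h) \<le> (S - 1) * M + m * h"
        using *(1) by (intro degree_add_le) auto
      thus ?thesis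
        using j degree_monom_le[of "1::'a" j]
        by (intro degree_mult_le[THEN order.trans] add_mono) auto
    qed
    hence "degree (\<Phi> (a, d)) \<le> ((S - 1) * M + m * h) + (B - 1)"
      unfolding \<Phi>_def prod.case by (intro degree_sum_le) auto
    also have "\<dots> < U"
      unfolding U_def using \<open>B > 0\<close> by (intro add_le_less_mono add_mono mult_le_mono) auto
    finally show "\<Phi> (a, d) \<in> polys_below U"
      by (simp add: polys_below_iff)
  qed
  moreover have "card V = CARD('a) ^ (2 * (S * B))"
    unfolding V_def by (simp add: card_cartesian_product card_PiE card_polys_below mult_2
        flip: power_mult power_add)
  hence "card V > card (polys_below U :: 'a poly set)"
    using dimension one_less_card_field[where 'a='a] by (simp add: card_polys_below)
  ultimately have "\<not> inj_on \<Phi> V"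
    using card_inj_on_le[of \<Phi> V "polys_below U"] by auto
  then obtain a d a' d' where V: "(a, d) \<in> V" "(a', d') \<in> V" "(a, d) \<noteq> (a', d')"
    and \<Phi>_eq: "\<Phi> (a, d) = \<Phi> (a', d')"
    unfolding inj_on_def by auto
  define \<alpha> where "\<alpha> = (\<lambda>j. a j - a' j)"
  define \<delta> where "\<delta> = (\<lambda>j. d j - d' j)"
  have below: "\<alpha> j \<in> polys_below S" "\<delta> j \<in> polys_below S" if "j < B" for j
  proof -
    have "a j \<in> polys_below S" "d j \<in> polys_below S" "a' j \<in> polys_below S" "d' j \<in> polys_below S"
      using V(1,2) that by (auto simp: V_def)
    thus "\<alpha> j \<in> polys_below S" "\<delta> j \<in> polys_below S"
      by (simp_all add: \<alpha>_def \<delta>_def polys_below_def)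
  qed
  have nz: "\<exists>j<B. \<alpha> j \<noteq> 0 \<or> \<delta> j \<noteq> 0"
  proof (rule ccontr)
    assume "\<not> ?thesis"
    hence eq: "a j = a' j" "d j = d' j" if "j < B" for j
      using that by (auto simp: \<alpha>_def \<delta>_def)
    have "a = a'"
      by (rule PiE_ext[of _ "{..<B}" "\<lambda>_. polys_below S"]) (use V eq in \<open>auto simp: V_def\<close>)
    moreover have "d = d'"
      by (rule PiE_ext[of _ "{..<B}" "\<lambda>_. polys_below S"]) (use V eq in \<open>auto simp: V_def\<close>)
    ultimately show False
      using V(3) by simp
  qed
  have vanish: "(\<Sum>j<B. (\<alpha> j ^ M + e * \<delta> j ^ M * f ^ h) * monom 1 j) = 0"
  proof -
    have "(\<Sum>j<B. (\<alpha> j ^ M + e * \<delta> j ^ M * f ^ h) * monom 1 j) = \<Phi> (a, d) - \<Phi> (a', d')"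
      unfolding \<Phi>_def \<alpha>_def \<delta>_def pow_diff prod.case sum_subtractf[symmetric]
      by (intro sum.cong refl) (simp add: algebra_simps)
    thus ?thesis
      using \<Phi>_eq by simp
  qed

  define R where "R = (\<Sum>j<B. (\<alpha> j + \<delta> j * f ^ ((k + 1) div 2)) * monom 1 (k * j))"
  have "R \<noteq> 0"
  proof
    assume "R = 0"
    define poly2 :: "(nat \<Rightarrow> 'a poly) \<Rightarrow> 'a poly poly" where "poly2 = (\<lambda>c. \<Sum>j<B. monom (c j) j)"
    have ev: "poly (poly2 c) (monom 1 k) = (\<Sum>j<B. c j * monom 1 (k * j))" for c
      by (simp add: poly2_def poly_sum poly_monom monom_power)
    have cf: "coeff (poly2 c) j = (if j < B then c j else 0)" for c j
      by (simp add: poly2_def coeff_sum)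
    have "poly (poly2 \<alpha>) (monom 1 k) + poly (poly2 \<delta>) (monom 1 k) * f ^ ((k + 1) div 2) = 0"
      using \<open>R = 0\<close> unfolding R_def ev by (simp add: algebra_simps sum.distrib sum_distrib_left)
    moreover have "degree (coeff (poly2 \<alpha>) i) \<le> S - 1" "degree (coeff (poly2 \<delta>) i) \<le> S - 1" for i
      using below[of i] by (auto simp: cf polys_below_iff)
    \<comment> \<open>Here 2 S + m \<le> k enters; passing from S to S - 1 makes the inequality
      strict.\<close>
    moreover have "2 * (S - 1) + degree f < k"
      using S2(1) \<open>S > 0\<close> by (simp add: m_def)
    ultimately have "poly2 \<alpha> = 0 \<and> poly2 \<delta> = 0"
      using stepanov_auxiliary_eq_0[OF P k_def \<open>odd k\<close>] by blast
    hence *: "(if j < B then \<alpha> j else 0) = 0" "(if j < B then \<delta> j else 0) = 0" for j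
      using cf[of \<alpha> j] cf[of \<delta> j] by simp_all
    obtain j where "j < B" "\<alpha> j \<noteq> 0 \<or> \<delta> j \<noteq> 0"
      using nz by blast
    thus False
      using *[of j] by simp
  qed

  define \<Q> where "\<Q> = {Q \<in> irreds N. residue_symbol f Q = \<epsilon>}"
  have "Q dvd R" if "Q \<in> \<Q>" for Q
  proof (rule irreducible_dvd_power[where n = M])
    have Q: "irreducible Q" "degree Q = N" "residue_symbol f Q = \<epsilon>"
      using that by (auto simp: \<Q>_def irreds_def)
    show "irreducible Q"
      by fact
    have cong1: "[monom 1 (k * j * M) = monom (1::'a) j] (mod Q)" for j
    proof -
      have "monom (1::'a) (k * j * M) = monom 1 j ^ (CARD('a) ^ N)"
        by (simp add: kM monom_power mult_ac)
      thus ?thesis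
        using cong_power_card_power[OF Q(1), of "monom 1 j"] Q(2) by simp
    qed
    \<comment> \<open>This splitting isolates Euler's exponent; the rest h is the power of f that
      remains in the residue.\<close>
    have exp: "(k + 1) div 2 * M = (CARD('a) ^ N - 1) div 2 + h"
    proof -
      have "k * M > 0"
        using \<open>odd M\<close> \<open>odd k\<close> by (intro mult_pos_pos odd_pos)
      define x z w where "x = k * M" and "z = (k * M - 1) div 2" and "w = (k + 1) div 2 * M"
      have "even (k * M - 1)"
        using \<open>odd M\<close> \<open>odd k\<close> by simp
      hence "2 * z = x - 1"
        by (simp add: z_def x_def)
      moreover have "2 * w = x + M"
        using arg_cong[OF k2, of "\<lambda>x. x * M"] by (simp add: algebra_simps w_def x_def)
      moreover have "x > 0"
        unfolding x_def by fact
      ultimately have "2 * w + 1 = 2 * z + 1 + (M + 1)"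
        by simp
      hence "2 * w = 2 * (z + h)"
        unfolding h2[symmetric] by simp
      thus ?thesis
        unfolding kM z_def w_def by simp
    qed
    have cong2: "[f ^ ((k + 1) div 2 * M) = e * f ^ h] (mod Q)"
      unfolding exp power_add e_def using cong_power_half[OF odd Q(1), of f] Q
      by (intro cong_scalar_right) simp
    have "R ^ M = (\<Sum>j<B. (\<alpha> j ^ M + \<delta> j ^ M * f ^ ((k + 1) div 2 * M)) * monom 1 (k * j * M))"
      unfolding R_def M_def sum_power_card_power_poly
      by (simp add: power_mult_distrib add_power_card_power_poly power_mult monom_power)
    also have "[\<dots> = (\<Sum>j<B. (\<alpha> j ^ M + \<delta> j ^ M * (e * f ^ h)) * monom 1 j)] (mod Q)"
      by (intro cong_sum cong_mult cong_add cong1 cong2) auto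
    also have "(\<Sum>j<B. (\<alpha> j ^ M + \<delta> j ^ M * (e * f ^ h)) * monom 1 j) = 0"
      using vanish by (simp add: mult_ac)
    finally show "Q dvd R ^ M"
      by (simp add: cong_0_iff)
  qed
  hence dvd: "\<Prod>\<Q> dvd R"
    by (intro prod_irreducible_dvd) (auto simp: \<Q>_def dest: irredsD)
  have "N * card \<Q> = degree (\<Prod>\<Q>)"
    by (subst degree_prod_sum_eq) (auto simp: \<Q>_def irreds_def)
  also have "\<dots> \<le> degree R"
    using dvd \<open>R \<noteq> 0\<close> by (rule dvd_imp_degree_le)
  also have "\<dots> \<le> (S + m * ((k + 1) div 2)) + k * (B - 1)"
  proof -
    have "degree ((\<alpha> j + \<delta> j * f ^ ((k + 1) div 2)) * monom 1 (k * j))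
        \<le> (S + m * ((k + 1) div 2)) + k * (B - 1)" if "j < B" for j
    proof -
      have "degree (\<alpha> j) \<le> S" "degree (\<delta> j) \<le> S"
        using below[OF that] by (auto simp: polys_below_iff)
      moreover have "degree (\<delta> j * f ^ ((k + 1) div 2)) \<le> S + m * ((k + 1) div 2)"
        using \<open>degree (\<delta> j) \<le> S\<close> degree_power_le[of f "(k + 1) div 2"]
        by (intro degree_mult_le[THEN order.trans] add_mono) (auto simp: m_def)
      ultimately have "degree (\<alpha> j + \<delta> j * f ^ ((k + 1) div 2)) \<le> S + m * ((k + 1) div 2)"
        by (intro degree_add_le) auto
      moreover have "degree (monom (1::'a) (k * j)) \<le> k * (B - 1)"
        using that by (intro degree_monom_le[THEN order.trans] mult_le_mono) auto
      ultimately show ?thesis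
        by (intro degree_mult_le[THEN order.trans] add_mono)
    qed
    thus ?thesis
      unfolding R_def by (intro degree_sum_le) auto
  qed
  finally have "2 * (N * card \<Q>) \<le> 2 * S + m * (2 * ((k + 1) div 2)) + k * (2 * (B - 1))"
    by (simp add: algebra_simps)
  \<comment> \<open>The k saved by B - 1 absorbs 2 S + m.\<close>
  also have "2 * (B - 1) + 1 = M + 4 * m"
    using h2 \<open>B > 0\<close> by (simp add: B_def h_def)
  hence "k * (2 * (B - 1)) + k = k * M + 4 * (k * m)"
    by (metis (no_types, lifting) add_mult_distrib2 mult.left_commute mult_1_right)
  hence "2 * S + m * (2 * ((k + 1) div 2)) + k * (2 * (B - 1)) \<le> k * M + 6 * (k * m)"
    unfolding k2 using S2(1) \<open>odd k\<close> m mult_le_mono1[of 1 k m]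
    by (auto simp: algebra_simps odd_pos)
  finally show ?thesis
    by (simp add: \<Q>_def kM m_def k_def mult_ac)
qed

section \<open>Kronecker symbols and the von Mangoldt recurrence\<close>

lemma ex_monic_irreducible_dvd:
  fixes f :: "'a::field poly"
  assumes "degree f > 0"
  shows "\<exists>P. monic P \<and> irreducible P \<and> P dvd f"
  using assms
proof (induction "degree f" arbitrary: f rule: less_induct)
  case less
  have f0: "f \<noteq> 0"
    using less.prems by auto
  have nu: "\<not> is_unit f"
    using less.prems is_unit_iff_degree[OF f0] by simp
  show ?case
  proof (cases "irreducible f")
    case True
    define P where "P = smult (inverse (lead_coeff f)) f"
    have "monic P"
      using f0 by (simp add: P_def)
    moreover have eq: "f = smult (lead_coeff f) P"
      using f0 by (simp add: P_def)
    moreover have "irreducible P"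
    proof -
      have "P = [:inverse (lead_coeff f):] * f"
        by (simp add: P_def)
      moreover have "is_unit [:inverse (lead_coeff f):]"
        using f0 by (simp add: is_unit_triv)
      ultimately show ?thesis
        using True irreducible_mult_unit_left by metis
    qed
    moreover have "P dvd f"
      by (subst eq) (rule dvd_smult[OF dvd_refl])
    ultimately show ?thesis
      by blast
  next
    case False
    then obtain a b where ab: "f = a * b" "\<not> is_unit a" "\<not> is_unit b"
      using f0 nu unfolding irreducible_def by blast
    have nz: "a \<noteq> 0" "b \<noteq> 0"
      using f0 ab by auto
    hence "degree a > 0" "degree b > 0"
      using ab is_unit_iff_degree[of a] is_unit_iff_degree[of b] by simp_all
    moreover from this have "degree a < degree f"
      using nz by (simp add: ab degree_mult_eq)
    ultimately obtain P where "monic P" "irreducible P" "P dvd a"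
      using less.hyps by blast
    thus ?thesis
      unfolding ab(1) using dvd_mult2 by blast
  qed
qed

section \<open>Multiplicities and multiplicativity of the Kronecker symbol\<close>

lemma power_degree_le:
  fixes f :: "'a::field poly"
  assumes "irreducible P" "f \<noteq> 0" "P ^ k dvd f"
  shows "k * degree P \<le> degree f" "k \<le> degree f"
proof -
  have "P \<noteq> 0"
    using assms by auto
  show 1: "k * degree P \<le> degree f"
    using dvd_imp_degree_le[OF assms(3,2)] \<open>P \<noteq> 0\<close> by (simp add: degree_power_eq)
  have "degree P > 0"
    using assms irreducible_imp_degree_pos by blast
  hence "k * 1 \<le> k * degree P"
    by (intro mult_le_mono) auto
  thus "k \<le> degree f"
    using 1 by (metis mult_1_right order.trans)
qed

lemma irreducible_power_dvd_mult:
  fixes f g :: "'a::field poly"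
  assumes P: "irreducible P" and f: "\<not> P dvd f"
  shows "P ^ k dvd f * g \<longleftrightarrow> P ^ k dvd g"
proof
  show "P ^ k dvd f * g \<Longrightarrow> P ^ k dvd g"
  proof (induction k)
    case (Suc k)
    have "P ^ k dvd P ^ Suc k"
      by (rule le_imp_power_dvd) simp
    hence "P ^ k dvd g"
      using Suc.prems Suc.IH dvd_trans by blast
    then obtain c where c: "g = P ^ k * c" ..
    have "P ^ k * P dvd P ^ k * (f * c)"
      using Suc.prems unfolding c by (simp add: mult_ac)
    moreover have "P ^ k \<noteq> 0"
      using P by auto
    ultimately have "P dvd f * c"
      by (subst (asm) dvd_mult_cancel_left) auto
    hence "P dvd c"
      using f irreducible_dvd_mult_iff[OF P] by blast
    thus ?case
      unfolding c by (simp add: mult.commute mult_dvd_mono)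
  qed simp
qed simp

definition mult_of :: "'a::field poly \<Rightarrow> 'a poly \<Rightarrow> nat" where
  "mult_of P f = Max {k. P ^ k dvd f}"

lemma le_mult_of_iff:
  fixes f :: "'a::field poly"
  assumes "irreducible P" "f \<noteq> 0"
  shows "k \<le> mult_of P f \<longleftrightarrow> P ^ k dvd f"
proof -
  have fin: "finite {k. P ^ k dvd f}"
    by (rule finite_subset[of _ "{..degree f}"]) (use power_degree_le[OF assms] in auto)
  have ne: "0 \<in> {k. P ^ k dvd f}"
    by simp
  have "Max {k. P ^ k dvd f} \<in> {k. P ^ k dvd f}"
    using ne by (intro Max_in[OF fin]) blast
  hence dvd: "P ^ mult_of P f dvd f"
    by (simp add: mult_of_def)
  show ?thesis
  proof
    assume "k \<le> mult_of P f"
    thus "P ^ k dvd f"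
      using dvd_trans[OF le_imp_power_dvd dvd] by blast
  next
    assume "P ^ k dvd f"
    thus "k \<le> mult_of P f"
      unfolding mult_of_def by (intro Max_ge[OF fin]) simp
  qed
qed

lemma mult_of_eqI:
  assumes "irreducible P" "f \<noteq> 0" "\<And>k. P ^ k dvd f \<longleftrightarrow> k \<le> n"
  shows "mult_of P f = n"
proof (rule antisym)
  show "mult_of P f \<le> n"
    using le_mult_of_iff[OF assms(1,2), of "mult_of P f"] assms(3) by simp
  show "n \<le> mult_of P f"
    using le_mult_of_iff[OF assms(1,2), of n] assms(3) by simp
qed

lemma mult_of_mult_self:
  fixes f :: "'a::field poly"
  assumes "irreducible P" "f \<noteq> 0"
  shows "mult_of P (P * f) = Suc (mult_of P f)"
proof (rule mult_of_eqI)
  have "P \<noteq> 0"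
    using assms by auto
  thus "P * f \<noteq> 0"
    using assms by simp
  fix k show "P ^ k dvd P * f \<longleftrightarrow> k \<le> Suc (mult_of P f)"
    using \<open>P \<noteq> 0\<close> le_mult_of_iff[OF assms] by (cases k) auto
qed fact

lemma mult_of_mult_other:
  fixes f g :: "'a::field poly"
  assumes "irreducible P" "\<not> P dvd f" "g \<noteq> 0"
  shows "mult_of P (f * g) = mult_of P g"
  using assms irreducible_power_dvd_mult[OF assms(1,2)] le_mult_of_iff[OF assms(1,3)]
  by (intro mult_of_eqI) auto

lemma monic_irreducible_dvd_imp_eq:
  fixes P Q :: "'a::field poly"
  assumes "monic P" "irreducible P" "monic Q" "irreducible Q" "P dvd Q"
  shows "P = Q"
proof -
  have "\<not> P dvd 1"
    using assms by (auto simp: irreducible_def)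
  hence "Q dvd P"
    using irreducibleD'[OF assms(4,5)] by blast
  thus ?thesis
    using assms by (intro monic_dvd_antisym)
qed

lemma finite_monic_degree_le: "finite {f :: 'a::{field,finite} poly. monic f \<and> degree f \<le> n}"
proof -
  have "{f :: 'a poly. monic f \<and> degree f \<le> n} = (\<Union>k\<le>n. {f. monic f \<and> degree f = k})"
    by auto
  thus ?thesis by simp
qed

text \<open>An index set common to all f of bounded degree allows the symbols of g and P g to be
  compared factor by factor.\<close>

lemma kronecker_symbol_altdef:
  fixes f :: "'a::{field,finite} poly"
  assumes "f \<noteq> 0" "degree f \<le> n"
  shows "kronecker_symbol D f = (\<Prod>P | monic P \<and> irreducible P \<and> degree P \<le> n. residue_symbol D P ^ mult_of P f)"
  unfolding kronecker_symbol_def mult_of_def[symmetric]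
proof (rule prod.mono_neutral_left)
  show "finite {P :: 'a poly. monic P \<and> irreducible P \<and> degree P \<le> n}"
    by (rule finite_subset[OF _ finite_monic_degree_le[of n]]) auto
  show "{P. monic P \<and> irreducible P \<and> P dvd f} \<subseteq> {P. monic P \<and> irreducible P \<and> degree P \<le> n}"
    using dvd_imp_degree_le[OF _ assms(1)] assms(2) by (auto intro: order.trans)
  have "mult_of P f = 0" if "irreducible P" "\<not> P dvd f" for P
    using le_mult_of_iff[OF that(1) assms(1), of 1] that(2) by simp
  thus "\<forall>P\<in>{P. monic P \<and> irreducible P \<and> degree P \<le> n} - {P. monic P \<and> irreducible P \<and> P dvd f}.
      residue_symbol D P ^ mult_of P f = 1"
    by auto
qed

lemma kronecker_symbol_1: "kronecker_symbol D 1 = 1"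
  unfolding kronecker_symbol_def by (rule prod.neutral) (auto simp: irreducible_def)

lemma kronecker_symbol_mult_irreducible:
  fixes P g :: "'a::{field,finite} poly"
  assumes P: "monic P" "irreducible P" and g: "g \<noteq> 0"
  shows "kronecker_symbol D (P * g) = residue_symbol D P * kronecker_symbol D g"
proof -
  define n where "n = degree P + degree g"
  define A where "A = {P :: 'a poly. monic P \<and> irreducible P \<and> degree P \<le> n}"
  have P0: "P \<noteq> 0"
    using P by auto
  have [simp]: "finite A"
    unfolding A_def by (rule finite_subset[OF _ finite_monic_degree_le[of n]]) auto
  have "P \<in> A"
    using P by (simp add: A_def n_def)
  have other: "mult_of P' (P * g) = mult_of P' g" if "P' \<in> A - {P}" for P'
    using that P g monic_irreducible_dvd_imp_eq[of P' P] by (intro mult_of_mult_other) (auto simp: A_def)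
  have "kronecker_symbol D (P * g) = (\<Prod>P'\<in>A. residue_symbol D P' ^ mult_of P' (P * g))"
    unfolding A_def using P0 g by (intro kronecker_symbol_altdef) (auto simp: n_def degree_mult_eq)
  also have "\<dots> = residue_symbol D P ^ Suc (mult_of P g) * (\<Prod>P'\<in>A - {P}. residue_symbol D P' ^ mult_of P' g)"
    using \<open>P \<in> A\<close> other by (simp add: prod.remove[of A P] mult_of_mult_self P g)
  also have "\<dots> = residue_symbol D P * (\<Prod>P'\<in>A. residue_symbol D P' ^ mult_of P' g)"
    using \<open>P \<in> A\<close> by (simp add: prod.remove[of A P])
  also have "(\<Prod>P'\<in>A. residue_symbol D P' ^ mult_of P' g) = kronecker_symbol D g"
    unfolding A_def using g by (intro kronecker_symbol_altdef[symmetric]) (auto simp: n_def)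
  finally show ?thesis .
qed

text \<open>\<open>mangoldt_sum \<psi> m\<close> is the sum of \<open>\<Lambda>(f) \<psi>(f)\<close> over the monic \<open>f\<close> of degree \<open>m\<close>, with
  \<open>\<Lambda>(P ^ k) = degree P\<close>.\<close>

definition prime_powers :: "nat \<Rightarrow> ('a::field poly \<times> nat) set" where
  "prime_powers m = {(P, k). monic P \<and> irreducible P \<and> k > 0 \<and> k * degree P = m}"

definition mangoldt_sum :: "('a::field poly \<Rightarrow> real) \<Rightarrow> nat \<Rightarrow> real" where
  "mangoldt_sum \<psi> m = (\<Sum>(P, k)\<in>prime_powers m. real (degree P) * \<psi> P ^ k)"

text \<open>The coefficient of u^n in the L-function of \<psi>, where u = q^(-s).\<close>

definition coeff_sum_of :: "('a::field poly \<Rightarrow> real) \<Rightarrow> nat \<Rightarrow> real" where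
  "coeff_sum_of \<psi> n = (\<Sum>f | monic f \<and> degree f = n. \<psi> f)"

lemma finite_prime_powers: "finite {(P :: 'a::{field,finite} poly, k). monic P \<and> irreducible P \<and> k > 0 \<and> k * degree P \<le> n}"
proof (rule finite_subset)
  show "{(P :: 'a poly, k). monic P \<and> irreducible P \<and> k > 0 \<and> k * degree P \<le> n}
      \<subseteq> {f. monic f \<and> degree f \<le> n} \<times> {..n}"
  proof safe
    fix P :: "'a poly" and k
    assume *: "irreducible P" "k > 0" "k * degree P \<le> n"
    have "degree P > 0"
      using *(1) irreducible_imp_degree_pos by blast
    hence "k * 1 \<le> k * degree P" "1 * degree P \<le> k * degree P"
      using * by (auto intro!: mult_le_mono simp del: mult_le_cancel1 mult_le_cancel2 simp: Suc_le_eq)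
    thus "degree P \<le> n" "k \<le> n"
      using *(3) by linarith+
  qed
qed (simp add: finite_monic_degree_le)

lemma finite_prime_powers_eq [simp]: "finite (prime_powers m :: ('a::{field,finite} poly \<times> nat) set)"
  unfolding prime_powers_def by (rule finite_subset[OF _ finite_prime_powers[of m]]) auto

text \<open>The analogue of log |f| being the sum of \<Lambda>(d) over the divisors d of f. Removing
  one factor Q from f removes exactly one pair, the one whose exponent is the full multiplicity of
  Q.\<close>

lemma degree_eq_sum_prime_powers:
  fixes f :: "'a::{field,finite} poly"
  assumes "monic f"
  shows "degree f = (\<Sum>(P, k)\<in>{(P, k). monic P \<and> irreducible P \<and> k > 0 \<and> P ^ k dvd f}. degree P)"
  using assms
proof (induction "degree f" arbitrary: f rule: less_induct)
  case less
  define A where "A = (\<lambda>f :: 'a poly. {(P, k). monic P \<and> irreducible P \<and> k > 0 \<and> P ^ k dvd f})"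
  have fin: "finite (A g)" if "g \<noteq> 0" for g
    by (rule finite_subset[OF _ finite_prime_powers[of "degree g"]])
      (use power_degree_le[OF _ that] in \<open>auto simp: A_def\<close>)
  show ?case
  proof (cases "degree f = 0")
    case True
    then obtain c where "f = [:c:]"
      by (rule degree_eq_zeroE)
    hence "f = 1"
      using less.prems by (simp add: one_pCons)
    have "A f = {}"
    proof -
      have False if "irreducible P" "k > 0" "P ^ k dvd f" for P k
        using power_degree_le[OF that(1) _ that(3)] that(2) True \<open>f = 1\<close> by simp
      thus ?thesis
        by (auto simp: A_def)
    qed
    thus ?thesis
      using True unfolding A_def by (simp only: sum.empty)
  next
    case False
    then obtain Q where Q: "monic Q" "irreducible Q" "Q dvd f"
      using ex_monic_irreducible_dvd by blast
    then obtain g where f: "f = Q * g"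
      by blast
    have "monic g"
      using less.prems Q unfolding f lead_coeff_mult by simp
    hence nz: "Q \<noteq> 0" "g \<noteq> 0"
      using Q by auto
    have deg: "degree f = degree Q + degree g"
      using nz by (simp add: f degree_mult_eq)
    have iff: "P ^ k dvd f \<longleftrightarrow> P ^ k dvd g \<or> (P = Q \<and> k = Suc (mult_of Q g))"
      if "monic P" "irreducible P" for P k
    proof (cases "P = Q")
      case True
      have "P ^ k dvd f \<longleftrightarrow> k \<le> Suc (mult_of Q g)"
        using le_mult_of_iff[of Q f k] mult_of_mult_self[OF Q(2) nz(2)] Q nz f True by auto
      thus ?thesis
        using le_mult_of_iff[OF Q(2) nz(2), of k] True by auto
    next
      case False
      hence "\<not> P dvd Q"
        using monic_irreducible_dvd_imp_eq[of P Q] that Q by blast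
      thus ?thesis
        using False irreducible_power_dvd_mult[OF that(2), of Q k g] by (simp add: f)
    qed
    have "\<not> Q ^ Suc (mult_of Q g) dvd g"
      using le_mult_of_iff[OF Q(2) nz(2), of "Suc (mult_of Q g)"] by simp
    hence new: "(Q, Suc (mult_of Q g)) \<notin> A g"
      by (simp add: A_def)
    have "A f = insert (Q, Suc (mult_of Q g)) (A g)"
      using iff Q by (auto simp: A_def)
    hence "(\<Sum>(P, k)\<in>A f. degree P) = degree Q + (\<Sum>(P, k)\<in>A g. degree P)"
      using new fin[OF nz(2)] by simp
    also have "(\<Sum>(P, k)\<in>A g. degree P) = degree g"
      using less.hyps[of g] \<open>monic g\<close> deg irreducible_imp_degree_pos[OF Q(2)] unfolding A_def by linarith
    finally show ?thesis
      using deg unfolding A_def by linarith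
  qed
qed

text \<open>The logarithmic derivative of the Euler product, in coefficients. Each f is weighted by
  its degree, the degree is distributed over the prime powers dividing f, and the multiples of each
  prime power are collected.\<close>

theorem coeff_sum_recurrence:
  fixes \<psi> :: "'a::{field,finite} poly \<Rightarrow> real"
  assumes mult: "\<And>P g. monic P \<Longrightarrow> irreducible P \<Longrightarrow> monic g \<Longrightarrow> \<psi> (P * g) = \<psi> P * \<psi> g"
  shows "real n * coeff_sum_of \<psi> n = (\<Sum>m=1..n. mangoldt_sum \<psi> m * coeff_sum_of \<psi> (n - m))"
proof -
  define T where "T = {(P :: 'a poly, k). monic P \<and> irreducible P \<and> k > 0 \<and> k * degree P \<le> n}"
  define w where "w = (\<lambda>(P :: 'a poly, k :: nat). k * degree P)"
  have [simp]: "finite T"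
    unfolding T_def by (rule finite_prime_powers)
  have pow: "\<psi> (P ^ k * g) = \<psi> P ^ k * \<psi> g" if "monic P" "irreducible P" "monic g" for P g :: "'a poly" and k
  proof (induction k)
    case (Suc k)
    have "monic (P ^ k * g)"
      using that by (simp add: lead_coeff_mult lead_coeff_power)
    thus ?case
      using Suc mult[OF that(1,2), of "P ^ k * g"] by (simp add: mult_ac)
  qed simp
  have inner: "(\<Sum>f | monic f \<and> degree f = n \<and> P ^ k dvd f. \<psi> f) = \<psi> P ^ k * coeff_sum_of \<psi> (n - w (P, k))"
    if "(P, k) \<in> T" for P :: "'a poly" and k
  proof -
    have P: "monic P" "irreducible P" "k * degree P \<le> n" "P \<noteq> 0"
      using that by (auto simp: T_def)
    have "(\<Sum>g :: 'a poly | monic g \<and> degree g = n - w (P, k). \<psi> (P ^ k * g)) =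
          (\<Sum>f | monic f \<and> degree f = n \<and> P ^ k dvd f. \<psi> f)"
    proof (rule sum.reindex_bij_witness[of _ "\<lambda>f. f div P ^ k" "\<lambda>g. P ^ k * g"])
      fix g :: "'a poly" assume g: "g \<in> {g. monic g \<and> degree g = n - w (P, k)}"
      hence "g \<noteq> 0"
        by auto
      have "lead_coeff P = 1" "lead_coeff g = 1"
        using g P by blast+
      hence "monic (P ^ k * g)"
        unfolding lead_coeff_mult lead_coeff_power by simp
      thus "P ^ k * g \<in> {f. monic f \<and> degree f = n \<and> P ^ k dvd f}"
        using g P \<open>g \<noteq> 0\<close> by (auto simp: degree_mult_eq degree_power_eq w_def)
    next
      fix f :: "'a poly" assume f: "f \<in> {f. monic f \<and> degree f = n \<and> P ^ k dvd f}"
      then obtain g where g: "f = P ^ k * g"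
        by auto
      have "monic g"
        using f P unfolding g by (simp add: lead_coeff_mult lead_coeff_power)
      moreover from this have "g \<noteq> 0"
        by auto
      ultimately show "f div P ^ k \<in> {g. monic g \<and> degree g = n - w (P, k)}"
        using f P unfolding g by (auto simp: degree_mult_eq degree_power_eq w_def)
    qed (use P in auto)
    moreover have "(\<Sum>g :: 'a poly | monic g \<and> degree g = n - w (P, k). \<psi> (P ^ k * g)) =
        (\<Sum>g | monic g \<and> degree g = n - w (P, k). \<psi> P ^ k * \<psi> g)"
      by (intro sum.cong refl pow P) blast
    ultimately show ?thesis
      by (simp only: coeff_sum_of_def sum_distrib_left)
  qed
  have "real n * coeff_sum_of \<psi> n = (\<Sum>f | monic f \<and> degree f = n. real (degree f) * \<psi> f)"
    by (simp add: coeff_sum_of_def sum_distrib_left)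
  also have "\<dots> = (\<Sum>f | monic f \<and> degree f = n. \<Sum>(P, k)\<in>{(P, k). (P, k) \<in> T \<and> P ^ k dvd f}. real (degree P) * \<psi> f)"
  proof (rule sum.cong[OF refl])
    fix f :: "'a poly" assume f: "f \<in> {f. monic f \<and> degree f = n}"
    hence "f \<noteq> 0"
      by auto
    hence eq: "{(P, k). monic P \<and> irreducible P \<and> k > 0 \<and> P ^ k dvd f} = {(P, k). (P, k) \<in> T \<and> P ^ k dvd f}"
      using power_degree_le(1)[of _ f] f by (auto simp: T_def)
    have "degree f = (\<Sum>(P, k)\<in>{(P, k). (P, k) \<in> T \<and> P ^ k dvd f}. degree P)"
      unfolding eq[symmetric] by (intro degree_eq_sum_prime_powers) (use f in blast)
    hence "real (degree f) = (\<Sum>(P, k)\<in>{(P, k). (P, k) \<in> T \<and> P ^ k dvd f}. real (degree P))"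
      by (simp only: of_nat_sum case_prod_unfold)
    thus "real (degree f) * \<psi> f = (\<Sum>(P, k)\<in>{(P, k). (P, k) \<in> T \<and> P ^ k dvd f}. real (degree P) * \<psi> f)"
      by (simp only: sum_distrib_right case_prod_unfold)
  qed
  also have "\<dots> = (\<Sum>f | monic f \<and> degree f = n. \<Sum>p | p \<in> T \<and> fst p ^ snd p dvd f. real (degree (fst p)) * \<psi> f)"
    by (simp add: case_prod_unfold)
  also have "\<dots> = (\<Sum>p\<in>T. \<Sum>f | f \<in> {f. monic f \<and> degree f = n} \<and> fst p ^ snd p dvd f. real (degree (fst p)) * \<psi> f)"
    by (rule sum.swap_restrict) simp_all
  also have "\<dots> = (\<Sum>p\<in>T. real (degree (fst p)) * \<psi> (fst p) ^ snd p * coeff_sum_of \<psi> (n - w p))"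
    by (intro sum.cong refl) (use inner in \<open>simp flip: sum_distrib_left add: conj_assoc split: prod.splits\<close>)
  also have "\<dots> = (\<Sum>m\<in>{1..n}. \<Sum>p\<in>{p\<in>T. w p = m}. real (degree (fst p)) * \<psi> (fst p) ^ snd p * coeff_sum_of \<psi> (n - w p))"
  proof (rule sum.group[symmetric])
    show "w ` T \<subseteq> {1..n}"
      using irreducible_imp_degree_pos by (auto simp: T_def w_def Suc_le_eq)
  qed simp_all
  also have "\<dots> = (\<Sum>m=1..n. mangoldt_sum \<psi> m * coeff_sum_of \<psi> (n - m))"
  proof (rule sum.cong[OF refl])
    fix m assume "m \<in> {1..n}"
    hence "{p \<in> T. w p = m} = prime_powers m"
      by (auto simp: T_def w_def prime_powers_def)
    thus "(\<Sum>p\<in>{p\<in>T. w p = m}. real (degree (fst p)) * \<psi> (fst p) ^ snd p * coeff_sum_of \<psi> (n - w p)) =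
        mangoldt_sum \<psi> m * coeff_sum_of \<psi> (n - m)"
      by (simp add: mangoldt_sum_def case_prod_unfold sum_distrib_right)
        (intro sum.cong refl, auto simp: prime_powers_def w_def)
  qed
  finally show ?thesis .
qed

section \<open>Character sums over irreducible polynomials\<close>

text \<open>The prime polynomial theorem in exact form. There are q^k monic polynomials of degree k,
  so in the recurrence every smaller degree contributes q^n; of the total n q^n exactly q^n is left
  for degree n.\<close>

lemma mangoldt_sum_const_1:
  assumes "n > 0"
  shows "mangoldt_sum (\<lambda>_ :: 'a::{field,finite} poly. 1) n = real CARD('a) ^ n"
  using assms
proof (induction n rule: less_induct)
  case (less n)
  let ?q = "real CARD('a)"
  let ?\<Lambda> = "mangoldt_sum (\<lambda>_ :: 'a poly. 1)"
  have c: "coeff_sum_of (\<lambda>_ :: 'a poly. 1) k = ?q ^ k" for k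
    by (simp add: coeff_sum_of_def card_monic_of_degree)
  have "real n * ?q ^ n = (\<Sum>m=1..n. ?\<Lambda> m * ?q ^ (n - m))"
    using coeff_sum_recurrence[of "\<lambda>_ :: 'a poly. 1" n] by (simp add: c)
  also have "{1..n} = insert n {1..<n}"
    using less.prems by auto
  also have "(\<Sum>m\<in>\<dots>. ?\<Lambda> m * ?q ^ (n - m)) = ?\<Lambda> n + (\<Sum>m=1..<n. ?\<Lambda> m * ?q ^ (n - m))"
    by simp
  also have "(\<Sum>m=1..<n. ?\<Lambda> m * ?q ^ (n - m)) = (\<Sum>m=1..<n. ?q ^ n)"
    using less.IH by (intro sum.cong refl) (simp flip: power_add)
  also have "\<dots> = (real n - 1) * ?q ^ n"
    using less.prems by (simp add: of_nat_diff)
  finally show ?case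
    by (simp add: algebra_simps)
qed

lemma degree_mult_card_irreds_le:
  "n * card (irreds n :: 'a::{field,finite} poly set) \<le> CARD('a) ^ n"
proof (cases "n = 0")
  case False
  have inj: "inj_on (\<lambda>P :: 'a poly. (P, 1 :: nat)) (irreds n)"
    by (auto simp: inj_on_def)
  have "real (n * card (irreds n :: 'a poly set)) = (\<Sum>(P, k)\<in>(\<lambda>P. (P, 1 :: nat)) ` irreds n. real (degree (P :: 'a poly)))"
    by (subst sum.reindex[OF inj]) (simp add: irredsD(3) cong: sum.cong)
  also have "\<dots> \<le> (\<Sum>(P :: 'a poly, k)\<in>prime_powers n. real (degree P))"
    by (intro sum_mono2 finite_prime_powers_eq) (auto simp: irreds_def prime_powers_def)
  also have "\<dots> = real (CARD('a) ^ n)"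
    using mangoldt_sum_const_1[where 'a='a, of n] False by (simp add: mangoldt_sum_def)
  finally show ?thesis
    by (rule of_nat_le_iff[THEN iffD1])
qed auto

lemma sum_power_le:
  fixes q :: nat
  assumes "q \<ge> 2"
  shows "(\<Sum>d=1..n. q ^ d) \<le> 2 * q ^ n"
proof (induction n)
  case (Suc n)
  have "2 * q ^ n \<le> q ^ Suc n"
    using assms by simp
  moreover have "(\<Sum>d=1..Suc n. q ^ d) = (\<Sum>d=1..n. q ^ d) + q ^ Suc n"
    by simp
  ultimately show ?case
    using Suc.IH by linarith
qed simp

text \<open>The error comes from the prime powers with exponent at least 2. Their primes have degree
  at most n / 2, and each such prime determines its exponent.\<close>

lemma mangoldt_sum_approx:
  fixes \<psi> :: "'a::{field,finite} poly \<Rightarrow> real"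
  assumes \<psi>: "\<And>P. \<bar>\<psi> P\<bar> \<le> 1" and n: "n > 0"
  shows "\<bar>mangoldt_sum \<psi> n - real n * (\<Sum>P\<in>irreds n. \<psi> P)\<bar> \<le> 2 * real CARD('a) ^ (n div 2)"
proof -
  define A where "A = (\<lambda>P :: 'a poly. (P, 1 :: nat)) ` irreds n"
  define R where "R = prime_powers n - A"
  have inj: "inj_on (\<lambda>P :: 'a poly. (P, 1 :: nat)) (irreds n)"
    by (auto simp: inj_on_def)
  have "A \<subseteq> prime_powers n"
    by (auto simp: A_def irreds_def prime_powers_def)
  hence "mangoldt_sum \<psi> n = (\<Sum>(P, k)\<in>R. real (degree P) * \<psi> P ^ k) + (\<Sum>(P, k)\<in>A. real (degree P) * \<psi> P ^ k)"
    unfolding mangoldt_sum_def R_def by (intro sum.subset_diff) auto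
  also have "(\<Sum>(P, k)\<in>A. real (degree P) * \<psi> P ^ k) = real n * (\<Sum>P\<in>irreds n. \<psi> P)"
    unfolding A_def by (subst sum.reindex[OF inj]) (simp add: sum_distrib_left irredsD(3) cong: sum.cong)
  finally have "\<bar>mangoldt_sum \<psi> n - real n * (\<Sum>P\<in>irreds n. \<psi> P)\<bar> = \<bar>\<Sum>(P, k)\<in>R. real (degree P) * \<psi> P ^ k\<bar>"
    by simp
  also have "\<dots> \<le> (\<Sum>(P, k)\<in>R. \<bar>real (degree P) * \<psi> P ^ k\<bar>)"
    unfolding case_prod_unfold by (rule sum_abs)
  also have "\<dots> \<le> (\<Sum>p\<in>R. real (degree (fst p)))"
    unfolding case_prod_unfold using \<psi>
    by (intro sum_mono) (auto simp: abs_mult power_abs intro!: mult_left_le power_le_one)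
  also have "\<dots> = (\<Sum>P\<in>fst ` R. real (degree P))"
  proof (rule sum.reindex[symmetric, unfolded o_def])
    show "inj_on fst R"
    proof (rule inj_onI)
      fix x y assume xy: "x \<in> R" "y \<in> R" "fst x = fst y"
      hence "irreducible (fst x)" "snd x * degree (fst x) = n" "snd y * degree (fst x) = n"
        by (auto simp: R_def prime_powers_def)
      hence "snd x = snd y"
        using irreducible_imp_degree_pos[of "fst x"] by (metis mult_cancel2 not_less0)
      thus "x = y"
        using xy by (simp add: prod_eq_iff)
    qed
  qed
  also have "\<dots> \<le> (\<Sum>P\<in>(\<Union>d\<in>{1..n div 2}. irreds d). real (degree (P :: 'a poly)))"
  proof (rule sum_mono2)
    show "fst ` R \<subseteq> (\<Union>d\<in>{1..n div 2}. irreds d)"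
    proof safe
      fix P :: "'a poly" and k assume "(P, k) \<in> R"
      hence P: "monic P" "irreducible P" "k > 0" "k * degree P = n" "(P, k) \<notin> A"
        by (auto simp: R_def prime_powers_def)
      have "k \<noteq> 1"
        using P by (auto simp: A_def irreds_def)
      hence "2 * degree P \<le> k * degree P"
        using P by (intro mult_le_mono) auto
      hence "degree P \<in> {1..n div 2}"
        using P irreducible_imp_degree_pos[of P] by auto
      thus "fst (P, k) \<in> (\<Union>d\<in>{1..n div 2}. irreds d)"
        using P by (auto simp: irreds_def)
    qed
  qed auto
  also have "\<dots> = (\<Sum>d=1..n div 2. \<Sum>P\<in>irreds d. real (degree (P :: 'a poly)))"
    by (intro sum.UNION_disjoint) (auto dest: irredsD(3))
  also have "\<dots> = (\<Sum>d=1..n div 2. real (d * card (irreds d :: 'a poly set)))"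
    by (intro sum.cong refl) (simp add: irreds_def)
  also have "\<dots> \<le> (\<Sum>d=1..n div 2. real (CARD('a) ^ d))"
    by (intro sum_mono of_nat_mono degree_mult_card_irreds_le)
  also have "\<dots> = real (\<Sum>d=1..n div 2. CARD('a) ^ d)"
    by simp
  also have "\<dots> \<le> real (2 * CARD('a) ^ (n div 2))"
    using one_less_card_field[where 'a='a] by (intro of_nat_mono sum_power_le) auto
  finally show ?thesis
    by simp
qed

lemma degree_mult_card_irreds_ge:
  assumes "n > 0"
  shows "real (n * card (irreds n :: 'a::{field,finite} poly set)) \<ge> real CARD('a) ^ n - 2 * real CARD('a) ^ (n div 2)"
  using mangoldt_sum_approx[of "\<lambda>_ :: 'a poly. 1" n] assms by (simp add: mangoldt_sum_const_1)

text \<open>The balanced choice s = N div 2. If deg f is too large for it, then q^(N div 2) \<le> 8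
  deg f and the trivial bound by all irreducibles already suffices, which accounts for the
  16.\<close>

lemma stepanov_bound':
  fixes f :: "'a::{field,finite} poly"
  assumes odd: "odd CARD('a)" and P: "irreducible P" "P dvd f" "\<not> P ^ 2 dvd f"
    and \<epsilon>: "\<epsilon> = 1 \<or> \<epsilon> = (-1::int)"
  shows "2 * N * card {Q \<in> irreds N. residue_symbol f Q = \<epsilon>}
    \<le> CARD('a) ^ N + 16 * degree f * CARD('a) ^ (N - N div 2)"
proof (cases "8 * degree f < CARD('a) ^ (N div 2)")
  case True
  have "2 * N * card {Q \<in> irreds N. residue_symbol f Q = \<epsilon>}
    \<le> CARD('a) ^ N + 6 * degree f * CARD('a) ^ (N - N div 2)"
    by (rule stepanov_bound[OF odd P \<epsilon> _ _ True]) auto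
  thus ?thesis
    by (rule order.trans) (intro add_left_mono mult_right_mono, auto)
next
  case False
  have "N * card {Q \<in> irreds N. residue_symbol f Q = \<epsilon>} \<le> N * card (irreds N :: 'a poly set)"
    by (intro mult_le_mono card_mono) auto
  also have "\<dots> \<le> CARD('a) ^ N"
    by (rule degree_mult_card_irreds_le)
  finally have "2 * N * card {Q \<in> irreds N. residue_symbol f Q = \<epsilon>} \<le> 2 * CARD('a) ^ N"
    by simp
  also have "CARD('a) ^ N = CARD('a) ^ (N div 2) * CARD('a) ^ (N - N div 2)"
    by (simp flip: power_add)
  also have "2 * \<dots> \<le> 2 * (8 * degree f * CARD('a) ^ (N - N div 2))"
    using False by (intro mult_left_mono mult_right_mono) auto
  finally show ?thesis
    by simp
qed

text \<open>Stepanov's method bounds only from above, but it does so for both signs, and the two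
  counts add up to almost all irreducibles; hence neither can be too small. The constant is 16 + 2 +
  1: from Stepanov, from the count of irreducibles, and from the Q dividing f.\<close>

theorem character_sum_bound:
  fixes f :: "'a::{field,finite} poly"
  assumes odd: "odd CARD('a)" and P: "irreducible P" "P dvd f" "\<not> P ^ 2 dvd f" and N: "N > 0"
  shows "real N * \<bar>\<Sum>Q\<in>irreds N. real_of_int (residue_symbol f Q)\<bar>
    \<le> 19 * real (degree f) * real CARD('a) ^ (N - N div 2)"
proof -
  define A where "A = (\<lambda>\<epsilon> :: int. {Q \<in> irreds N. residue_symbol f Q = \<epsilon>})"
  define x where "x = (\<lambda>\<epsilon>. real N * real (card (A \<epsilon>)))"
  let ?q = "real CARD('a)" and ?E = "real (degree f) * real CARD('a) ^ (N - N div 2)"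
  have f0: "f \<noteq> 0"
    using P(3) by auto
  have m: "degree f \<ge> 1"
    using irreducible_imp_degree_pos[OF P(1)] dvd_imp_degree_le[OF P(2) f0] by linarith
  have fin [simp]: "finite (A \<epsilon>)" for \<epsilon>
    by (simp add: A_def)
  have un: "irreds N = A 1 \<union> A (-1) \<union> A 0"
    using residue_symbol_cases[of f] by (auto simp: A_def)
  have disj: "A 1 \<inter> A (-1) = {}" "(A 1 \<union> A (-1)) \<inter> A 0 = {}"
    by (auto simp: A_def)
  have "(\<Sum>Q\<in>irreds N. real_of_int (residue_symbol f Q)) =
      (\<Sum>Q\<in>A 1. real_of_int (residue_symbol f Q)) + (\<Sum>Q\<in>A (-1). real_of_int (residue_symbol f Q))
       + (\<Sum>Q\<in>A 0. real_of_int (residue_symbol f Q))"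
    unfolding un by (simp add: sum.union_disjoint disj)
  also have "(\<Sum>Q\<in>A \<epsilon>. real_of_int (residue_symbol f Q)) = of_int \<epsilon> * real (card (A \<epsilon>))" for \<epsilon>
    by (simp add: A_def)
  hence "(\<Sum>Q\<in>A 1. real_of_int (residue_symbol f Q)) + (\<Sum>Q\<in>A (-1). real_of_int (residue_symbol f Q))
       + (\<Sum>Q\<in>A 0. real_of_int (residue_symbol f Q)) = real (card (A 1)) - real (card (A (-1)))"
    by simp
  finally have sum: "real N * (\<Sum>Q\<in>irreds N. real_of_int (residue_symbol f Q)) = x 1 - x (-1)"
    by (simp only: x_def right_diff_distrib)
  have upper: "2 * x \<epsilon> \<le> ?q ^ N + 16 * ?E" if "\<epsilon> = 1 \<or> \<epsilon> = -1" for \<epsilon>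
  proof -
    have "real (2 * N * card (A \<epsilon>)) \<le> real (CARD('a) ^ N + 16 * degree f * CARD('a) ^ (N - N div 2))"
      unfolding A_def by (intro of_nat_mono stepanov_bound'[OF odd P that])
    thus ?thesis
      by (simp add: x_def)
  qed
  have "x 0 \<le> real (degree f)"
  proof -
    have "\<Prod>(A 0) dvd f"
      by (intro prod_irreducible_dvd) (auto simp: A_def residue_symbol_eq_0_iff dest: irredsD)
    hence "degree (\<Prod>(A 0)) \<le> degree f"
      using f0 by (rule dvd_imp_degree_le)
    moreover have "degree (\<Prod>(A 0)) = N * card (A 0)"
      by (subst degree_prod_sum_eq) (auto simp: A_def irreds_def)
    ultimately have "N * card (A 0) \<le> degree f"
      by simp
    thus ?thesis
      unfolding x_def by (simp flip: of_nat_mult)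
  qed
  moreover have "x 1 + x (-1) + x 0 = real (N * card (irreds N :: 'a poly set))"
    unfolding un by (simp add: card_Un_disjoint disj x_def algebra_simps)
  ultimately have lower: "x 1 + x (-1) \<ge> ?q ^ N - 2 * ?q ^ (N div 2) - real (degree f)"
    using degree_mult_card_irreds_ge[where 'a='a, OF N] by linarith
  have q1: "1 \<le> ?q"
    using one_less_card_field[where 'a='a] by simp
  have "1 * ?q ^ (N div 2) \<le> real (degree f) * ?q ^ (N - N div 2)"
    using m q1 by (intro mult_mono power_increasing) auto
  moreover have "real (degree f) * 1 \<le> real (degree f) * ?q ^ (N - N div 2)"
    using q1 by (intro mult_left_mono one_le_power) auto
  ultimately have "\<bar>x 1 - x (-1)\<bar> \<le> 19 * ?E"
    using lower upper[of 1] upper[of "-1"] by (simp add: abs_le_iff)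
  thus ?thesis
    unfolding sum[symmetric] using N by (simp add: abs_mult mult.assoc)
qed

section \<open>The value at 1 of the L-function\<close>

lemma sum_power_le_geometric:
  fixes \<theta> :: real
  assumes "0 \<le> \<theta>" "\<theta> < 1"
  shows "(\<Sum>m=1..n. \<theta> ^ m) \<le> \<theta> / (1 - \<theta>)"
proof -
  have "(\<Sum>m=1..n. \<theta> ^ m) * (1 - \<theta>) = \<theta> - \<theta> ^ Suc n"
  proof (induction n)
    case (Suc n)
    have "(\<Sum>m=1..Suc n. \<theta> ^ m) * (1 - \<theta>) = (\<Sum>m=1..n. \<theta> ^ m) * (1 - \<theta>) + \<theta> ^ Suc n * (1 - \<theta>)"
      by (simp add: distrib_right)
    also have "\<dots> = \<theta> - \<theta> ^ Suc (Suc n)"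
      unfolding Suc.IH by (simp add: algebra_simps)
    finally show ?case .
  qed simp
  also have "\<dots> \<le> \<theta>"
    using assms by simp
  finally show ?thesis
    using assms by (simp add: field_simps)
qed

text \<open>The sum on the right reproduces a bound K r'^n up to the factor \<open>B\<close>, and
  the factor n on the left outweighs \<open>B\<close> once n > n0. K is chosen to cover the initial
  terms.\<close>

lemma recurrence_growth:
  fixes a c :: "nat \<Rightarrow> real"
  assumes rec: "\<And>n. real n * c n = (\<Sum>m=1..n. a m * c (n - m))"
    and a: "\<And>m. m > 0 \<Longrightarrow> \<bar>a m\<bar> \<le> A * r ^ m" and r: "0 < r" "r < r'" and A: "A \<ge> 0"
  obtains K where "\<And>n. \<bar>c n\<bar> \<le> K * r' ^ n"
proof -
  define \<theta> where "\<theta> = r / r'"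
  have \<theta>: "0 < \<theta>" "\<theta> < 1"
    using r by (auto simp: \<theta>_def)
  define B where "B = A * (\<theta> / (1 - \<theta>))"
  obtain n0 :: nat where n0: "B \<le> real n0"
    using real_arch_simple by blast
  define K where "K = (\<Sum>n\<le>n0. \<bar>c n\<bar> / r' ^ n)"
  have K0: "K \<ge> 0"
    unfolding K_def using r by (intro sum_nonneg) auto
  have "\<bar>c n\<bar> \<le> K * r' ^ n" for n
  proof (induction n rule: less_induct)
    case (less n)
    show ?case
    proof (cases "n \<le> n0")
      case True
      have "\<bar>c n\<bar> / r' ^ n \<le> K"
        unfolding K_def by (rule member_le_sum) (use True r in auto)
      thus ?thesis
        using r by (simp add: field_simps)
    next
      case False
      have "real n * \<bar>c n\<bar> = \<bar>\<Sum>m=1..n. a m * c (n - m)\<bar>"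
        unfolding rec[symmetric] by (simp add: abs_mult)
      also have "\<dots> \<le> (\<Sum>m=1..n. \<bar>a m\<bar> * \<bar>c (n - m)\<bar>)"
        by (rule order.trans[OF sum_abs]) (simp add: abs_mult)
      also have "\<dots> \<le> (\<Sum>m=1..n. (A * r ^ m) * (K * r' ^ (n - m)))"
        using A r by (intro sum_mono mult_mono a less.IH) auto
      also have "\<dots> = (\<Sum>m=1..n. A * K * r' ^ n * \<theta> ^ m)"
      proof (rule sum.cong[OF refl])
        fix m assume "m \<in> {1..n}"
        hence "r' ^ n = r' ^ (n - m) * r' ^ m"
          by (simp flip: power_add)
        thus "(A * r ^ m) * (K * r' ^ (n - m)) = A * K * r' ^ n * \<theta> ^ m"
          using r by (simp add: \<theta>_def power_divide)
      qed
      also have "\<dots> = A * K * r' ^ n * (\<Sum>m=1..n. \<theta> ^ m)"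
        by (simp add: sum_distrib_left)
      also have "\<dots> \<le> A * K * r' ^ n * (\<theta> / (1 - \<theta>))"
        using A K0 r \<theta> by (intro mult_left_mono sum_power_le_geometric) auto
      also have "\<dots> = B * (K * r' ^ n)"
        by (simp add: B_def)
      also have "\<dots> \<le> real n * (K * r' ^ n)"
        using n0 False K0 r by (intro mult_right_mono) auto
      finally show ?thesis
        using False by (simp add: mult_le_cancel_left_pos)
    qed
  qed
  thus ?thesis
    using that by blast
qed

text \<open>The recurrence says \<open>F' = S' F\<close> for the power series \<open>F\<close> of \<open>c\<close> and
  \<open>S(x) = \<Sum>m\<ge>1. a m / m * x ^ m\<close>. At \<open>m = 0\<close> the summand is \<open>0\<close>.\<close>

lemma power_series_eq_exp:
  fixes a c :: "nat \<Rightarrow> real"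
  assumes rec: "\<And>n. real n * c n = (\<Sum>m=1..n. a m * c (n - m))" and c0: "c 0 = 1"
    and a: "\<And>m. m > 0 \<Longrightarrow> \<bar>a m\<bar> \<le> A * r ^ m"
    and r: "0 < r" "r < r'" and A: "A \<ge> 0" and x: "0 \<le> x" "x < \<rho>" "r' * \<rho> < 1"
  shows "summable (\<lambda>m. a m / real m * x ^ m)"
    and "(\<Sum>n. c n * x ^ n) = exp (\<Sum>m. a m / real m * x ^ m)"
proof -
  obtain K where K: "\<And>n. \<bar>c n\<bar> \<le> K * r' ^ n"
    using recurrence_growth[OF rec a r A] by blast
  define s where "s = (\<lambda>m. a m / real m)"
  have geo: "summable (\<lambda>n. K * (r' * \<rho>) ^ n)" "summable (\<lambda>n. A * (r' * \<rho>) ^ n)"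
    using x r by (intro summable_mult summable_geometric; simp)+
  have sumc: "summable (\<lambda>n. c n * \<rho> ^ n)"
  proof (rule summable_comparison_test[OF _ geo(1)], intro exI allI impI)
    fix n :: nat
    have "\<bar>c n\<bar> * \<rho> ^ n \<le> K * r' ^ n * \<rho> ^ n"
      using K x by (intro mult_right_mono) auto
    thus "norm (c n * \<rho> ^ n) \<le> K * (r' * \<rho>) ^ n"
      using x by (simp add: abs_mult power_mult_distrib)
  qed
  have s_le: "\<bar>s m\<bar> \<le> A * r' ^ m" for m
  proof (cases "m = 0")
    case False
    have "\<bar>s m\<bar> \<le> \<bar>a m\<bar>"
      using False mult_left_mono[of 1 "real m" "\<bar>a m\<bar>"] by (simp add: s_def field_simps)
    also have "\<dots> \<le> A * r ^ m"
      using a False by simp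
    also have "\<dots> \<le> A * r' ^ m"
      using A r by (intro mult_left_mono power_mono) auto
    finally show ?thesis .
  qed (use A in \<open>simp add: s_def\<close>)
  have sums: "summable (\<lambda>n. s n * \<rho> ^ n)"
  proof (rule summable_comparison_test[OF _ geo(2)], intro exI allI impI)
    fix n :: nat
    have "\<bar>s n\<bar> * \<rho> ^ n \<le> A * r' ^ n * \<rho> ^ n"
      using s_le x by (intro mult_right_mono) auto
    thus "norm (s n * \<rho> ^ n) \<le> A * (r' * \<rho>) ^ n"
      using x by (simp add: abs_mult power_mult_distrib)
  qed
  have \<rho>: "norm y < norm \<rho>" if "y \<in> {-\<rho><..<\<rho>}" for y
    using that by auto
  show "summable (\<lambda>m. a m / real m * x ^ m)"
    using powser_inside[OF sums \<rho>[of x]] x by (simp add: s_def)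
  define F where "F = (\<lambda>y. \<Sum>n. c n * y ^ n)"
  define S where "S = (\<lambda>y. \<Sum>n. s n * y ^ n)"
  have dF: "(F has_field_derivative (\<Sum>n. diffs c n * y ^ n)) (at y)" if "y \<in> {-\<rho><..<\<rho>}" for y
    unfolding F_def using termdiffs_strong[OF sumc \<rho>[OF that]] .
  have dS: "(S has_field_derivative (\<Sum>n. diffs s n * y ^ n)) (at y)" if "y \<in> {-\<rho><..<\<rho>}" for y
    unfolding S_def using termdiffs_strong[OF sums \<rho>[OF that]] .
  have eq: "(\<Sum>n. diffs c n * y ^ n) = (\<Sum>n. diffs s n * y ^ n) * F y" if y: "y \<in> {-\<rho><..<\<rho>}" for y
  proof -
    have "norm y < \<rho>"
      using y by auto
    then obtain z where z: "norm y < z" "z < \<rho>"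
      using dense by blast
    have "summable (\<lambda>n. diffs s n * z ^ n)"
      by (rule termdiff_converges[of z \<rho>]) (use z powser_inside[OF sums] in auto)
    hence 1: "summable (\<lambda>n. norm (diffs s n * y ^ n))"
      using z by (intro powser_insidea) auto
    have 2: "summable (\<lambda>n. norm (c n * y ^ n))"
      using \<rho>[OF y] by (intro powser_insidea[OF sumc])
    have "(\<Sum>n. diffs s n * y ^ n) * F y = (\<Sum>n. \<Sum>i\<le>n. (diffs s i * y ^ i) * (c (n - i) * y ^ (n - i)))"
      unfolding F_def by (rule Cauchy_product[OF 1 2])
    also have "(\<lambda>n. \<Sum>i\<le>n. (diffs s i * y ^ i) * (c (n - i) * y ^ (n - i))) = (\<lambda>n. diffs c n * y ^ n)"
    proof
      fix n
      have "diffs c n = (\<Sum>m=1..Suc n. a m * c (Suc n - m))"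
        using rec[of "Suc n"] by (simp add: diffs_def)
      also have "\<dots> = (\<Sum>i\<le>n. a (Suc i) * c (n - i))"
        unfolding One_nat_def sum.shift_bounds_cl_Suc_ivl by (simp add: atMost_atLeast0)
      also have "\<dots> = (\<Sum>i\<le>n. diffs s i * c (n - i))"
        by (simp add: diffs_def s_def)
      finally have "diffs c n * y ^ n = (\<Sum>i\<le>n. diffs s i * c (n - i) * y ^ n)"
        by (simp add: sum_distrib_right)
      also have "\<dots> = (\<Sum>i\<le>n. (diffs s i * y ^ i) * (c (n - i) * y ^ (n - i)))"
      proof (rule sum.cong[OF refl])
        fix i assume "i \<in> {..n}"
        hence "y ^ n = y ^ i * y ^ (n - i)"
          by (simp flip: power_add)
        thus "diffs s i * c (n - i) * y ^ n = (diffs s i * y ^ i) * (c (n - i) * y ^ (n - i))"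
          by simp
      qed
      finally show "(\<Sum>i\<le>n. (diffs s i * y ^ i) * (c (n - i) * y ^ (n - i))) = diffs c n * y ^ n" ..
    qed
    finally show ?thesis ..
  qed
  \<comment> \<open>F' = S' F makes F exp(-S) constant, so it keeps its value 1 at 0.\<close>
  define h where "h = (\<lambda>y. F y * exp (- S y))"
  have "(h has_field_derivative 0) (at y within {-\<rho><..<\<rho>})" if y: "y \<in> {-\<rho><..<\<rho>}" for y
  proof (rule has_field_derivative_at_within)
    show "(h has_field_derivative 0) (at y)"
      unfolding h_def
      by (rule derivative_eq_intros dF[OF y] dS[OF y] refl)+ (simp add: eq[OF y])
  qed
  then obtain C where C: "\<And>y. y \<in> {-\<rho><..<\<rho>} \<Longrightarrow> h y = C"
    using has_field_derivative_zero_constant[of "{-\<rho><..<\<rho>}" h] by auto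
  have "F 0 = 1" "S 0 = 0"
    unfolding F_def S_def powser_zero by (simp_all add: s_def c0)
  hence "h 0 = 1"
    by (simp add: h_def)
  moreover have "h x = h 0"
    using C x by auto
  ultimately have "h x = 1"
    by simp
  hence "F x = exp (S x)"
    by (simp add: h_def exp_minus field_simps)
  thus "(\<Sum>n. c n * x ^ n) = exp (\<Sum>m. a m / real m * x ^ m)"
    by (simp add: F_def S_def s_def)
qed

section \<open>L(1) as an exponential of prime sums\<close>

lemma two_power_le:
  fixes q :: real
  assumes "q \<ge> 4"
  shows "2 ^ m \<le> 2 * q ^ (m div 2)"
proof -
  obtain k where k: "m = 2 * k \<or> m = 2 * k + 1"
    by (metis oddE evenE)
  have "(4::real) ^ k \<le> q ^ k"
    using assms by (intro power_mono) auto
  moreover have "(2::real) ^ (2 * k) = 4 ^ k"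
    by (simp add: power_mult)
  moreover have "0 \<le> q ^ k"
    using assms by simp
  ultimately show ?thesis
    using k by auto
qed

text \<open>Square-root cancellation is traded for 2^(-m), possible as q \<ge> 4; the factor 2 pays
  for rounding m / 2.\<close>

lemma power_half_div_le:
  fixes q :: real
  assumes "q \<ge> 4"
  shows "q ^ (m - m div 2) / q ^ m \<le> 2 / 2 ^ m" "q ^ (m div 2) / q ^ m \<le> 2 / 2 ^ m"
proof -
  have "q ^ m = q ^ (m - m div 2) * q ^ (m div 2)"
    by (simp flip: power_add)
  hence "q ^ (m - m div 2) / q ^ m = 1 / q ^ (m div 2)"
    using assms by simp
  also have "\<dots> \<le> 2 / 2 ^ m"
    using two_power_le[OF assms, of m] assms by (simp add: field_simps)
  finally show *: "q ^ (m - m div 2) / q ^ m \<le> 2 / 2 ^ m" .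
  have "q ^ (m div 2) \<le> q ^ (m - m div 2)"
    using assms by (intro power_increasing) auto
  hence "q ^ (m div 2) / q ^ m \<le> q ^ (m - m div 2) / q ^ m"
    using assms by (intro divide_right_mono) auto
  with * show "q ^ (m div 2) / q ^ m \<le> 2 / 2 ^ m"
    by linarith
qed

lemma abs_kronecker_symbol_le: "\<bar>real_of_int (kronecker_symbol D f)\<bar> \<le> 1"
proof -
  have "\<bar>real_of_int (residue_symbol D P)\<bar> \<le> 1" for P
    by (simp add: residue_symbol_def)
  thus ?thesis
    unfolding kronecker_symbol_def by (simp add: abs_prod power_abs) (intro prod_le_1, auto intro: power_le_one)
qed

lemma kronecker_symbol_irreducible:
  assumes "monic P" "irreducible P"
  shows "kronecker_symbol D P = residue_symbol D P"
  using kronecker_symbol_mult_irreducible[OF assms, of 1 D] by (simp add: kronecker_symbol_1)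

lemma L_chi_1_eq:
  "L_chi 1 (D :: 'a::{field,finite} poly) =
    (\<Sum>n. coeff_sum_of (\<lambda>f. real_of_int (kronecker_symbol D f)) n * (1 / real CARD('a)) ^ n)"
proof -
  have pos: "real CARD('a) > 0"
    by simp
  show ?thesis
    unfolding L_chi_def coeff_sum_of_def sum_distrib_right poly_abs_def
    by (intro arg_cong[of _ _ suminf] ext sum.cong refl)
       (use pos in \<open>auto simp: powr_minus powr_realpow power_divide field_simps\<close>)
qed

text \<open>Up to n the full von Mangoldt sums are kept, because they are evaluated exactly later.
  Between n and N prime powers are discarded, leaving prime sums suited to averaging. Beyond N the
  character sum bound applied to D itself is enough.\<close>

lemma L_chi_approx:
  fixes D :: "'a::{field,finite} poly"
  defines "q \<equiv> real CARD('a)" and "\<psi> \<equiv> \<lambda>f. real_of_int (kronecker_symbol D f)"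
  assumes odd: "odd CARD('a)" and q: "CARD('a) \<ge> 4" and D: "irreducible D" "degree D = N" and n: "0 < n" "n \<le> N"
  shows "\<exists>S. L_chi 1 D = exp S \<and>
    \<bar>S - (\<Sum>m=1..n. mangoldt_sum \<psi> m / (real m * q ^ m))
       - (\<Sum>m\<in>{n<..N}. \<Sum>P\<in>irreds m. real_of_int (residue_symbol D P) / q ^ m)\<bar> \<le> 42 / real n"
proof -
  define \<Lambda> where "\<Lambda> = mangoldt_sum \<psi>"
  define \<sigma> where "\<sigma> = (\<lambda>m. \<Sum>P\<in>irreds m. real_of_int (residue_symbol D P))"
  have q4: "q \<ge> 4"
    using q by (simp add: q_def)
  have D0: "D \<noteq> 0"
    using D by auto
  have degD: "degree D > 0"
    using D irreducible_imp_degree_pos by blast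
  have ndvd: "\<not> D ^ 2 dvd D"
  proof
    assume "D ^ 2 dvd D"
    from dvd_imp_degree_le[OF this D0] show False
      using degD D0 by (simp add: degree_power_eq)
  qed
  have \<sigma>: "real m * \<bar>\<sigma> m\<bar> \<le> 19 * real N * q ^ (m - m div 2)" if "m > 0" for m
    unfolding \<sigma>_def q_def D(2)[symmetric] by (rule character_sum_bound[OF odd D(1) dvd_refl ndvd that])
  have \<Lambda>: "\<bar>\<Lambda> m - real m * \<sigma> m\<bar> \<le> 2 * q ^ (m div 2)" if "m > 0" for m
  proof -
    have "\<sigma> m = (\<Sum>P\<in>irreds m. \<psi> P)"
      unfolding \<sigma>_def \<psi>_def
      by (intro sum.cong refl arg_cong[of _ _ real_of_int] kronecker_symbol_irreducible[symmetric])
        (auto dest: irredsD(1,2))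
    moreover have "\<bar>\<psi> P\<bar> \<le> 1" for P
      unfolding \<psi>_def by (rule abs_kronecker_symbol_le)
    ultimately show ?thesis
      unfolding \<Lambda>_def q_def using mangoldt_sum_approx[of \<psi> m] that by simp
  qed
  have \<Lambda>_le: "\<bar>\<Lambda> m\<bar> \<le> 42 * real N * (q / 2) ^ m" if m: "m > 0" for m
  proof -
    have "\<bar>\<Lambda> m\<bar> \<le> \<bar>real m * \<sigma> m\<bar> + 2 * q ^ (m div 2)"
      using \<Lambda>[OF m] by linarith
    also have "\<bar>real m * \<sigma> m\<bar> = real m * \<bar>\<sigma> m\<bar>"
      by (simp add: abs_mult)
    also have "\<dots> \<le> 19 * real N * q ^ (m - m div 2)"
      by (rule \<sigma>[OF m])
    also have "2 * q ^ (m div 2) \<le> 2 * real N * q ^ (m - m div 2)"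
      using n q4 by (intro mult_mono power_increasing) auto
    finally have "\<bar>\<Lambda> m\<bar> \<le> 21 * real N * q ^ (m - m div 2)"
      by simp
    also have "q ^ (m - m div 2) \<le> 2 * (q / 2) ^ m"
      using power_half_div_le(1)[OF q4, of m] q4 by (simp add: field_simps)
    hence "21 * real N * q ^ (m - m div 2) \<le> 21 * real N * (2 * (q / 2) ^ m)"
      by (intro mult_left_mono) auto
    finally show ?thesis
      by simp
  qed
  have rec: "real n * coeff_sum_of \<psi> n = (\<Sum>m=1..n. \<Lambda> m * coeff_sum_of \<psi> (n - m))" for n
    unfolding \<Lambda>_def
  proof (rule coeff_sum_recurrence)
    fix P g :: "'a poly" assume *: "monic P" "irreducible P" "monic g"
    hence "g \<noteq> 0"
      by auto
    with * show "\<psi> (P * g) = \<psi> P * \<psi> g"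
      using kronecker_symbol_mult_irreducible[of P g D] kronecker_symbol_irreducible[of P D]
      by (auto simp: \<psi>_def)
  qed
  have "{f :: 'a poly. monic f \<and> degree f = 0} = {1}"
    by (auto elim!: degree_eq_zeroE simp: one_pCons)
  hence c0: "coeff_sum_of \<psi> 0 = 1"
    by (simp add: coeff_sum_of_def \<psi>_def kronecker_symbol_1)
  define S where "S = (\<Sum>m. \<Lambda> m / real m * (1 / q) ^ m)"
  have summable: "summable (\<lambda>m. \<Lambda> m / real m * (1 / q) ^ m)"
    and L: "L_chi 1 D = exp S"
    unfolding S_def L_chi_1_eq q_def[symmetric] \<psi>_def[symmetric]
    \<comment> \<open>The growth rate is r = q / 2. The chosen r' and \<rho> satisfy q / 2 < r', 1 /
      q < \<rho> and r' \<rho> = 5 / 6.\<close>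
    by (rule power_series_eq_exp[OF rec c0 \<Lambda>_le, where r' = "2 * q / 3" and \<rho> = "5 / (4 * q)"];
      use q4 in \<open>simp add: field_simps\<close>)+
  have N0: "N > 0"
    using n by simp
  \<comment> \<open>The terms of \<open>b\<close> after n sum to exactly the error to be bounded:
    the prime sums with m \<le> n cancel.\<close>
  define b where "b = (\<lambda>m. \<Lambda> m / real m * (1 / q) ^ m - (if m \<le> N then \<sigma> m / q ^ m else 0))"
  have b_le: "\<bar>b m\<bar> \<le> 42 / 2 ^ m" if m: "m > 0" for m
  proof -
    have 1: "\<bar>\<Lambda> m / real m * (1 / q) ^ m - \<sigma> m / q ^ m\<bar> \<le> 4 / 2 ^ m"
    proof -
      have "\<bar>\<Lambda> m / real m * (1 / q) ^ m - \<sigma> m / q ^ m\<bar> = \<bar>\<Lambda> m - real m * \<sigma> m\<bar> / (real m * q ^ m)"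
      proof -
        have "\<Lambda> m / real m * (1 / q) ^ m - \<sigma> m / q ^ m = (\<Lambda> m - real m * \<sigma> m) / (real m * q ^ m)"
          using m q4 by (simp add: field_simps)
        thus ?thesis
          using q4 by (simp add: abs_mult)
      qed
      also have "\<dots> \<le> \<bar>\<Lambda> m - real m * \<sigma> m\<bar> / q ^ m"
        using m q4 by (intro divide_left_mono) auto
      also have "\<dots> \<le> 2 * q ^ (m div 2) / q ^ m"
        using \<Lambda>[OF m] q4 by (intro divide_right_mono) auto
      also have "\<dots> \<le> 2 * (2 / 2 ^ m)"
        using power_half_div_le(2)[OF q4, of m] by simp
      finally show ?thesis by simp
    qed
    show ?thesis
    proof (cases "m \<le> N")
      case True
      thus ?thesis
        using 1 by (auto simp: b_def intro: order.trans divide_right_mono)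
    next
      case False
      \<comment> \<open>For m > N the factor N / m is below 1, so the degree of D drops out of the
        bound.\<close>
      have "real m * \<bar>\<sigma> m\<bar> \<le> 19 * real m * q ^ (m - m div 2)"
        using False q4 by (intro order.trans[OF \<sigma>[OF m]] mult_right_mono) auto
      hence "\<bar>\<sigma> m\<bar> \<le> 19 * q ^ (m - m div 2)"
        using m by (simp add: mult_le_cancel_left_pos mult.assoc mult.left_commute)
      hence "\<bar>\<sigma> m\<bar> / q ^ m \<le> 19 * q ^ (m - m div 2) / q ^ m"
        using q4 by (intro divide_right_mono) auto
      hence "\<bar>\<sigma> m / q ^ m\<bar> \<le> 19 * (2 / 2 ^ m)"
        using power_half_div_le(1)[OF q4, of m] q4 by simp
      hence "\<bar>\<Lambda> m / real m * (1 / q) ^ m\<bar> \<le> 4 / 2 ^ m + 19 * (2 / 2 ^ m)"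
        using 1 by linarith
      also have "\<dots> = 42 / 2 ^ m"
        by (simp add: field_simps)
      finally show ?thesis
        using False by (simp add: b_def)
    qed
  qed
  have summ2: "summable (\<lambda>m. if m \<le> N then \<sigma> m / q ^ m else 0)"
    by (rule summable_finite[of "{..N}"]) auto
  have sumb: "summable b"
    unfolding b_def by (intro summable_diff summable summ2)
  have tail: "S - (\<Sum>m=1..n. \<Lambda> m / (real m * q ^ m)) - (\<Sum>m\<in>{n<..N}. \<sigma> m / q ^ m) = (\<Sum>m. b (m + Suc n))"
  proof -
    have "S - (\<Sum>m. if m \<le> N then \<sigma> m / q ^ m else 0) = (\<Sum>m. b m)"
      unfolding S_def b_def by (intro suminf_diff summable summ2)
    also have "\<dots> = (\<Sum>m. b (m + Suc n)) + (\<Sum>m<Suc n. b m)"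
      by (rule suminf_split_initial_segment[OF sumb])
    also have "(\<Sum>m. if m \<le> N then \<sigma> m / q ^ m else 0) = (\<Sum>m\<le>N. \<sigma> m / q ^ m)"
      by (subst suminf_finite[of "{..N}"]) auto
    also have "{..N} = {..n} \<union> {n<..N}"
      using n by auto
    also have "(\<Sum>m\<in>\<dots>. \<sigma> m / q ^ m) = (\<Sum>m\<le>n. \<sigma> m / q ^ m) + (\<Sum>m\<in>{n<..N}. \<sigma> m / q ^ m)"
      by (rule sum.union_disjoint) auto
    also have "(\<Sum>m<Suc n. b m) = (\<Sum>m\<le>n. \<Lambda> m / real m * (1 / q) ^ m) - (\<Sum>m\<le>n. \<sigma> m / q ^ m)"
      unfolding b_def lessThan_Suc_atMost sum_subtractf[symmetric] using n by (intro sum.cong) auto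
    also have "{..n} = insert 0 {1..n}"
      by auto
    also have "(\<Sum>m\<in>\<dots>. \<Lambda> m / real m * (1 / q) ^ m) = (\<Sum>m=1..n. \<Lambda> m / (real m * q ^ m))"
      by (simp add: power_divide)
    finally show ?thesis
      by simp
  qed
  have geo: "(\<lambda>m. 42 / 2 ^ (m + Suc n)) sums (42 / 2 ^ n :: real)"
  proof -
    have "(\<lambda>m. (42 / 2 ^ Suc n) * (1 / 2) ^ m) sums ((42 / 2 ^ Suc n) * (1 / (1 - 1 / 2)) :: real)"
      by (intro sums_mult geometric_sums) simp
    thus ?thesis
      by (simp add: power_add power_divide field_simps)
  qed
  have "\<bar>\<Sum>m. b (m + Suc n)\<bar> \<le> 42 / 2 ^ n"
  proof -
    have "norm (\<Sum>m. b (m + Suc n)) \<le> (\<Sum>m. 42 / 2 ^ (m + Suc n))"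
    proof (rule norm_suminf_le[OF _ sums_summable[OF geo]])
      show "norm (b (m + Suc n)) \<le> 42 / 2 ^ (m + Suc n)" for m
        unfolding real_norm_def by (rule b_le) simp
    qed
    thus ?thesis
      using sums_unique[OF geo] by simp
  qed
  also have "42 / 2 ^ n \<le> 42 / real n"
  proof -
    have "real n \<le> 2 ^ n"
      by (metis less_exp nless_le of_nat_less_iff of_nat_numeral of_nat_power)
    thus ?thesis
      using n by (intro divide_left_mono) auto
  qed
  finally show ?thesis
    using L unfolding tail[symmetric] \<Lambda>_def \<sigma>_def sum_divide_distrib by blast
qed

section \<open>Averaging over irreducible polynomials\<close>

lemma mangoldt_sum_cong:
  assumes "\<And>P. monic P \<Longrightarrow> irreducible P \<Longrightarrow> degree P \<le> m \<Longrightarrow> f P = g P"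
  shows "mangoldt_sum f m = mangoldt_sum g m"
  unfolding mangoldt_sum_def
proof (rule sum.cong[OF refl], safe)
  fix P :: "'a poly" and k assume "(P, k) \<in> prime_powers m"
  hence P: "monic P" "irreducible P" "k > 0" "k * degree P = m"
    by (auto simp: prime_powers_def)
  hence "1 * degree P \<le> m"
    unfolding P(4)[symmetric] by (intro mult_le_mono1) simp
  thus "real (degree P) * f P ^ k = real (degree P) * g P ^ k"
    using assms[OF P(1,2)] by simp
qed

text \<open>Even exponents have the opposite sign, which is corrected by adding them twice. Halving
  the exponent identifies them with the prime powers of degree m / 2.\<close>

lemma mangoldt_sum_const_minus_1:
  assumes "m > 0"
  shows "mangoldt_sum (\<lambda>_ :: 'a::{field,finite} poly. - 1) m =
    - (real CARD('a) ^ m) + (if even m then 2 * real CARD('a) ^ (m div 2) else 0)"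
proof -
  define E where "E = {p \<in> (prime_powers m :: ('a poly \<times> nat) set). even (snd p)}"
  have "mangoldt_sum (\<lambda>_ :: 'a poly. - 1) m =
      (\<Sum>p\<in>prime_powers m. - real (degree (fst p :: 'a poly)) + (if even (snd p) then 2 * real (degree (fst p)) else 0))"
    unfolding mangoldt_sum_def by (intro sum.cong refl) (auto simp: case_prod_unfold)
  also have "\<dots> = - mangoldt_sum (\<lambda>_ :: 'a poly. 1) m + (\<Sum>p\<in>E. 2 * real (degree (fst p)))"
    unfolding E_def mangoldt_sum_def
    by (simp add: sum_subtractf case_prod_unfold sum.inter_filter)
  also have "(\<Sum>p\<in>E. 2 * real (degree (fst p))) = (if even m then 2 * real CARD('a) ^ (m div 2) else 0)"
  proof (cases "even m")
    case False
    hence "E = {}"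
      by (auto simp: E_def prime_powers_def)
    thus ?thesis
      using False by simp
  next
    case True
    then obtain j where j: "m = 2 * j"
      by (rule evenE)
    have "(\<Sum>p\<in>E. 2 * real (degree (fst p))) = (\<Sum>p\<in>prime_powers j. 2 * real (degree (fst p :: 'a poly)))"
      by (rule sum.reindex_bij_witness[of _ "\<lambda>(P, k). (P, 2 * k)" "\<lambda>(P, k). (P, k div 2)"])
        (auto simp: E_def prime_powers_def j elim!: evenE)
    also have "\<dots> = 2 * mangoldt_sum (\<lambda>_ :: 'a poly. 1) j"
      by (simp add: mangoldt_sum_def sum_distrib_left case_prod_unfold)
    finally show ?thesis
      using assms j by (simp add: mangoldt_sum_const_1)
  qed
  finally show ?thesis
    using assms by (simp add: mangoldt_sum_const_1)
qed

lemma sum_power_div_le_ln: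
  fixes x :: real
  assumes "0 < x" "x < 1"
  shows "(\<Sum>j=1..n. x ^ j / real j) \<le> - ln (1 - x)"
proof -
  have "ln (1 - x) = (\<Sum>n. (- 1) ^ n * (1 / real (n + 1)) * ((1 - x) - 1) ^ Suc n)"
    using assms by (intro ln_series) auto
  also have "(\<lambda>n. (- 1) ^ n * (1 / real (n + 1)) * ((1 - x) - 1) ^ Suc n) = (\<lambda>n. - (x ^ Suc n / real (Suc n)))"
  proof
    fix n
    have "(- 1) ^ n * (- x) ^ Suc n = - (x ^ Suc n)"
      by (simp add: power_minus[of x])
    thus "(- 1) ^ n * (1 / real (n + 1)) * ((1 - x) - 1) ^ Suc n = - (x ^ Suc n / real (Suc n))"
      by (simp add: field_simps)
  qed
  finally have ln: "ln (1 - x) = (\<Sum>n. - (x ^ Suc n / real (Suc n)))" .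
  have summable: "summable (\<lambda>n. x ^ Suc n / real (Suc n))"
  proof (rule summable_comparison_test)
    show "summable (\<lambda>n. x ^ n)"
      using assms by (intro summable_geometric) auto
    show "\<exists>N. \<forall>n\<ge>N. norm (x ^ Suc n / real (Suc n)) \<le> x ^ n"
    proof (intro exI allI impI)
      fix n
      have "x ^ Suc n / real (Suc n) \<le> x ^ Suc n / 1"
        using assms by (intro divide_left_mono) auto
      also have "\<dots> \<le> x ^ n"
        using assms by (simp add: mult_left_le_one_le)
      finally show "norm (x ^ Suc n / real (Suc n)) \<le> x ^ n"
        using assms by simp
    qed
  qed
  have "(\<Sum>j=1..n. x ^ j / real j) = (\<Sum>j<n. x ^ Suc j / real (Suc j))"
    by (rule sum.reindex_bij_witness[of _ Suc "\<lambda>j. j - 1"]) auto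
  also have "\<dots> \<le> (\<Sum>n. x ^ Suc n / real (Suc n))"
    using assms by (intro sum_le_suminf summable) auto
  also have "\<dots> = - ln (1 - x)"
    using ln suminf_minus[OF summable] by simp
  finally show ?thesis .
qed

lemma head_plus:
  assumes "\<And>P :: 'a::{field,finite} poly. monic P \<Longrightarrow> irreducible P \<Longrightarrow> degree P \<le> n \<Longrightarrow> \<psi> P = 1"
  shows "(\<Sum>m=1..n. mangoldt_sum \<psi> m / (real m * real CARD('a) ^ m)) = harm n"
  unfolding harm_def
proof (rule sum.cong[OF refl])
  fix m assume m: "m \<in> {1..n}"
  have "mangoldt_sum \<psi> m = mangoldt_sum (\<lambda>_ :: 'a poly. 1) m"
    using assms m by (intro mangoldt_sum_cong) auto
  thus "mangoldt_sum \<psi> m / (real m * real CARD('a) ^ m) = inverse (real m)"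
    using m by (simp add: mangoldt_sum_const_1 field_simps)
qed

text \<open>For m = 2 j the correction by even powers contributes 2 q^j / (2 j q^(2j)) = q^(-j) / j,
  a term of the series of -ln (1 - 1/q).\<close>

lemma head_minus:
  assumes "\<And>P :: 'a::{field,finite} poly. monic P \<Longrightarrow> irreducible P \<Longrightarrow> degree P \<le> n \<Longrightarrow> \<psi> P = - 1"
  shows "(\<Sum>m=1..n. mangoldt_sum \<psi> m / (real m * real CARD('a) ^ m)) \<le> - harm n - ln (1 - 1 / real CARD('a))"
proof -
  let ?q = "real CARD('a)"
  have q: "?q > 1"
    using one_less_card_field[where 'a='a] by simp
  have "(\<Sum>m=1..n. mangoldt_sum \<psi> m / (real m * ?q ^ m)) =
      (\<Sum>m=1..n. - inverse (real m) + (if even m then 2 / (real m * ?q ^ (m div 2)) else 0))"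
  proof (rule sum.cong[OF refl])
    fix m assume m: "m \<in> {1..n}"
    have 1: "mangoldt_sum \<psi> m = mangoldt_sum (\<lambda>_ :: 'a poly. - 1) m"
      using assms m by (intro mangoldt_sum_cong) auto
    show "mangoldt_sum \<psi> m / (real m * ?q ^ m) = - inverse (real m) + (if even m then 2 / (real m * ?q ^ (m div 2)) else 0)"
    proof (cases "even m")
      case True
      hence "?q ^ m = ?q ^ (m div 2) * ?q ^ (m div 2)"
        by (simp flip: power_add mult_2)
      thus ?thesis
        using True m q by (simp add: 1 mangoldt_sum_const_minus_1 field_simps)
    next
      case False
      thus ?thesis
        using m q by (simp add: 1 mangoldt_sum_const_minus_1 field_simps)
    qed
  qed
  also have "\<dots> = - harm n + (\<Sum>m=1..n. if even m then 2 / (real m * ?q ^ (m div 2)) else 0)"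
    by (simp only: sum.distrib sum_negf harm_def)
  also have "(\<Sum>m=1..n. if even m then 2 / (real m * ?q ^ (m div 2)) else 0) =
      (\<Sum>m | m \<in> {1..n} \<and> even m. 2 / (real m * ?q ^ (m div 2)))"
    by (rule sum.inter_filter[symmetric]) simp
  also have "(\<Sum>m | m \<in> {1..n} \<and> even m. 2 / (real m * ?q ^ (m div 2))) = (\<Sum>j=1..n div 2. (1 / ?q) ^ j / real j)"
    by (rule sum.reindex_bij_witness[of _ "\<lambda>j. 2 * j" "\<lambda>m. m div 2"])
      (auto elim!: evenE simp: power_divide)
  also have "\<dots> \<le> - ln (1 - 1 / ?q)"
    using q by (intro sum_power_div_le_ln) auto
  finally show ?thesis
    by simp
qed

section \<open>Euler's constant and the value of zeta at 2\<close>

lemma harm_ge_ln_euler: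
  assumes "n > 0"
  shows "harm n \<ge> ln (real n) + euler_mascheroni"
proof -
  have "(\<lambda>n. harm (Suc n) - ln (real (Suc n))) \<longlonglongrightarrow> (euler_mascheroni :: real)"
    by (rule LIMSEQ_Suc[OF euler_mascheroni_LIMSEQ])
  hence "(euler_mascheroni :: real) \<le> harm (Suc (n - 1)) - ln (real (Suc (n - 1)))"
    by (intro decseq_ge decseq_harm_diff_ln)
  thus ?thesis
    using assms by simp
qed

text \<open>Turns the factor left by \<open>head_minus\<close> into zeta at 2; the inequality has
  the direction that an upper bound for L(1) calls for.\<close>

lemma zeta_poly_2_ge: "zeta_poly TYPE('a::{field,finite}) 2 \<ge> 1 / (1 - 1 / real CARD('a))"
proof -
  let ?q = "real CARD('a)"
  define g where "g = (\<lambda>f :: 'a poly. poly_abs f powr - 2)"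
  have q: "?q > 1"
    using one_less_card_field[where 'a='a] by simp
  have partial: "sum g {f. monic f \<and> degree f \<le> n} = (\<Sum>k\<le>n. (1 / ?q) ^ k)" for n
  proof -
    have "{f :: 'a poly. monic f \<and> degree f \<le> n} = (\<Union>k\<le>n. {f. monic f \<and> degree f = k})"
      by auto
    also have "sum g \<dots> = (\<Sum>k\<le>n. \<Sum>f | monic f \<and> degree f = k. g f)"
      by (intro sum.UNION_disjoint) auto
    also have "\<dots> = (\<Sum>k\<le>n. (1 / ?q) ^ k)"
    proof (rule sum.cong[OF refl])
      fix k
      have "(\<Sum>f | monic f \<and> degree f = k. g f) = (\<Sum>f :: 'a poly | monic f \<and> degree f = k. (?q ^ k) powr - 2)"
        by (intro sum.cong) (auto simp: g_def poly_abs_def)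
      also have "\<dots> = ?q ^ k * (?q ^ k) powr - 2"
        by (simp add: card_monic_of_degree)
      also have "(?q ^ k) powr - 2 = 1 / (?q ^ k) ^ 2"
        using q by (simp add: powr_minus powr_numeral divide_inverse)
      also have "?q ^ k * (1 / (?q ^ k) ^ 2) = (1 / ?q) ^ k"
        using q by (simp add: power2_eq_square power_divide)
      finally show "(\<Sum>f | monic f \<and> degree f = k. g f) = (1 / ?q) ^ k" .
    qed
    finally show ?thesis .
  qed
  have geo: "(\<lambda>k. (1 / ?q) ^ k) sums (1 / (1 - 1 / ?q))"
    using q by (intro geometric_sums) simp
  have nonneg: "g f \<ge> 0" for f
    by (simp add: g_def)
  \<comment> \<open>\<open>infsum\<close> is 0 for a family that is not summable, so this must
    precede any bound by finite sums.\<close>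
  have summable: "g summable_on {f. monic f}"
  proof (rule nonneg_bdd_above_summable_on)
    show "bdd_above (sum g ` {F. F \<subseteq> {f. monic f} \<and> finite F})"
    proof (rule bdd_aboveI2)
      fix F :: "'a poly set" assume F: "F \<in> {F. F \<subseteq> {f. monic f} \<and> finite F}"
      define n where "n = Max (insert 0 (degree ` F))"
      have "F \<subseteq> {f. monic f \<and> degree f \<le> n}"
        using F by (auto simp: n_def)
      hence "sum g F \<le> sum g {f. monic f \<and> degree f \<le> n}"
        by (intro sum_mono2 finite_monic_degree_le nonneg)
      also have "\<dots> \<le> (\<Sum>k. (1 / ?q) ^ k)"
        unfolding partial by (intro sum_le_suminf sums_summable[OF geo]) auto
      finally show "sum g F \<le> (\<Sum>k. (1 / ?q) ^ k)" .
    qed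
  qed (use nonneg in auto)
  have "(\<Sum>k\<le>n. (1 / ?q) ^ k) \<le> infsum g {f. monic f}" for n
    unfolding partial[symmetric]
    by (intro finite_sum_le_infsum summable finite_monic_degree_le) (use nonneg in auto)
  moreover have "(\<lambda>n. \<Sum>k\<le>n. (1 / ?q) ^ k) \<longlonglongrightarrow> 1 / (1 - 1 / ?q)"
    using geo by (simp add: sums_def_le)
  ultimately have "1 / (1 - 1 / ?q) \<le> infsum g {f. monic f}"
    by (intro LIMSEQ_le_const2) auto
  thus ?thesis
    by (simp add: zeta_poly_def g_def)
qed

text \<open>A product of distinct primes is squarefree, so any member of B can serve as the prime
  dividing it exactly once.\<close>

lemma character_sum_prod_bound:
  fixes B :: "'a::{field,finite} poly set"
  assumes odd: "odd CARD('a)" and B: "finite B" "B \<noteq> {}" "\<And>P. P \<in> B \<Longrightarrow> monic P \<and> irreducible P" and N: "N > 0"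
    and deg: "(\<Sum>P\<in>B. degree P) \<le> d"
  shows "\<bar>\<Sum>Q\<in>irreds N. \<Prod>P\<in>B. real_of_int (residue_symbol P Q)\<bar>
    \<le> 19 * real d * real CARD('a) ^ (N - N div 2) / real N"
proof -
  obtain P where P: "P \<in> B"
    using B by blast
  have PI: "monic P" "irreducible P"
    using B P by auto
  have split: "\<Prod>B = P * \<Prod>(B - {P})"
    using B P by (simp add: prod.remove)
  have "\<not> P ^ 2 dvd \<Prod>B"
  proof
    assume "P ^ 2 dvd \<Prod>B"
    hence "P dvd \<Prod>(B - {P})"
      using PI unfolding split power2_eq_square by (subst (asm) dvd_mult_cancel_left) auto
    then obtain P' where "P' \<in> B - {P}" "P dvd P'"
      using irreducible_dvd_prod[OF PI(2), of "\<lambda>x. x"] by blast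
    thus False
      using monic_irreducible_dvd_imp_eq[of P P'] PI B(3)[of P'] by auto
  qed
  moreover have "P dvd \<Prod>B"
    unfolding split by simp
  ultimately have "real N * \<bar>\<Sum>Q\<in>irreds N. real_of_int (residue_symbol (\<Prod>B) Q)\<bar>
    \<le> 19 * real (degree (\<Prod>B)) * real CARD('a) ^ (N - N div 2)"
    by (intro character_sum_bound[OF odd PI(2)] N)
  also have "degree (\<Prod>B) = (\<Sum>P\<in>B. degree P)"
    by (rule degree_prod_sum_eq) (use B(3) in fastforce)
  also have "19 * real \<dots> * real CARD('a) ^ (N - N div 2) \<le> 19 * real d * real CARD('a) ^ (N - N div 2)"
    by (intro mult_right_mono mult_left_mono of_nat_mono deg) auto
  also have "(\<Sum>Q\<in>irreds N. real_of_int (residue_symbol (\<Prod>B) Q)) =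
      (\<Sum>Q\<in>irreds N. \<Prod>P\<in>B. real_of_int (residue_symbol P Q))"
  proof (rule sum.cong[OF refl])
    fix Q :: "'a poly" assume "Q \<in> irreds N"
    thus "real_of_int (residue_symbol (\<Prod>B) Q) = (\<Prod>P\<in>B. real_of_int (residue_symbol P Q))"
      using residue_symbol_prod[OF odd irredsD(2), of Q N "\<lambda>x. x" B] by simp
  qed
  finally show ?thesis
    using N by (simp add: field_simps)
qed

text \<open>The weight \<open>w(Q)\<close> detects the primes \<open>Q\<close> with \<open>(P/Q) = \<epsilon>\<close> for all \<open>P\<close> of degree at most
  \<open>n\<close>; averaging the tail over these \<open>Q\<close> shows that it is not too far from \<open>0\<close> on the wrong side
  for one of them.\<close>

lemma exists_prescribed_symbols:
  fixes \<epsilon> :: int and n N :: nat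
  defines "q \<equiv> real CARD('a::{field,finite})"
  defines "K \<equiv> card (\<Union>d\<in>{1..n}. irreds d :: 'a poly set)"
  assumes q1: "CARD('a) mod 4 = 1" and \<epsilon>: "\<epsilon> = 1 \<or> \<epsilon> = -1" and n: "0 < n" "n < N"
    and large: "40 * real N ^ 2 * 2 ^ K * (2 * q ^ n + real N) * q ^ (N - N div 2) < q ^ N"
  shows "\<exists>Q :: 'a poly. Q \<in> irreds N \<and>
    (\<forall>P. monic P \<longrightarrow> irreducible P \<longrightarrow> degree P \<le> n \<longrightarrow> residue_symbol Q P = \<epsilon>) \<and>
    of_int \<epsilon> * (\<Sum>m\<in>{n<..N}. \<Sum>P\<in>irreds m. real_of_int (residue_symbol Q P) / q ^ m) \<ge> - 1 / real n"
proof (rule ccontr)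
  assume contra: "\<not> ?thesis"
  define \<P> where "\<P> = (\<Union>d\<in>{1..n}. irreds d :: 'a poly set)"
  define r where "r = (\<lambda>P Q :: 'a poly. real_of_int (residue_symbol P Q))"
  \<comment> \<open>No symbol vanishes when deg Q = N > n, so on \<open>irreds N\<close> the weight
    is 2^K if all symbols equal \<epsilon>, and 0 otherwise.\<close>
  define w where "w = (\<lambda>Q. \<Prod>P\<in>\<P>. (of_int \<epsilon> * r P Q + 1))"
  define \<tau> where "\<tau> = (\<lambda>Q :: 'a poly. \<Sum>m\<in>{n<..N}. \<Sum>P\<in>irreds m. real_of_int (residue_symbol Q P) / q ^ m)"
  define t where "t = N - N div 2"
  define dg where "dg = (\<Sum>P\<in>\<P>. degree P)"
  define W where "W = (\<Sum>Q\<in>irreds N. w Q)"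
  define e where "e = (of_int \<epsilon> :: real)"
  have odd: "odd CARD('a)"
    using q1 by presburger
  have qgt1: "q > 1"
    unfolding q_def using one_less_card_field[where 'a='a] by simp
  have e: "e = 1 \<or> e = -1" "\<bar>e\<bar> = 1"
    using \<epsilon> by (auto simp: e_def)
  have fin [simp]: "finite \<P>"
    by (simp add: \<P>_def)
  have \<P>: "monic P" "irreducible P" "degree P \<le> n" if "P \<in> \<P>" for P
    using that by (auto simp: \<P>_def dest: irredsD)
  have N: "N > 0"
    using n by simp
  have rbound: "\<bar>r P Q\<bar> \<le> 1" for P Q
    by (simp add: r_def residue_symbol_def)
  have recip: "real_of_int (residue_symbol Q P) = r P Q" if "P \<in> irreds m" "Q \<in> irreds N" for P Q m
    unfolding r_def using residue_symbol_reciprocity[OF q1] irredsD[OF that(1)] irredsD[OF that(2)] by metis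
  have dg_le: "real dg \<le> 2 * q ^ n"
  proof -
    have "dg = (\<Sum>d=1..n. \<Sum>P\<in>irreds d. degree (P :: 'a poly))"
      unfolding dg_def \<P>_def by (intro sum.UNION_disjoint) (auto dest: irredsD(3))
    also have "\<dots> = (\<Sum>d=1..n. d * card (irreds d :: 'a poly set))"
      by (intro sum.cong refl) (simp add: irredsD(3) cong: sum.cong)
    also have "\<dots> \<le> (\<Sum>d=1..n. CARD('a) ^ d)"
      by (intro sum_mono degree_mult_card_irreds_le)
    also have "\<dots> \<le> 2 * CARD('a) ^ n"
      using one_less_card_field[where 'a='a] by (intro sum_power_le) auto
    finally have "real dg \<le> real (2 * CARD('a) ^ n)"
      by (rule of_nat_mono)
    thus ?thesis
      by (simp add: q_def)
  qed

  have expand: "w Q = (\<Sum>A\<in>Pow \<P>. e ^ card A * (\<Prod>P\<in>A. r P Q))" for Q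
    unfolding w_def e_def[symmetric] by (subst prod_add) (simp_all add: prod.distrib)
  have bound: "\<bar>\<Sum>Q\<in>irreds N. \<Prod>P\<in>B. r P Q\<bar> \<le> 19 * (2 * q ^ n + real N) * q ^ t / real N"
    if "finite B" "B \<noteq> {}" "\<And>P. P \<in> B \<Longrightarrow> monic P \<and> irreducible P" "(\<Sum>P\<in>B. degree P) \<le> dg + N" for B
  proof -
    have "\<bar>\<Sum>Q\<in>irreds N. \<Prod>P\<in>B. r P Q\<bar> \<le> 19 * real (dg + N) * q ^ t / real N"
      unfolding r_def q_def t_def by (rule character_sum_prod_bound[OF odd that(1-3) N that(4)])
    also have "\<dots> \<le> 19 * (2 * q ^ n + real N) * q ^ t / real N"
      using dg_le qgt1 by (intro divide_right_mono mult_right_mono mult_left_mono) auto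
    finally show ?thesis .
  qed
  define M where "M = 19 * (2 * q ^ n + real N) * q ^ t / real N"
  have M0: "M \<ge> 0"
    unfolding M_def using qgt1 by (intro divide_nonneg_nonneg mult_nonneg_nonneg add_nonneg_nonneg) auto
  have cardPow: "real (card (Pow \<P>)) = 2 ^ K"
    by (simp add: card_Pow K_def \<P>_def)

  \<comment> \<open>The empty subset gives the main term; every other subset gives a squarefree
    nonconstant product and hence cancellation.\<close>
  have W_ge: "W \<ge> real (card (irreds N :: 'a poly set)) - 2 ^ K * M"
  proof -
    have "W = (\<Sum>A\<in>Pow \<P>. e ^ card A * (\<Sum>Q\<in>irreds N. \<Prod>P\<in>A. r P Q))"
      unfolding W_def expand sum_distrib_left by (rule sum.swap)
    also have "\<dots> = real (card (irreds N :: 'a poly set))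
        + (\<Sum>A\<in>Pow \<P> - {{}}. e ^ card A * (\<Sum>Q\<in>irreds N. \<Prod>P\<in>A. r P Q))"
      by (subst sum.remove[of _ "{}"]) auto
    finally have "W - real (card (irreds N :: 'a poly set)) =
        (\<Sum>A\<in>Pow \<P> - {{}}. e ^ card A * (\<Sum>Q\<in>irreds N. \<Prod>P\<in>A. r P Q))"
      by simp
    also have "\<bar>\<dots>\<bar> \<le> (\<Sum>A\<in>Pow \<P> - {{}}. M)"
    proof (rule order.trans[OF sum_abs sum_mono])
      fix A assume A: "A \<in> Pow \<P> - {{}}"
      hence "finite A"
        using fin by (auto intro: finite_subset)
      moreover have "(\<Sum>P\<in>A. degree P) \<le> dg + N"
        unfolding dg_def using A by (intro trans_le_add1 sum_mono2) auto
      ultimately have "\<bar>\<Sum>Q\<in>irreds N. \<Prod>P\<in>A. r P Q\<bar> \<le> M"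
        unfolding M_def using A \<P> by (intro bound) auto
      thus "\<bar>e ^ card A * (\<Sum>Q\<in>irreds N. \<Prod>P\<in>A. r P Q)\<bar> \<le> M"
        using e by (simp add: abs_mult power_abs)
    qed
    also have "\<dots> \<le> (\<Sum>A\<in>Pow \<P>. M)"
      using M0 by (intro sum_mono2) auto
    also have "\<dots> = 2 ^ K * M"
      using cardPow by simp
    finally show ?thesis
      by linarith
  qed

  have T_le: "\<bar>\<Sum>Q\<in>irreds N. w Q * r P Q\<bar> \<le> 2 ^ K * M" if P: "P \<in> irreds m" "n < m" "m \<le> N" for P m
  proof -
    \<comment> \<open>A prime of degree above n is none of those in the weight, so each product
      stays squarefree and nonconstant: there is no main term.\<close>
    have "P \<notin> \<P>"
      using P \<P>(3)[of P] by (auto dest: irredsD(3))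
    hence ins: "(\<Prod>P'\<in>A. r P' Q) * r P Q = (\<Prod>P'\<in>insert P A. r P' Q)" if "A \<subseteq> \<P>" for A Q
      using that finite_subset[OF that fin] by (subst prod.insert) auto
    have "(\<Sum>Q\<in>irreds N. w Q * r P Q) =
        (\<Sum>Q\<in>irreds N. \<Sum>A\<in>Pow \<P>. e ^ card A * (\<Prod>P'\<in>insert P A. r P' Q))"
      unfolding expand sum_distrib_right by (intro sum.cong refl) (simp add: ins mult.assoc)
    also have "\<dots> = (\<Sum>A\<in>Pow \<P>. e ^ card A * (\<Sum>Q\<in>irreds N. \<Prod>P'\<in>insert P A. r P' Q))"
      unfolding sum_distrib_left by (rule sum.swap)
    also have "\<bar>\<dots>\<bar> \<le> (\<Sum>A\<in>Pow \<P>. M)"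
    proof (rule order.trans[OF sum_abs sum_mono])
      fix A assume A: "A \<in> Pow \<P>"
      hence finA: "finite A"
        using fin by (auto intro: finite_subset)
      have "(\<Sum>P\<in>A. degree P) \<le> dg"
        unfolding dg_def using A by (intro sum_mono2) auto
      hence "(\<Sum>P\<in>insert P A. degree P) \<le> dg + N"
        using finA A \<open>P \<notin> \<P>\<close> P irredsD(3)[OF P(1)] by (subst sum.insert) auto
      hence "\<bar>\<Sum>Q\<in>irreds N. \<Prod>P'\<in>insert P A. r P' Q\<bar> \<le> M"
        unfolding M_def using A \<P> finA irredsD[OF P(1)] by (intro bound) auto
      thus "\<bar>e ^ card A * (\<Sum>Q\<in>irreds N. \<Prod>P'\<in>insert P A. r P' Q)\<bar> \<le> M"
        using e by (simp add: abs_mult power_abs)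
    qed
    also have "\<dots> = 2 ^ K * M"
      using cardPow by simp
    finally show ?thesis .
  qed

  have \<tau>_le: "\<bar>\<Sum>Q\<in>irreds N. w Q * \<tau> Q\<bar> \<le> real N * (2 ^ K * M)"
  proof -
    have "(\<Sum>Q\<in>irreds N. w Q * \<tau> Q) =
        (\<Sum>Q\<in>irreds N. \<Sum>m\<in>{n<..N}. \<Sum>P\<in>irreds m. w Q * r P Q / q ^ m)"
      unfolding \<tau>_def sum_distrib_left
      by (intro sum.cong refl) (simp add: recip)
    also have "\<dots> = (\<Sum>m\<in>{n<..N}. \<Sum>Q\<in>irreds N. \<Sum>P\<in>irreds m. w Q * r P Q / q ^ m)"
      by (rule sum.swap)
    also have "\<dots> = (\<Sum>m\<in>{n<..N}. \<Sum>P\<in>irreds m. (\<Sum>Q\<in>irreds N. w Q * r P Q) / q ^ m)"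
      unfolding sum_divide_distrib by (intro sum.cong refl sum.swap)
    also have "\<bar>\<dots>\<bar> \<le> (\<Sum>m\<in>{n<..N}. 2 ^ K * M)"
    proof (rule order.trans[OF sum_abs sum_mono])
      fix m assume m: "m \<in> {n<..N}"
      have "\<bar>\<Sum>P\<in>irreds m. (\<Sum>Q\<in>irreds N. w Q * r P Q) / q ^ m\<bar> \<le> (\<Sum>P\<in>(irreds m :: 'a poly set). 2 ^ K * M / q ^ m)"
      proof (rule order.trans[OF sum_abs sum_mono])
        fix P :: "'a poly" assume "P \<in> irreds m"
        thus "\<bar>(\<Sum>Q\<in>irreds N. w Q * r P Q) / q ^ m\<bar> \<le> 2 ^ K * M / q ^ m"
          using T_le[of P m] m qgt1 by (simp add: divide_right_mono)
      qed
      also have "\<dots> = real (card (irreds m :: 'a poly set)) * (2 ^ K * M / q ^ m)"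
        by simp
      also have "\<dots> \<le> q ^ m * (2 ^ K * M / q ^ m)"
      proof (rule mult_right_mono)
        have "1 * card (irreds m :: 'a poly set) \<le> m * card (irreds m :: 'a poly set)"
          using m by (intro mult_le_mono1) auto
        also have "\<dots> \<le> CARD('a) ^ m"
          by (rule degree_mult_card_irreds_le)
        finally have "real (card (irreds m :: 'a poly set)) \<le> real (CARD('a) ^ m)"
          by simp
        thus "real (card (irreds m :: 'a poly set)) \<le> q ^ m"
          by (simp add: q_def)
        show "0 \<le> 2 ^ K * M / q ^ m"
          using M0 qgt1 by simp
      qed
      also have "\<dots> = 2 ^ K * M"
        using qgt1 by simp
      finally show "\<bar>\<Sum>P\<in>irreds m. (\<Sum>Q\<in>irreds N. w Q * r P Q) / q ^ m\<bar> \<le> 2 ^ K * M" .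
    qed
    also have "\<dots> \<le> real N * (2 ^ K * M)"
      using M0 by (simp add: mult_right_mono)
    finally show ?thesis .
  qed

  \<comment> \<open>A nonzero weight forces the prescribed symbols, and then the negated claim makes
    the bracket negative. Summation over Q bounds W by n times the weighted tail, which is too
    small.\<close>
  have "w Q * (e * \<tau> Q + 1 / real n) \<le> 0" if Q: "Q \<in> irreds N" for Q
  proof (cases "w Q = 0")
    case False
    have w0: "w Q \<ge> 0"
      unfolding w_def e_def[symmetric]
    proof (rule prod_nonneg)
      fix P assume "P \<in> \<P>"
      show "0 \<le> e * r P Q + 1"
        using e rbound[of P Q] by auto
    qed
    have "residue_symbol Q P = \<epsilon>" if P: "monic P" "irreducible P" "degree P \<le> n" for P
    proof -
      have mem: "P \<in> irreds (degree P)" "P \<in> \<P>"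
        using P irreducible_imp_degree_pos[OF P(2)] by (auto simp: \<P>_def irreds_def)
      have "e * r P Q + 1 \<noteq> 0"
        using False mem(2) unfolding w_def e_def by (auto simp: prod_zero_iff)
      moreover have "r P Q \<noteq> 0"
      proof
        assume "r P Q = 0"
        hence "Q dvd P"
          by (simp add: r_def residue_symbol_eq_0_iff)
        moreover have "P \<noteq> 0"
          using P by auto
        ultimately have "degree Q \<le> degree P"
          by (intro dvd_imp_degree_le)
        thus False
          using P n irredsD(3)[OF Q] by simp
      qed
      ultimately have "r P Q = e"
        using e residue_symbol_cases[of P Q] by (auto simp: r_def)
      thus ?thesis
        using recip[OF mem(1) Q] by (simp add: e_def)
    qed
    hence "\<not> e * \<tau> Q \<ge> - 1 / real n"
      using contra Q unfolding \<tau>_def e_def by blast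
    hence "e * \<tau> Q + 1 / real n \<le> 0"
      by simp
    thus ?thesis
      using w0 by (simp add: mult_nonneg_nonpos)
  qed simp
  hence "(\<Sum>Q\<in>irreds N. w Q * (e * \<tau> Q + 1 / real n)) \<le> 0"
    by (intro sum_nonpos) auto
  also have "(\<Sum>Q\<in>irreds N. w Q * (e * \<tau> Q + 1 / real n)) = e * (\<Sum>Q\<in>irreds N. w Q * \<tau> Q) + W / real n"
    unfolding W_def by (simp add: algebra_simps sum.distrib sum_distrib_left sum_divide_distrib)
  finally have "W / real n \<le> - (e * (\<Sum>Q\<in>irreds N. w Q * \<tau> Q))"
    by linarith
  also have "\<dots> \<le> \<bar>\<Sum>Q\<in>irreds N. w Q * \<tau> Q\<bar>"
    using e by auto
  also have "\<dots> \<le> real N * (2 ^ K * M)"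
    by (rule \<tau>_le)
  finally have "W \<le> real n * (real N * (2 ^ K * M))"
    using n by (simp add: field_simps)
  also have "\<dots> \<le> (real N - 1) * (real N * (2 ^ K * M))"
    using n M0 by (intro mult_right_mono) auto
  finally have "real (card (irreds N :: 'a poly set)) \<le> (real N - 1) * (real N * (2 ^ K * M)) + 2 ^ K * M"
    using W_ge by linarith
  also have "\<dots> \<le> (real N - 1) * (real N * (2 ^ K * M)) + real N * (2 ^ K * M)"
    using N M0 mult_right_mono[of 1 "real N" "2 ^ K * M"] by simp
  also have "\<dots> = real N ^ 2 * (2 ^ K * M)"
    by (simp add: algebra_simps power2_eq_square)
  finally have "real N * real (card (irreds N :: 'a poly set)) \<le> real N * (real N ^ 2 * (2 ^ K * M))"
    by (intro mult_left_mono) auto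
  also have "\<dots> = 19 * (real N ^ 2 * 2 ^ K * (2 * q ^ n + real N) * q ^ t)"
    unfolding M_def using N by (simp add: mult_ac)
  finally have 1: "q ^ N - 2 * q ^ (N div 2) \<le> 19 * (real N ^ 2 * 2 ^ K * (2 * q ^ n + real N) * q ^ t)"
    using degree_mult_card_irreds_ge[where 'a='a, OF N] by (simp add: q_def)
  \<comment> \<open>The secondary term 2 q^(N div 2) is absorbed as well, so 21 in place of 19
    results, within the 40 of the assumption.\<close>
  have "1 * 1 * 1 * q ^ (N div 2) \<le> real N ^ 2 * 2 ^ K * (2 * q ^ n + real N) * q ^ t"
  proof (intro mult_mono)
    show "q ^ (N div 2) \<le> q ^ t"
      unfolding t_def using qgt1 by (intro power_increasing) auto
    show "1 \<le> real N ^ 2"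
      using N by simp
    show "1 \<le> 2 * q ^ n + real N"
      using N qgt1 by (intro add_increasing) auto
  qed (use qgt1 in auto)
  moreover have "0 \<le> q ^ (N div 2)"
    using qgt1 by simp
  ultimately have "q ^ N \<le> 40 * (real N ^ 2 * 2 ^ K * (2 * q ^ n + real N) * q ^ t)"
    using 1 by linarith
  thus False
    using large unfolding t_def mult.assoc by linarith
qed

section \<open>Extreme values\<close>

text \<open>The constant 4 reproduces itself: 4 / n \<le> 3 q / (n + 1) leaves room for the new
  term.\<close>

lemma sum_power_div_le:
  fixes q :: real
  assumes q: "q \<ge> 4" and n: "n > 0"
  shows "(\<Sum>d=1..n. q ^ d / real d) \<le> 4 * q ^ n / real n"
  using n
proof (induction n rule: nat_induct_non_zero)
  case 1
  thus ?case using q by simp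
next
  case (Suc n)
  have "4 * (real n + 1) \<le> 3 * q * real n"
  proof -
    define z where "z = q * real n"
    have "4 * real n \<le> z"
      unfolding z_def using q by (intro mult_right_mono) auto
    moreover have "real n \<ge> 1"
      using Suc.hyps by simp
    ultimately have "4 * real n + 4 \<le> 3 * z"
      by linarith
    thus ?thesis
      by (simp add: z_def)
  qed
  hence "4 * (real n + 1) * q ^ n \<le> 3 * q * real n * q ^ n"
    using q by (intro mult_right_mono) auto
  hence "4 * q ^ n * real (Suc n) \<le> 3 * q ^ Suc n * real n"
    by (simp add: mult_ac add.commute)
  hence "4 * q ^ n / real n \<le> 3 * q ^ Suc n / real (Suc n)"
    using Suc.hyps by (subst pos_divide_le_eq) (simp_all only: times_divide_eq_left pos_le_divide_eq of_nat_0_less_iff zero_less_Suc)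
  moreover have "(\<Sum>d=1..Suc n. q ^ d / real d) = (\<Sum>d=1..n. q ^ d / real d) + q ^ Suc n / real (Suc n)"
    by simp
  moreover have "3 * q ^ Suc n / real (Suc n) + q ^ Suc n / real (Suc n) = 4 * q ^ Suc n / real (Suc n)"
    by (simp flip: add_divide_distrib)
  ultimately show ?case
    using Suc.IH by linarith
qed

lemma card_irreds_up_to_le:
  assumes "CARD('a::{field,finite}) \<ge> 4" "n > 0"
  shows "real (card (\<Union>d\<in>{1..n}. irreds d :: 'a poly set)) \<le> 4 * real CARD('a) ^ n / real n"
proof -
  have "real (card (\<Union>d\<in>{1..n}. irreds d :: 'a poly set)) \<le> real (\<Sum>d=1..n. card (irreds d :: 'a poly set))"
    by (intro of_nat_mono card_UN_le) auto
  also have "\<dots> \<le> (\<Sum>d=1..n. real CARD('a) ^ d / real d)"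
    unfolding of_nat_sum
  proof (rule sum_mono)
    fix d assume d: "d \<in> {1..n}"
    have "real (d * card (irreds d :: 'a poly set)) \<le> real (CARD('a) ^ d)"
      by (intro of_nat_mono degree_mult_card_irreds_le)
    hence "real (card (irreds d :: 'a poly set)) * real d \<le> real CARD('a) ^ d"
      by (simp add: mult.commute)
    thus "real (card (irreds d :: 'a poly set)) \<le> real CARD('a) ^ d / real d"
      using d by (subst pos_le_divide_eq) auto
  qed
  also have "\<dots> \<le> 4 * real CARD('a) ^ n / real n"
    using assms by (intro sum_power_div_le) auto
  finally show ?thesis .
qed

text \<open>The cutoff \<open>n\<close> is as large as \<open>8 q\<^sup>n \<le> N n\<close> permits, up to \<open>O(1)\<close>: this keeps the number of
  conditions \<open>(P/Q) = \<epsilon>\<close> below \<open>N / 2\<close>.\<close>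

lemma exists_cutoff:
  fixes q :: real
  assumes q: "q \<ge> 5" and N: "log q (log q (real N)) \<ge> 50" "2 * log q (real N) < real N"
  shows "\<exists>n>0. n < N \<and> 8 * q ^ n \<le> real N * real n \<and>
    real n \<ge> log q (real N) + log q (log q (real N)) - 3"
proof -
  define x where "x = log q (real N)"
  define y where "y = log q x"
  \<comment> \<open>q^(x+y) = N log N. Subtracting 2 gains q^2 \<ge> 25, more than the required 8,
    and rounding down costs at most 1.\<close>
  define n where "n = nat \<lfloor>x + y\<rfloor> - 2"
  have y: "y \<ge> 50"
    using N by (simp add: y_def x_def)
  have lnq: "ln q \<ge> 1"
    using q exp_le by (intro ln_ge_iff[THEN iffD2]) auto
  \<comment> \<open>The degenerate cases N = 0 and x = 0 are excluded through the default
    \<open>ln 0 = 0\<close>, which would make y = 0.\<close>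
  have N0: "real N > 0"
  proof (rule ccontr)
    assume "\<not> real N > 0"
    hence "x = 0"
      by (simp add: x_def log_def)
    thus False
      using y by (simp add: y_def log_def)
  qed
  have x0: "x > 0"
  proof (rule ccontr)
    assume "\<not> x > 0"
    moreover have "x < 0 \<Longrightarrow> False"
      using N0 q unfolding x_def by (cases "N = 0") (auto simp: log_less_zero_cancel_iff)
    ultimately have "x = 0"
      by (meson linorder_neqE_linordered_idom)
    thus False
      using y by (simp add: y_def log_def)
  qed
  have yx: "y \<le> x"
  proof (cases "x \<ge> 1")
    case True
    have "y = ln x / ln q"
      by (simp add: y_def log_def)
    also have "\<dots> \<le> ln x / 1"
      using True lnq by (intro divide_left_mono) auto
    also have "\<dots> \<le> x"
      using ln_le_minus_one[OF x0] by simp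
    finally show ?thesis .
  next
    case False
    hence "y \<le> 0"
      using x0 q by (simp add: y_def)
    thus ?thesis
      using y by simp
  qed
  have n: "real n \<ge> x + y - 3" "real n \<le> x + y - 2"
    unfolding n_def using y x0 by linarith+
  have "q ^ n = q powr real n"
    using q by (simp add: powr_realpow)
  also have "\<dots> \<le> q powr (x + y - 2)"
    using n q by (intro powr_mono) auto
  also have "\<dots> = q powr x * q powr y / q ^ 2"
    using q by (simp add: powr_diff powr_add powr_numeral)
  also have "q powr x = real N"
    unfolding x_def using q N0 by (intro powr_log_cancel) auto
  also have "q powr y = x"
    unfolding y_def using q x0 by (intro powr_log_cancel) auto
  also have "real N * x / q ^ 2 \<le> real N * x / 5 ^ 2"
    using q N0 x0 by (intro divide_left_mono power_mono mult_pos_pos) auto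
  finally have "25 * q ^ n \<le> real N * x"
    by simp
  moreover have "0 \<le> q ^ n"
    using q by simp
  ultimately have "8 * q ^ n \<le> real N * x"
    by linarith
  also have "\<dots> \<le> real N * real n"
    using n y by (intro mult_left_mono) auto
  finally have "8 * q ^ n \<le> real N * real n" .
  moreover have "0 < n" "n < N"
    using n y yx N(2) x0 by (auto simp flip: x_def)
  ultimately show ?thesis
    using n by (auto simp: x_def y_def)
qed

text \<open>The 8 in the cutoff gives K \<le> N / 2. Then 2^K costs one factor 2^(N/2) and the
  polynomial factors, at most 120 N^4, cost another; together they stay below 4^(N div 2) \<le> q^(N
  div 2).\<close>

lemma exists_cutoff_imp_large:
  fixes q :: real
  assumes q: "q \<ge> 4" and n: "n < N" "8 * q ^ n \<le> real N * real n"
    and K: "real K \<le> 4 * q ^ n / real n" and N: "120 * real N ^ 4 < 2 ^ (N div 2)"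
  shows "40 * real N ^ 2 * 2 ^ K * (2 * q ^ n + real N) * q ^ (N - N div 2) < q ^ N"
proof -
  have n0: "n > 0"
  proof (rule ccontr)
    assume "\<not> n > 0"
    thus False
      using n q by simp
  qed
  have "4 * q ^ n / real n \<le> real N / 2"
    using n n0 by (simp add: field_simps)
  hence "K \<le> N div 2"
    using K by linarith
  hence K2: "(2::real) ^ K \<le> 2 ^ (N div 2)"
    by (intro power_increasing) auto
  have "real N * real n \<le> real N * real N"
    using n by (intro mult_left_mono) auto
  moreover have "q ^ n \<ge> 0"
    using q by simp
  ultimately have "2 * q ^ n \<le> real N ^ 2"
    using n(2) unfolding power2_eq_square by linarith
  moreover have "real N * 1 \<le> real N * real N"
    using n by (intro mult_left_mono) auto
  hence "real N \<le> real N ^ 2"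
    by (simp add: power2_eq_square)
  ultimately have "2 * q ^ n + real N \<le> 3 * real N ^ 2"
    by linarith
  hence "40 * real N ^ 2 * 2 ^ K * (2 * q ^ n + real N) \<le> 40 * real N ^ 2 * 2 ^ (N div 2) * (3 * real N ^ 2)"
    using K2 q by (intro mult_mono) auto
  also have "\<dots> = 120 * real N ^ 4 * 2 ^ (N div 2)"
    by (simp add: power2_eq_square power4_eq_xxxx)
  also have "\<dots> < 2 ^ (N div 2) * 2 ^ (N div 2)"
    using N by (intro mult_strict_right_mono) auto
  also have "\<dots> = 4 ^ (N div 2)"
    by (simp flip: power_mult_distrib)
  also have "\<dots> \<le> q ^ (N div 2)"
    using q by (intro power_mono) auto
  finally have "40 * real N ^ 2 * 2 ^ K * (2 * q ^ n + real N) * q ^ (N - N div 2) < q ^ (N div 2) * q ^ (N - N div 2)"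
    using q by (intro mult_strict_right_mono) auto
  thus ?thesis
    by (simp flip: power_add)
qed

lemma eventually_large:
  fixes q :: real
  assumes "q > 1"
  shows "\<forall>\<^sub>F N in sequentially. log q (log q (real N)) \<ge> 50 \<and> 2 * log q (real N) < real N \<and>
    120 * real N ^ 4 < 2 ^ (N div 2)"
proof (intro eventually_conj)
  have pos: "ln q > 0"
    using assms by simp
  have "filterlim (\<lambda>N. log q (log q (real N))) at_top sequentially"
    unfolding log_def using pos by real_asymp
  thus "\<forall>\<^sub>F N in sequentially. log q (log q (real N)) \<ge> 50"
    unfolding filterlim_at_top by blast
  show "\<forall>\<^sub>F N in sequentially. 2 * log q (real N) < real N"
    unfolding log_def using pos by real_asymp
  \<comment> \<open>The rounded exponent \<open>N div 2\<close> is first replaced by its lower bound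
    (N - 1) / 2.\<close>
  have "\<forall>\<^sub>F N in sequentially. 120 * real N ^ 4 < 2 powr ((real N - 1) / 2)"
    by real_asymp
  thus "\<forall>\<^sub>F N in sequentially. 120 * real N ^ 4 < 2 ^ (N div 2)"
  proof eventually_elim
    case (elim N)
    have "2 powr ((real N - 1) / 2) \<le> 2 powr real (N div 2)"
    proof (rule powr_mono)
      have "N \<le> 2 * (N div 2) + 1"
        by presburger
      hence "real N \<le> real (2 * (N div 2) + 1)"
        by (rule of_nat_mono)
      thus "(real N - 1) / 2 \<le> real (N div 2)"
        by simp
    qed simp
    also have "\<dots> = 2 ^ (N div 2)"
      by (simp add: powr_realpow)
    finally show ?case
      using elim by linarith
  qed
qed

theorem theorem1p6:
  assumes "CARD('a::{field,finite}) mod 4 = 1"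
  shows "\<exists>C::real. \<forall>\<^sub>F N in sequentially.
    \<exists>(Q1 :: 'a poly) (Q2 :: 'a poly) (E1 :: real) (E2 :: real).
      irreducible Q1 \<and> degree Q1 = N \<and> irreducible Q2 \<and> degree Q2 = N \<and>
      \<bar>E1\<bar> \<le> C \<and> \<bar>E2\<bar> \<le> C \<and>
      L_chi 1 Q1 \<ge> exp euler_mascheroni *
        (iter_log (real CARD('a)) 2 (poly_abs Q1) + iter_log (real CARD('a)) 3 (poly_abs Q1)) + E1 \<and>
      L_chi 1 Q2 \<le> zeta_poly TYPE('a) 2 * exp (- euler_mascheroni) *
        inverse (iter_log (real CARD('a)) 2 (poly_abs Q1) + iter_log (real CARD('a)) 3 (poly_abs Q1) + E2)"
proof -
  define q where "q = real CARD('a)"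
  define G where "G = exp (euler_mascheroni :: real)"
  have card: "CARD('a) \<ge> 5" "odd CARD('a)"
    using assms one_less_card_field[where 'a='a] by presburger+
  have q: "q \<ge> 5"
    using card by (simp add: q_def)
  have G: "G \<ge> 1"
    using euler_mascheroni_pos by (simp add: G_def)
  have "\<forall>\<^sub>F N in sequentially. \<exists>(Q1 :: 'a poly) (Q2 :: 'a poly) (E1 :: real) (E2 :: real).
      irreducible Q1 \<and> degree Q1 = N \<and> irreducible Q2 \<and> degree Q2 = N \<and>
      \<bar>E1\<bar> \<le> 46 * G \<and> \<bar>E2\<bar> \<le> 46 * G \<and>
      L_chi 1 Q1 \<ge> G * (iter_log q 2 (poly_abs Q1) + iter_log q 3 (poly_abs Q1)) + E1 \<and>
      L_chi 1 Q2 \<le> zeta_poly TYPE('a) 2 * exp (- euler_mascheroni) *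
        inverse (iter_log q 2 (poly_abs Q1) + iter_log q 3 (poly_abs Q1) + E2)"
    using eventually_large[of q]
  proof (rule eventually_mono)
    fix N assume N: "log q (log q (real N)) \<ge> 50 \<and> 2 * log q (real N) < real N \<and> 120 * real N ^ 4 < 2 ^ (N div 2)"
    define Y where "Y = log q (real N) + log q (log q (real N))"
    obtain n where n: "0 < n" "n < N" "8 * q ^ n \<le> real N * real n" "real n \<ge> Y - 3"
      using exists_cutoff[OF q, of N] N unfolding Y_def by blast
    have "log q (real N) \<ge> 0"
      using n q by simp
    \<comment> \<open>50 exceeds the total loss 46 below, so Y - 46 is positive and inverses can be
      compared.\<close>
    hence Y: "Y \<ge> 50"
      using N by (simp add: Y_def)
    \<comment> \<open>The iterated logarithms depend on the degree alone, so |Q1| may stand in the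
      bound for Q2.\<close>
    have Y_eq: "iter_log q 2 (poly_abs Q) + iter_log q 3 (poly_abs Q) = Y" if "degree Q = N" for Q :: "'a poly"
    proof -
      have "log q (q ^ N) = real N"
        using q by (simp add: log_nat_power)
      thus ?thesis
        using that by (simp add: iter_log_def poly_abs_def q_def[symmetric] Y_def numeral_2_eq_2 numeral_3_eq_3)
    qed
    define T where "T = (\<lambda>Q :: 'a poly. \<Sum>m\<in>{n<..N}. \<Sum>P\<in>irreds m. real_of_int (residue_symbol Q P) / q ^ m)"
    define H where "H = (\<lambda>Q :: 'a poly. \<Sum>m=1..n. mangoldt_sum (\<lambda>f. real_of_int (kronecker_symbol Q f)) m / (real m * q ^ m))"
    have "40 * real N ^ 2 * 2 ^ card (\<Union>d\<in>{1..n}. irreds d :: 'a poly set) * (2 * q ^ n + real N) * q ^ (N - N div 2) < q ^ N"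
      by (rule exists_cutoff_imp_large)
        (use q n N card card_irreds_up_to_le[where 'a='a, of n] in \<open>auto simp: q_def\<close>)
    note large = this[unfolded q_def]
    have ex: "\<exists>Q :: 'a poly. Q \<in> irreds N \<and>
        (\<forall>P. monic P \<longrightarrow> irreducible P \<longrightarrow> degree P \<le> n \<longrightarrow> residue_symbol Q P = \<epsilon>) \<and>
        of_int \<epsilon> * T Q \<ge> - 1 / real n" if "\<epsilon> = 1 \<or> \<epsilon> = -1" for \<epsilon> :: int
      unfolding T_def q_def by (rule exists_prescribed_symbols[OF assms that n(1,2) large])
    have approx: "\<exists>S. L_chi 1 Q = exp S \<and> \<bar>S - H Q - T Q\<bar> \<le> 42 / real n" if "Q \<in> irreds N" for Q :: "'a poly"
      unfolding H_def T_def q_def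
      by (rule L_chi_approx) (use card n irredsD[OF that] in auto)
    have harm: "harm n \<ge> ln (real n) + euler_mascheroni"
      using n by (intro harm_ge_ln_euler)
    \<comment> \<open>43 is 42 from \<open>L_chi_approx\<close> plus 1 from the averaged tail, and
      the 3 lost in the cutoff makes 46. The linear bound for exp converts the error 43 / n in the
      exponent into an additive constant.\<close>
    have "1 - 43 / real n \<le> exp (- (43 / real n))"
      using exp_ge_add_one_self[of "- (43 / real n)"] by simp
    hence "real n * (1 - 43 / real n) \<le> real n * exp (- (43 / real n))"
      by (intro mult_left_mono) auto
    hence n_exp: "Y - 46 \<le> real n * exp (- (43 / real n))"
      using n by (simp add: right_diff_distrib)

    obtain Q1 :: "'a poly" where Q1: "Q1 \<in> irreds N" "T Q1 \<ge> - 1 / real n"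
      and sym1: "\<And>P. monic P \<Longrightarrow> irreducible P \<Longrightarrow> degree P \<le> n \<Longrightarrow> residue_symbol Q1 P = 1"
      using ex[of 1] by auto
    obtain S1 where S1: "L_chi 1 Q1 = exp S1" "\<bar>S1 - H Q1 - T Q1\<bar> \<le> 42 / real n"
      using approx[OF Q1(1)] by blast
    have "H Q1 = harm n"
      unfolding H_def q_def by (rule head_plus) (simp add: kronecker_symbol_irreducible sym1)
    hence "S1 \<ge> ln (real n) + euler_mascheroni + - (43 / real n)"
      using S1(2) Q1(2) harm by (simp add: abs_le_iff)
    hence "exp (ln (real n) + euler_mascheroni + - (43 / real n)) \<le> L_chi 1 Q1"
      unfolding S1 by simp
    also have "exp (ln (real n) + euler_mascheroni + - (43 / real n)) = G * (real n * exp (- (43 / real n)))"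
      unfolding exp_add using n by (simp add: G_def)
    finally have "G * (real n * exp (- (43 / real n))) \<le> L_chi 1 Q1" .
    moreover have "G * (Y - 46) \<le> G * (real n * exp (- (43 / real n)))"
      using n_exp G by (intro mult_left_mono) auto
    ultimately have L1: "G * Y + - (46 * G) \<le> L_chi 1 Q1"
      by (simp add: right_diff_distrib)

    obtain Q2 :: "'a poly" where Q2: "Q2 \<in> irreds N" "- T Q2 \<ge> - 1 / real n"
      and sym2: "\<And>P. monic P \<Longrightarrow> irreducible P \<Longrightarrow> degree P \<le> n \<Longrightarrow> residue_symbol Q2 P = -1"
      using ex[of "-1"] by auto
    obtain S2 where S2: "L_chi 1 Q2 = exp S2" "\<bar>S2 - H Q2 - T Q2\<bar> \<le> 42 / real n"
      using approx[OF Q2(1)] by blast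
    have "H Q2 \<le> - harm n - ln (1 - 1 / q)"
      unfolding H_def q_def by (rule head_minus) (simp add: kronecker_symbol_irreducible sym2)
    hence "S2 \<le> - (ln (real n) + euler_mascheroni + - (43 / real n)) - ln (1 - 1 / q)"
      using S2(2) Q2(2) harm by (simp add: abs_le_iff)
    hence "L_chi 1 Q2 \<le> exp (- (ln (real n) + euler_mascheroni + - (43 / real n)) - ln (1 - 1 / q))"
      unfolding S2 by simp
    also have "\<dots> = 1 / (1 - 1 / q) * exp (- euler_mascheroni) * inverse (real n * exp (- (43 / real n)))"
    proof -
      have "1 - 1 / q > 0"
        using q by simp
      hence "exp (- ln (1 - 1 / q)) = 1 / (1 - 1 / q)"
        by (simp add: exp_minus inverse_eq_divide)
      moreover have "exp (- ln (real n)) = inverse (real n)"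
        using n by (simp add: exp_minus)
      moreover have "- (ln (real n) + euler_mascheroni + - (43 / real n)) - ln (1 - 1 / q)
          = - ln (1 - 1 / q) + - euler_mascheroni + (- ln (real n) + - (- (43 / real n)))"
        by simp
      ultimately show ?thesis
        by (simp only: exp_add exp_minus[of "- (43 / real n)"] inverse_mult_distrib)
    qed
    also have "\<dots> \<le> zeta_poly TYPE('a) 2 * exp (- euler_mascheroni) * inverse (Y - 46)"
    proof (intro mult_mono)
      show "1 / (1 - 1 / q) \<le> zeta_poly TYPE('a) 2"
        unfolding q_def by (rule zeta_poly_2_ge)
      moreover have "0 \<le> 1 / (1 - 1 / q)"
        using q by simp
      ultimately show *: "0 \<le> zeta_poly TYPE('a) 2"
        by linarith
      show "0 \<le> zeta_poly TYPE('a) 2 * exp (- euler_mascheroni)"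
        using * by (intro mult_nonneg_nonneg) simp_all
      show "inverse (real n * exp (- (43 / real n))) \<le> inverse (Y - 46)"
        using Y n_exp by (intro le_imp_inverse_le) auto
    qed auto
    finally have L2: "L_chi 1 Q2 \<le> zeta_poly TYPE('a) 2 * exp (- euler_mascheroni) * inverse (Y + - 46)"
      by simp
    show "\<exists>(Q1 :: 'a poly) (Q2 :: 'a poly) (E1 :: real) (E2 :: real).
      irreducible Q1 \<and> degree Q1 = N \<and> irreducible Q2 \<and> degree Q2 = N \<and>
      \<bar>E1\<bar> \<le> 46 * G \<and> \<bar>E2\<bar> \<le> 46 * G \<and>
      L_chi 1 Q1 \<ge> G * (iter_log q 2 (poly_abs Q1) + iter_log q 3 (poly_abs Q1)) + E1 \<and>
      L_chi 1 Q2 \<le> zeta_poly TYPE('a) 2 * exp (- euler_mascheroni) *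
        inverse (iter_log q 2 (poly_abs Q1) + iter_log q 3 (poly_abs Q1) + E2)"
    \<comment> \<open>The first error carries the factor G = exp \<gamma>, the second does not; G
      \<ge> 1 puts both under 46 G.\<close>
    proof (rule exI[of _ Q1], rule exI[of _ Q2], rule exI[of _ "- (46 * G)"], rule exI[of _ "- 46"], intro conjI)
      show "L_chi 1 Q1 \<ge> G * (iter_log q 2 (poly_abs Q1) + iter_log q 3 (poly_abs Q1)) + - (46 * G)"
        unfolding Y_eq[OF irredsD(3)[OF Q1(1)]] by (rule L1)
      show "L_chi 1 Q2 \<le> zeta_poly TYPE('a) 2 * exp (- euler_mascheroni) *
        inverse (iter_log q 2 (poly_abs Q1) + iter_log q 3 (poly_abs Q1) + - 46)"
        unfolding Y_eq[OF irredsD(3)[OF Q1(1)]] by (rule L2)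
    qed (use irredsD[OF Q1(1)] irredsD[OF Q2(1)] G in auto)
  qed (use q in simp)
  thus ?thesis
    unfolding q_def G_def by blast
qed

end
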